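(* Let $\Gamma=(\mathcal{C},\mathcal{X},H,I,\eta,\epsilon,\mathcal{E},\mathcal{F})$ be an admissible Galois structure on a finitely complete pointed category $\mathcal{C}$, with $H$ the inclusion of a full reflective subcategory $\mathcal{X}$, such that monadic extensions are pullback-stable and every object of $\mathcal{C}$ admits a weakly universal normal extension into it. Then the fundamental group functor $\pi_1(-,I)\colon\mathcal{C}\to\mathsf{Gp}(\mathcal{X})$ together with the natural transformation $\kappa\colon\pi_1(-,I)\circ\mathrm{Cod}\Rightarrow\mathrm{Gal}_\Gamma(-,0)$ is a (right) Kan extension of the Galois group functor $\mathrm{Gal}_\Gamma(-,0)\colon\mathsf{NExt}_\Gamma(\mathcal{C})\to\mathsf{Gp}(\mathcal{X})$ along $\mathrm{Cod}\colon\mathsf{NExt}_\Gamma(\mathcal{C})\to\mathcal{C}$; that is, for every functor $F\colon\mathcal{C}\to\mathsf{Gp}(\mathcal{X})$ and every natural transformation $\gamma\colon F\circ\mathrm{Cod}\Rightarrow\mathrm{Gal}_\Gamma(-,0)$ there is a unique natural transformation $\alpha\colon F\Rightarrow\pi_1(-,I)$ with $\kappa\circ\alpha_{\mathrm{Cod}}=\gamma$.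
   Context: **Galois structures.** A Galois structure $\Gamma=(\mathcal{C},\mathcal{X},H,I,\eta,\epsilon,\mathcal{E},\mathcal{F})$ on a category $\mathcal{C}$ is an adjunction $I\dashv H$, $I\colon\mathcal{C}\to\mathcal{X}$, $H\colon\mathcal{X}\to\mathcal{C}$, with unit $\eta\colon 1_{\mathcal{C}}\Rightarrow HI$ and counit $\epsilon\colon IH\Rightarrow 1_{\mathcal{X}}$, together with classes of morphisms $\mathcal{E}$ in $\mathcal{C}$ and $\mathcal{F}$ in $\mathcal{X}$ such that: (i) both contain all isomorphisms; (ii) both are pullback-stable (the pullback of a morphism in the class along any morphism exists and is in the class); (iii) both are closed under composition; (iv) $H(\mathcal{F})\subseteq\mathcal{E}$; (v) $I(\mathcal{E})\subseteq\mathcal{F}$. Morphisms in $\mathcal{E}$ are called fibrations. $(\mathcal{E}\downarrow B)$ denotes the full subcategory of the slice category $(\mathcal{C}\downarrow B)$ on morphisms in $\mathcal{E}$, and similarly $(\mathcal{F}\downarrow X)$. For $B\in\mathcal{C}$ let $H^B\colon(\mathcal{F}\downarrow I(B))\to(\mathcal{E}\downarrow B)$ send $g$ to the pullback of $H(g)$ along $\eta_B\colon B\to HI(B)$; $\Gamma$ is admissible when all $H^B$ are full and faithful. A trivial covering is a fibration $f\colon A\to B$ for which the naturality square of $\eta$ at $f$ (i.e. $HI(f)\circ\eta_A=\eta_B\circ f$) is a pullback. A monadic extension is a fibration $p\colon E\to B$ such that the pullback functor $p^*\colon(\mathcal{E}\downarrow B)\to(\mathcal{E}\downarrow E)$ is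 monadic. A normal extension is a monadic extension $p$ such that $p^*(p)$ is a trivial covering, i.e. a monadic extension whose kernel pair projections are trivial coverings. $\mathsf{NExt}_\Gamma(\mathcal{C})$ is the full subcategory of the category of arrows of $\mathcal{C}$ on the normal extensions, so a morphism $p\to p'$ is a pair $(f,b)$ with $p'f=bp$. $\mathrm{Cod}\colon\mathsf{NExt}_\Gamma(\mathcal{C})\to\mathcal{C}$ is the codomain functor. **Galois group.** For a normal extension $p\colon E\to B$ with kernel pair $d,c\colon\mathrm{Eq}(p)\rightrightarrows E$, the image under $I$ of the groupoid $\mathrm{Eq}(p)$ is an internal groupoid in $\mathcal{X}$ (by admissibility $I$ preserves pullbacks along trivial coverings), the Galois groupoid. The Galois group $\mathrm{Gal}_\Gamma(p,0)$ is the internal group in $\mathcal{X}$ with underlying object $\mathrm{Ker}(I(d))\cap\mathrm{Ker}(I(c))\subseteq I(\mathrm{Eq}(p))$, with the multiplication induced from the Galois groupoid. This defines a functor $\mathrm{Gal}_\Gamma(-,0)$ from $\mathsf{NExt}_\Gamma(\mathcal{C})$ to the category $\mathsf{Gp}(\mathcal{X})$ of internal groups in $\mathcal{X}$. **Fundamental group.** A normal extension $u\colon U\to B$ is weakly universal if for every normal extension $p\colon E\to B$ there is $e\colon U\to E$ with $p\circ e=u$. Morphisms of normal extensions with the same codomain component induce the same morphism of Galois groups. The fundamental group is $\pi_1(B,I)=\mathrm{Gal}_\Gamma(u,0)$ for a (chosen) weakly universal normal extension $u$ of $B$; on $f\colon A\to B$, $\pi_1(f,I)=\mathrm{Gal}_\Gamma((g,f),0)$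 for any morphism $(g,f)\colon v\to u$ in $\mathsf{NExt}_\Gamma(\mathcal{C})$ between the weakly universal normal extensions $v$ of $A$ and $u$ of $B$. The natural transformation $\kappa$ has components $\kappa_p=\mathrm{Gal}_\Gamma((h,1_B),0)\colon\pi_1(B,I)=\mathrm{Gal}_\Gamma(u,0)\to\mathrm{Gal}_\Gamma(p,0)$, for $p\colon E\to B$ normal, $u\colon U\to B$ the weakly universal normal extension of $B$ and any $h\colon U\to E$ with $ph=u$ (independent of the choice of $h$). *)

theory Defs
  imports Main
begin

text \<open>
  Categories are records with explicit carriers; the fields are only meaningful on the carriers,
  so uniqueness of natural transformations is uniqueness on objects of the carrier.
  Chosen limits (pullbacks, products, kernels, terminal objects) are Hilbert choices.
\<close>

section \<open>Categories, functors, natural transformations\<close>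

record ('o, 'm) cat =
  Obj :: "'o set"
  Arr :: "'m set"
  Dom :: "'m \<Rightarrow> 'o"
  Cod :: "'m \<Rightarrow> 'o"
  Ide :: "'o \<Rightarrow> 'm"
  Comp :: "'m \<Rightarrow> 'm \<Rightarrow> 'm" (infixr "\<cdot>\<index>" 70)

definition hom :: "('o, 'm) cat \<Rightarrow> 'o \<Rightarrow> 'o \<Rightarrow> 'm set" where
  "hom C a b = {f \<in> Arr C. Dom C f = a \<and> Cod C f = b}"

definition category :: "('o, 'm) cat \<Rightarrow> bool" where
  "category C \<longleftrightarrow>
     (\<forall>f \<in> Arr C. Dom C f \<in> Obj C \<and> Cod C f \<in> Obj C) \<and>
     (\<forall>a \<in> Obj C. Ide C a \<in> hom C a a) \<and>
     (\<forall>f \<in> Arr C. \<forall>g \<in> Arr C. Dom C g = Cod C f \<longrightarrow> g \<cdot>\<^bsub>C\<^esub> f \<in> hom C (Dom C f) (Cod C g)) \<and>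
     (\<forall>f \<in> Arr C. f \<cdot>\<^bsub>C\<^esub> Ide C (Dom C f) = f \<and> Ide C (Cod C f) \<cdot>\<^bsub>C\<^esub> f = f) \<and>
     (\<forall>f \<in> Arr C. \<forall>g \<in> Arr C. \<forall>h \<in> Arr C. Dom C g = Cod C f \<and> Dom C h = Cod C g \<longrightarrow>
        (h \<cdot>\<^bsub>C\<^esub> g) \<cdot>\<^bsub>C\<^esub> f = h \<cdot>\<^bsub>C\<^esub> (g \<cdot>\<^bsub>C\<^esub> f))"

definition is_inverse :: "('o, 'm) cat \<Rightarrow> 'm \<Rightarrow> 'm \<Rightarrow> bool" where
  "is_inverse C f g \<longleftrightarrow> f \<in> Arr C \<and> g \<in> hom C (Cod C f) (Dom C f) \<and>
     g \<cdot>\<^bsub>C\<^esub> f = Ide C (Dom C f) \<and> f \<cdot>\<^bsub>C\<^esub> g = Ide C (Cod C f)"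

definition is_iso :: "('o, 'm) cat \<Rightarrow> 'm \<Rightarrow> bool" where
  "is_iso C f \<longleftrightarrow> (\<exists>g. is_inverse C f g)"

definition inverse_arr :: "('o, 'm) cat \<Rightarrow> 'm \<Rightarrow> 'm" where
  "inverse_arr C f = (THE g. is_inverse C f g)"

record ('o, 'm, 'p, 'n) func =
  on_obj :: "'o \<Rightarrow> 'p"
  on_arr :: "'m \<Rightarrow> 'n"

definition is_functor :: "('o, 'm) cat \<Rightarrow> ('p, 'n) cat \<Rightarrow> ('o, 'm, 'p, 'n) func \<Rightarrow> bool" where
  "is_functor C D F \<longleftrightarrow> category C \<and> category D \<and>
     (\<forall>a \<in> Obj C. on_obj F a \<in> Obj D) \<and>
     (\<forall>f \<in> Arr C. on_arr F f \<in> hom D (on_obj F (Dom C f)) (on_obj F (Cod C f))) \<and>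
     (\<forall>a \<in> Obj C. on_arr F (Ide C a) = Ide D (on_obj F a)) \<and>
     (\<forall>f \<in> Arr C. \<forall>g \<in> Arr C. Dom C g = Cod C f \<longrightarrow>
        on_arr F (g \<cdot>\<^bsub>C\<^esub> f) = on_arr F g \<cdot>\<^bsub>D\<^esub> on_arr F f)"

definition id_func :: "('o, 'm, 'o, 'm) func" where
  "id_func = \<lparr>on_obj = (\<lambda>a. a), on_arr = (\<lambda>f. f)\<rparr>"

definition comp_func ::
  "('p, 'n, 'q, 'k) func \<Rightarrow> ('o, 'm, 'p, 'n) func \<Rightarrow> ('o, 'm, 'q, 'k) func" where
  "comp_func G F = \<lparr>on_obj = (\<lambda>a. on_obj G (on_obj F a)), on_arr = (\<lambda>f. on_arr G (on_arr F f))\<rparr>"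

definition nat_trans ::
  "('o, 'm) cat \<Rightarrow> ('p, 'n) cat \<Rightarrow> ('o, 'm, 'p, 'n) func \<Rightarrow> ('o, 'm, 'p, 'n) func \<Rightarrow>
   ('o \<Rightarrow> 'n) \<Rightarrow> bool" where
  "nat_trans C D F G \<alpha> \<longleftrightarrow> is_functor C D F \<and> is_functor C D G \<and>
     (\<forall>a \<in> Obj C. \<alpha> a \<in> hom D (on_obj F a) (on_obj G a)) \<and>
     (\<forall>f \<in> Arr C. \<alpha> (Cod C f) \<cdot>\<^bsub>D\<^esub> on_arr F f = on_arr G f \<cdot>\<^bsub>D\<^esub> \<alpha> (Dom C f))"

definition nat_iso ::
  "('o, 'm) cat \<Rightarrow> ('p, 'n) cat \<Rightarrow> ('o, 'm, 'p, 'n) func \<Rightarrow> ('o, 'm, 'p, 'n) func \<Rightarrow>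
   ('o \<Rightarrow> 'n) \<Rightarrow> bool" where
  "nat_iso C D F G \<alpha> \<longleftrightarrow> nat_trans C D F G \<alpha> \<and> (\<forall>a \<in> Obj C. is_iso D (\<alpha> a))"

definition full :: "('o, 'm) cat \<Rightarrow> ('p, 'n) cat \<Rightarrow> ('o, 'm, 'p, 'n) func \<Rightarrow> bool" where
  "full C D F \<longleftrightarrow> (\<forall>a \<in> Obj C. \<forall>b \<in> Obj C.
     \<forall>g \<in> hom D (on_obj F a) (on_obj F b). \<exists>f \<in> hom C a b. on_arr F f = g)"

definition faithful :: "('o, 'm) cat \<Rightarrow> ('o, 'm, 'p, 'n) func \<Rightarrow> bool" where
  "faithful C F \<longleftrightarrow> (\<forall>a \<in> Obj C. \<forall>b \<in> Obj C. inj_on (on_arr F) (hom C a b))"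

definition equivalence :: "('o, 'm) cat \<Rightarrow> ('p, 'n) cat \<Rightarrow> ('o, 'm, 'p, 'n) func \<Rightarrow> bool" where
  "equivalence C D K \<longleftrightarrow> is_functor C D K \<and>
     (\<exists>L \<alpha> \<beta>. is_functor D C L \<and> nat_iso C C id_func (comp_func L K) \<alpha> \<and>
       nat_iso D D (comp_func K L) id_func \<beta>)"

text \<open>\<open>L\<close> is left adjoint to \<open>R\<close>, with unit \<open>\<eta>\<close> and counit \<open>\<epsilon>\<close>.\<close>

definition adjunction ::
  "('o, 'm) cat \<Rightarrow> ('p, 'n) cat \<Rightarrow> ('o, 'm, 'p, 'n) func \<Rightarrow> ('p, 'n, 'o, 'm) func \<Rightarrow>
   ('o \<Rightarrow> 'm) \<Rightarrow> ('p \<Rightarrow> 'n) \<Rightarrow> bool" where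
  "adjunction C D L R \<eta> \<epsilon> \<longleftrightarrow>
     is_functor C D L \<and> is_functor D C R \<and>
     nat_trans C C id_func (comp_func R L) \<eta> \<and>
     nat_trans D D (comp_func L R) id_func \<epsilon> \<and>
     (\<forall>a \<in> Obj C. \<epsilon> (on_obj L a) \<cdot>\<^bsub>D\<^esub> on_arr L (\<eta> a) = Ide D (on_obj L a)) \<and>
     (\<forall>x \<in> Obj D. on_arr R (\<epsilon> x) \<cdot>\<^bsub>C\<^esub> \<eta> (on_obj R x) = Ide C (on_obj R x))"

definition full_subcategory :: "('o, 'm) cat \<Rightarrow> 'o set \<Rightarrow> ('o, 'm) cat" where
  "full_subcategory C S = C\<lparr>Obj := Obj C \<inter> S, Arr := {f \<in> Arr C. Dom C f \<in> S \<and> Cod C f \<in> S}\<rparr>"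

text \<open>\<open>X\<close> is a full subcategory of \<open>C\<close> and \<open>H\<close> acts as the inclusion \<open>X \<rightarrow> C\<close>.\<close>

definition full_subcategory_inclusion ::
  "('o, 'm) cat \<Rightarrow> ('o, 'm) cat \<Rightarrow> ('o, 'm, 'o, 'm) func \<Rightarrow> bool" where
  "full_subcategory_inclusion C X H \<longleftrightarrow>
     Obj X \<subseteq> Obj C \<and>
     Arr X = {f \<in> Arr C. Dom C f \<in> Obj X \<and> Cod C f \<in> Obj X} \<and>
     (\<forall>f \<in> Arr X. Dom X f = Dom C f \<and> Cod X f = Cod C f) \<and>
     (\<forall>x \<in> Obj X. Ide X x = Ide C x) \<and>
     (\<forall>f \<in> Arr X. \<forall>g \<in> Arr X. Dom C g = Cod C f \<longrightarrow> g \<cdot>\<^bsub>X\<^esub> f = g \<cdot>\<^bsub>C\<^esub> f) \<and>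
     (\<forall>x \<in> Obj X. on_obj H x = x) \<and>
     (\<forall>f \<in> Arr X. on_arr H f = f)"

section \<open>Limits\<close>

definition is_cone ::
  "('i, 'j) cat \<Rightarrow> ('o, 'm) cat \<Rightarrow> ('i, 'j, 'o, 'm) func \<Rightarrow> 'o \<Rightarrow> ('i \<Rightarrow> 'm) \<Rightarrow> bool" where
  "is_cone J C D a l \<longleftrightarrow> a \<in> Obj C \<and>
     (\<forall>j \<in> Obj J. l j \<in> hom C a (on_obj D j)) \<and>
     (\<forall>t \<in> Arr J. on_arr D t \<cdot>\<^bsub>C\<^esub> l (Dom J t) = l (Cod J t))"

definition is_limit ::
  "('i, 'j) cat \<Rightarrow> ('o, 'm) cat \<Rightarrow> ('i, 'j, 'o, 'm) func \<Rightarrow> 'o \<Rightarrow> ('i \<Rightarrow> 'm) \<Rightarrow> bool" where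
  "is_limit J C D a l \<longleftrightarrow> is_cone J C D a l \<and>
     (\<forall>b m. is_cone J C D b m \<longrightarrow>
        (\<exists>!h. h \<in> hom C b a \<and> (\<forall>j \<in> Obj J. l j \<cdot>\<^bsub>C\<^esub> h = m j)))"

text \<open>Every finite category is isomorphic to one with objects and arrows in \<open>nat\<close>.\<close>

definition finitely_complete :: "('o, 'm) cat \<Rightarrow> bool" where
  "finitely_complete C \<longleftrightarrow>
     (\<forall>(J :: (nat, nat) cat) D. finite (Obj J) \<and> finite (Arr J) \<and> is_functor J C D \<longrightarrow>
        (\<exists>a l. is_limit J C D a l))"

definition is_terminal :: "('o, 'm) cat \<Rightarrow> 'o \<Rightarrow> bool" where
  "is_terminal C t \<longleftrightarrow> t \<in> Obj C \<and> (\<forall>a \<in> Obj C. \<exists>!f. f \<in> hom C a t)"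

definition is_initial :: "('o, 'm) cat \<Rightarrow> 'o \<Rightarrow> bool" where
  "is_initial C t \<longleftrightarrow> t \<in> Obj C \<and> (\<forall>a \<in> Obj C. \<exists>!f. f \<in> hom C t a)"

definition is_zero_obj :: "('o, 'm) cat \<Rightarrow> 'o \<Rightarrow> bool" where
  "is_zero_obj C z \<longleftrightarrow> is_initial C z \<and> is_terminal C z"

definition pointed :: "('o, 'm) cat \<Rightarrow> bool" where
  "pointed C \<longleftrightarrow> (\<exists>z. is_zero_obj C z)"

definition zero_arr :: "('o, 'm) cat \<Rightarrow> 'o \<Rightarrow> 'o \<Rightarrow> 'm" where
  "zero_arr C a b = (THE f. \<exists>z g h. is_zero_obj C z \<and> g \<in> hom C a z \<and> h \<in> hom C z b \<and> f = h \<cdot>\<^bsub>C\<^esub> g)"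

definition terminal :: "('o, 'm) cat \<Rightarrow> 'o" where
  "terminal C = (SOME t. is_terminal C t)"

definition terminal_arr :: "('o, 'm) cat \<Rightarrow> 'o \<Rightarrow> 'm" where
  "terminal_arr C a = (THE f. f \<in> hom C a (terminal C))"

text \<open>The arrow \<open>h\<close> with \<open>p h = a\<close> and \<open>q h = b\<close>, for projections \<open>(p, q)\<close> of a pullback or product.\<close>

definition tuple :: "('o, 'm) cat \<Rightarrow> 'm \<times> 'm \<Rightarrow> 'm \<Rightarrow> 'm \<Rightarrow> 'm" where
  "tuple C pq a b = (THE h. h \<in> hom C (Dom C a) (Dom C (fst pq)) \<and>
     fst pq \<cdot>\<^bsub>C\<^esub> h = a \<and> snd pq \<cdot>\<^bsub>C\<^esub> h = b)"

definition is_product :: "('o, 'm) cat \<Rightarrow> 'o \<Rightarrow> 'o \<Rightarrow> 'm \<Rightarrow> 'm \<Rightarrow> bool" where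
  "is_product C x y p q \<longleftrightarrow>
     p \<in> Arr C \<and> q \<in> Arr C \<and> Dom C p = Dom C q \<and> Cod C p = x \<and> Cod C q = y \<and>
     (\<forall>a \<in> Arr C. \<forall>b \<in> Arr C. Dom C a = Dom C b \<and> Cod C a = x \<and> Cod C b = y \<longrightarrow>
        (\<exists>!h. h \<in> hom C (Dom C a) (Dom C p) \<and> p \<cdot>\<^bsub>C\<^esub> h = a \<and> q \<cdot>\<^bsub>C\<^esub> h = b))"

definition product :: "('o, 'm) cat \<Rightarrow> 'o \<Rightarrow> 'o \<Rightarrow> 'm \<times> 'm" where
  "product C x y = (SOME pq. is_product C x y (fst pq) (snd pq))"

text \<open>The square \<open>f p = g q\<close> is a pullback; thus \<open>q\<close> is a pullback of \<open>f\<close> along \<open>g\<close>.\<close>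

definition is_pullback :: "('o, 'm) cat \<Rightarrow> 'm \<Rightarrow> 'm \<Rightarrow> 'm \<Rightarrow> 'm \<Rightarrow> bool" where
  "is_pullback C f g p q \<longleftrightarrow>
     f \<in> Arr C \<and> g \<in> Arr C \<and> Cod C f = Cod C g \<and>
     p \<in> Arr C \<and> q \<in> Arr C \<and> Dom C p = Dom C q \<and> Cod C p = Dom C f \<and> Cod C q = Dom C g \<and>
     f \<cdot>\<^bsub>C\<^esub> p = g \<cdot>\<^bsub>C\<^esub> q \<and>
     (\<forall>a \<in> Arr C. \<forall>b \<in> Arr C.
        Dom C a = Dom C b \<and> Cod C a = Dom C f \<and> Cod C b = Dom C g \<and> f \<cdot>\<^bsub>C\<^esub> a = g \<cdot>\<^bsub>C\<^esub> b \<longrightarrow>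
        (\<exists>!h. h \<in> hom C (Dom C a) (Dom C p) \<and> p \<cdot>\<^bsub>C\<^esub> h = a \<and> q \<cdot>\<^bsub>C\<^esub> h = b))"

definition pullback :: "('o, 'm) cat \<Rightarrow> 'm \<Rightarrow> 'm \<Rightarrow> 'm \<times> 'm" where
  "pullback C f g = (SOME pq. is_pullback C f g (fst pq) (snd pq))"

definition pullback_stable :: "('o, 'm) cat \<Rightarrow> 'm set \<Rightarrow> bool" where
  "pullback_stable C M \<longleftrightarrow> (\<forall>f \<in> M. \<forall>g \<in> Arr C. Cod C g = Cod C f \<longrightarrow>
     (\<exists>p q. is_pullback C f g p q) \<and> (\<forall>p q. is_pullback C f g p q \<longrightarrow> q \<in> M))"

definition is_kernel :: "('o, 'm) cat \<Rightarrow> 'm \<Rightarrow> 'm \<Rightarrow> bool" where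
  "is_kernel C f k \<longleftrightarrow>
     f \<in> Arr C \<and> k \<in> Arr C \<and> Cod C k = Dom C f \<and>
     f \<cdot>\<^bsub>C\<^esub> k = zero_arr C (Dom C k) (Cod C f) \<and>
     (\<forall>a \<in> Arr C. Cod C a = Dom C f \<and> f \<cdot>\<^bsub>C\<^esub> a = zero_arr C (Dom C a) (Cod C f) \<longrightarrow>
        (\<exists>!h. h \<in> hom C (Dom C a) (Dom C k) \<and> k \<cdot>\<^bsub>C\<^esub> h = a))"

definition kernel :: "('o, 'm) cat \<Rightarrow> 'm \<Rightarrow> 'm" where
  "kernel C f = (SOME k. is_kernel C f k)"

text \<open>The intersection of two subobjects \<open>k\<close>, \<open>l\<close> of one object: the diagonal of their pullback.\<close>

definition subobj_inter :: "('o, 'm) cat \<Rightarrow> 'm \<Rightarrow> 'm \<Rightarrow> 'm" where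
  "subobj_inter C k l = k \<cdot>\<^bsub>C\<^esub> fst (pullback C k l)"

text \<open>The factorization of \<open>f\<close> through the monomorphism \<open>k\<close>.\<close>

definition factor :: "('o, 'm) cat \<Rightarrow> 'm \<Rightarrow> 'm \<Rightarrow> 'm" where
  "factor C k f = (THE h. h \<in> hom C (Dom C f) (Dom C k) \<and> k \<cdot>\<^bsub>C\<^esub> h = f)"

section \<open>Slice and arrow categories\<close>

text \<open>An arrow \<open>f \<rightarrow> g\<close> of the slice over \<open>B\<close> is a triple \<open>(f, h, g)\<close> with \<open>g h = f\<close>.\<close>

definition slice :: "('o, 'm) cat \<Rightarrow> 'o \<Rightarrow> ('m, 'm \<times> 'm \<times> 'm) cat" where
  "slice C B = \<lparr>
     Obj = {f \<in> Arr C. Cod C f = B},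
     Arr = {(f, h, g). f \<in> Arr C \<and> g \<in> Arr C \<and> Cod C f = B \<and> Cod C g = B \<and>
                       h \<in> hom C (Dom C f) (Dom C g) \<and> g \<cdot>\<^bsub>C\<^esub> h = f},
     Dom = (\<lambda>(f, h, g). f),
     Cod = (\<lambda>(f, h, g). g),
     Ide = (\<lambda>f. (f, Ide C (Dom C f), f)),
     Comp = (\<lambda>(f', h', g') (f, h, g). (f, h' \<cdot>\<^bsub>C\<^esub> h, g'))\<rparr>"

text \<open>An arrow \<open>p \<rightarrow> p'\<close> of the arrow category is \<open>(p, (f, b), p')\<close> with \<open>p' f = b p\<close>.\<close>

definition arrow_category :: "('o, 'm) cat \<Rightarrow> ('m, 'm \<times> ('m \<times> 'm) \<times> 'm) cat" where
  "arrow_category C = \<lparr>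
     Obj = Arr C,
     Arr = {(p, (f, b), p'). p \<in> Arr C \<and> p' \<in> Arr C \<and>
                             f \<in> hom C (Dom C p) (Dom C p') \<and> b \<in> hom C (Cod C p) (Cod C p') \<and>
                             p' \<cdot>\<^bsub>C\<^esub> f = b \<cdot>\<^bsub>C\<^esub> p},
     Dom = (\<lambda>(p, fb, p'). p),
     Cod = (\<lambda>(p, fb, p'). p'),
     Ide = (\<lambda>p. (p, (Ide C (Dom C p), Ide C (Cod C p)), p)),
     Comp = (\<lambda>(q, (f', b'), q') (p, (f, b), p'). (p, (f' \<cdot>\<^bsub>C\<^esub> f, b' \<cdot>\<^bsub>C\<^esub> b), q'))\<rparr>"

definition slice_functor ::
  "('p, 'n, 'o, 'm) func \<Rightarrow> ('n, 'n \<times> 'n \<times> 'n, 'm, 'm \<times> 'm \<times> 'm) func" where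
  "slice_functor H = \<lparr>
     on_obj = on_arr H,
     on_arr = (\<lambda>(f, h, g). (on_arr H f, on_arr H h, on_arr H g))\<rparr>"

text \<open>For \<open>p : E \<rightarrow> B\<close>, the functor sending \<open>f : A \<rightarrow> B\<close> to the projection \<open>A \<times>\<^sub>B E \<rightarrow> E\<close>.\<close>

definition pullback_functor ::
  "('o, 'm) cat \<Rightarrow> 'm \<Rightarrow> ('m, 'm \<times> 'm \<times> 'm, 'm, 'm \<times> 'm \<times> 'm) func" where
  "pullback_functor C p = \<lparr>
     on_obj = (\<lambda>f. snd (pullback C f p)),
     on_arr = (\<lambda>(f, h, g). (snd (pullback C f p),
        tuple C (pullback C g p) (h \<cdot>\<^bsub>C\<^esub> fst (pullback C f p)) (snd (pullback C f p)),
        snd (pullback C g p)))\<rparr>"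

section \<open>Monadic functors\<close>

definition eilenberg_moore ::
  "('o, 'm) cat \<Rightarrow> ('o, 'm, 'o, 'm) func \<Rightarrow> ('o \<Rightarrow> 'm) \<Rightarrow> ('o \<Rightarrow> 'm) \<Rightarrow>
   ('o \<times> 'm, ('o \<times> 'm) \<times> 'm \<times> ('o \<times> 'm)) cat" where
  "eilenberg_moore C T \<eta> \<mu> =
    (let Alg = {(x, s). x \<in> Obj C \<and> s \<in> hom C (on_obj T x) x \<and>
                  s \<cdot>\<^bsub>C\<^esub> \<eta> x = Ide C x \<and> s \<cdot>\<^bsub>C\<^esub> \<mu> x = s \<cdot>\<^bsub>C\<^esub> on_arr T s}
     in \<lparr>
     Obj = Alg,
     Arr = {((x, s), f, (y, t)). (x, s) \<in> Alg \<and> (y, t) \<in> Alg \<and> f \<in> hom C x y \<and>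
                                 f \<cdot>\<^bsub>C\<^esub> s = t \<cdot>\<^bsub>C\<^esub> on_arr T f},
     Dom = (\<lambda>(a, f, b). a),
     Cod = (\<lambda>(a, f, b). b),
     Ide = (\<lambda>a. (a, Ide C (fst a), a)),
     Comp = (\<lambda>(a', f', b') (a, f, b). (a, f' \<cdot>\<^bsub>C\<^esub> f, b'))\<rparr>)"

text \<open>
  The comparison functor of an adjunction with right adjoint \<open>U : A \<rightarrow> C\<close> and counit \<open>\<epsilon>\<close>; the
  induced monad on \<open>C\<close> has multiplication \<open>U \<epsilon> L\<close>.
\<close>

definition comparison ::
  "('a, 'k) cat \<Rightarrow> ('a, 'k, 'o, 'm) func \<Rightarrow> ('a \<Rightarrow> 'k) \<Rightarrow>
   ('a, 'k, 'o \<times> 'm, ('o \<times> 'm) \<times> 'm \<times> ('o \<times> 'm)) func" where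
  "comparison A U \<epsilon> =
    (let K = (\<lambda>a. (on_obj U a, on_arr U (\<epsilon> a)))
     in \<lparr>on_obj = K, on_arr = (\<lambda>f. (K (Dom A f), on_arr U f, K (Cod A f)))\<rparr>)"

definition monadic :: "('a, 'k) cat \<Rightarrow> ('o, 'm) cat \<Rightarrow> ('a, 'k, 'o, 'm) func \<Rightarrow> bool" where
  "monadic A C U \<longleftrightarrow> (\<exists>L \<eta> \<epsilon>. adjunction C A L U \<eta> \<epsilon> \<and>
     equivalence A
       (eilenberg_moore C (comp_func U L) \<eta> (\<lambda>x. on_arr U (\<epsilon> (on_obj L x))))
       (comparison A U \<epsilon>))"

section \<open>Galois structures\<close>

record ('o, 'm, 'p, 'n) galois_structure =
  baseC :: "('o, 'm) cat"
  baseX :: "('p, 'n) cat"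
  functH :: "('p, 'n, 'o, 'm) func"
  functI :: "('o, 'm, 'p, 'n) func"
  unitG :: "'o \<Rightarrow> 'm"
  counitG :: "'p \<Rightarrow> 'n"
  classE :: "'m set"
  classF :: "'n set"

definition is_galois_structure :: "('o, 'm, 'p, 'n) galois_structure \<Rightarrow> bool" where
  "is_galois_structure \<Gamma> \<longleftrightarrow>
    (let C = baseC \<Gamma>; X = baseX \<Gamma>; E = classE \<Gamma>; F = classF \<Gamma>; H = functH \<Gamma>; I = functI \<Gamma> in
     adjunction C X I H (unitG \<Gamma>) (counitG \<Gamma>) \<and>
     E \<subseteq> Arr C \<and> F \<subseteq> Arr X \<and>
     (\<forall>f. is_iso C f \<longrightarrow> f \<in> E) \<and> (\<forall>f. is_iso X f \<longrightarrow> f \<in> F) \<and>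
     pullback_stable C E \<and> pullback_stable X F \<and>
     (\<forall>f \<in> E. \<forall>g \<in> E. Dom C g = Cod C f \<longrightarrow> g \<cdot>\<^bsub>C\<^esub> f \<in> E) \<and>
     (\<forall>f \<in> F. \<forall>g \<in> F. Dom X g = Cod X f \<longrightarrow> g \<cdot>\<^bsub>X\<^esub> f \<in> F) \<and>
     on_arr H ` F \<subseteq> E \<and> on_arr I ` E \<subseteq> F)"

definition slice_class :: "('o, 'm) cat \<Rightarrow> 'm set \<Rightarrow> 'o \<Rightarrow> ('m, 'm \<times> 'm \<times> 'm) cat" where
  "slice_class C E B = full_subcategory (slice C B) E"

definition functHB ::
  "('o, 'm, 'p, 'n) galois_structure \<Rightarrow> 'o \<Rightarrow> ('n, 'n \<times> 'n \<times> 'n, 'm, 'm \<times> 'm \<times> 'm) func" where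
  "functHB \<Gamma> B =
     comp_func (pullback_functor (baseC \<Gamma>) (unitG \<Gamma> B)) (slice_functor (functH \<Gamma>))"

definition admissible :: "('o, 'm, 'p, 'n) galois_structure \<Rightarrow> bool" where
  "admissible \<Gamma> \<longleftrightarrow> (\<forall>B \<in> Obj (baseC \<Gamma>).
     full (slice_class (baseX \<Gamma>) (classF \<Gamma>) (on_obj (functI \<Gamma>) B))
          (slice_class (baseC \<Gamma>) (classE \<Gamma>) B) (functHB \<Gamma> B) \<and>
     faithful (slice_class (baseX \<Gamma>) (classF \<Gamma>) (on_obj (functI \<Gamma>) B)) (functHB \<Gamma> B))"

definition trivial_covering :: "('o, 'm, 'p, 'n) galois_structure \<Rightarrow> 'm \<Rightarrow> bool" where
  "trivial_covering \<Gamma> f \<longleftrightarrow> f \<in> classE \<Gamma> \<and>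
     is_pullback (baseC \<Gamma>)
       (on_arr (functH \<Gamma>) (on_arr (functI \<Gamma>) f)) (unitG \<Gamma> (Cod (baseC \<Gamma>) f))
       (unitG \<Gamma> (Dom (baseC \<Gamma>) f)) f"

definition monadic_extension :: "('o, 'm, 'p, 'n) galois_structure \<Rightarrow> 'm \<Rightarrow> bool" where
  "monadic_extension \<Gamma> p \<longleftrightarrow> p \<in> classE \<Gamma> \<and>
     monadic (slice_class (baseC \<Gamma>) (classE \<Gamma>) (Cod (baseC \<Gamma>) p))
             (slice_class (baseC \<Gamma>) (classE \<Gamma>) (Dom (baseC \<Gamma>) p))
             (pullback_functor (baseC \<Gamma>) p)"

definition normal_extension :: "('o, 'm, 'p, 'n) galois_structure \<Rightarrow> 'm \<Rightarrow> bool" where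
  "normal_extension \<Gamma> p \<longleftrightarrow> monadic_extension \<Gamma> p \<and>
     trivial_covering \<Gamma> (on_obj (pullback_functor (baseC \<Gamma>) p) p)"

definition NExt ::
  "('o, 'm, 'p, 'n) galois_structure \<Rightarrow> ('m, 'm \<times> ('m \<times> 'm) \<times> 'm) cat" where
  "NExt \<Gamma> = full_subcategory (arrow_category (baseC \<Gamma>)) {p. normal_extension \<Gamma> p}"

definition CodF ::
  "('o, 'm, 'p, 'n) galois_structure \<Rightarrow> ('m, 'm \<times> ('m \<times> 'm) \<times> 'm, 'o, 'm) func" where
  "CodF \<Gamma> = \<lparr>on_obj = Cod (baseC \<Gamma>), on_arr = (\<lambda>(p, (f, b), p'). b)\<rparr>"

definition weakly_universal :: "('o, 'm, 'p, 'n) galois_structure \<Rightarrow> 'o \<Rightarrow> 'm \<Rightarrow> bool" where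
  "weakly_universal \<Gamma> B u \<longleftrightarrow>
     normal_extension \<Gamma> u \<and> Cod (baseC \<Gamma>) u = B \<and>
     (\<forall>p. normal_extension \<Gamma> p \<and> Cod (baseC \<Gamma>) p = B \<longrightarrow>
        (\<exists>e \<in> hom (baseC \<Gamma>) (Dom (baseC \<Gamma>) u) (Dom (baseC \<Gamma>) p). p \<cdot>\<^bsub>baseC \<Gamma>\<^esub> e = u))"

section \<open>Internal groups and groupoids\<close>

text \<open>The multiplication is an arrow out of the chosen product of \<open>gp_obj\<close> with itself.\<close>

record ('o, 'm) int_group =
  gp_obj :: 'o
  gp_mult :: 'm
  gp_unit :: 'm
  gp_inv :: 'm

definition is_int_group :: "('o, 'm) cat \<Rightarrow> ('o, 'm) int_group \<Rightarrow> bool" where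
  "is_int_group C G \<longleftrightarrow>
    (let g = gp_obj G; P = product C g g; m = gp_mult G; gg = Dom C (fst P);
         Q = product C gg g;
         x = fst P \<cdot>\<^bsub>C\<^esub> fst Q; y = snd P \<cdot>\<^bsub>C\<^esub> fst Q; z = snd Q;
         mul = (\<lambda>a b. m \<cdot>\<^bsub>C\<^esub> tuple C P a b);
         one = gp_unit G \<cdot>\<^bsub>C\<^esub> terminal_arr C g
     in g \<in> Obj C \<and> m \<in> hom C gg g \<and> gp_unit G \<in> hom C (terminal C) g \<and> gp_inv G \<in> hom C g g \<and>
        mul (mul x y) z = mul x (mul y z) \<and>
        mul one (Ide C g) = Ide C g \<and> mul (Ide C g) one = Ide C g \<and>
        mul (gp_inv G) (Ide C g) = one \<and> mul (Ide C g) (gp_inv G) = one)"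

definition int_group_hom ::
  "('o, 'm) cat \<Rightarrow> ('o, 'm) int_group \<Rightarrow> ('o, 'm) int_group \<Rightarrow> 'm \<Rightarrow> bool" where
  "int_group_hom C G G' f \<longleftrightarrow>
     f \<in> hom C (gp_obj G) (gp_obj G') \<and>
     (let P = product C (gp_obj G) (gp_obj G); P' = product C (gp_obj G') (gp_obj G')
      in f \<cdot>\<^bsub>C\<^esub> gp_mult G = gp_mult G' \<cdot>\<^bsub>C\<^esub> tuple C P' (f \<cdot>\<^bsub>C\<^esub> fst P) (f \<cdot>\<^bsub>C\<^esub> snd P))"

definition Gp ::
  "('o, 'm) cat \<Rightarrow> (('o, 'm) int_group, ('o, 'm) int_group \<times> 'm \<times> ('o, 'm) int_group) cat" where
  "Gp C = \<lparr>
     Obj = {G. is_int_group C G},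
     Arr = {(G, f, G'). is_int_group C G \<and> is_int_group C G' \<and> int_group_hom C G G' f},
     Dom = (\<lambda>(G, f, G'). G),
     Cod = (\<lambda>(G, f, G'). G'),
     Ide = (\<lambda>G. (G, Ide C (gp_obj G), G)),
     Comp = (\<lambda>(H, f', H') (G, f, G'). (G, f' \<cdot>\<^bsub>C\<^esub> f, H'))\<rparr>"

text \<open>
  \<open>gd_comp\<close> is an arrow out of the chosen pullback of \<open>gd_cod\<close> along \<open>gd_dom\<close>: it composes a
  pair of arrows \<open>(\<alpha> : x \<rightarrow> y, \<beta> : y \<rightarrow> z)\<close>, written in diagrammatic order, to \<open>x \<rightarrow> z\<close>.
\<close>

record ('o, 'm) int_groupoid =
  gd_obj :: 'o
  gd_arr :: 'o
  gd_dom :: 'm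
  gd_cod :: 'm
  gd_unit :: 'm
  gd_inv :: 'm
  gd_comp :: 'm

definition kernel_pair :: "('o, 'm) cat \<Rightarrow> 'm \<Rightarrow> 'm \<times> 'm" where
  "kernel_pair C p = pullback C p p"

text \<open>The equivalence relation \<open>Eq(p)\<close> as a groupoid: composition is \<open>((x,y),(y,z)) \<mapsto> (x,z)\<close>.\<close>

definition kernel_pair_groupoid :: "('o, 'm) cat \<Rightarrow> 'm \<Rightarrow> ('o, 'm) int_groupoid" where
  "kernel_pair_groupoid C p =
    (let dc = kernel_pair C p; d = fst dc; c = snd dc; q = pullback C c d
     in \<lparr>gd_obj = Dom C p, gd_arr = Dom C d, gd_dom = d, gd_cod = c,
         gd_unit = tuple C dc (Ide C (Dom C p)) (Ide C (Dom C p)),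
         gd_inv = tuple C dc c d,
         gd_comp = tuple C dc (d \<cdot>\<^bsub>C\<^esub> fst q) (c \<cdot>\<^bsub>C\<^esub> snd q)\<rparr>)"

text \<open>
  The image of a groupoid \<open>G\<close> under a functor preserving the pullback \<open>G\<^sub>1 \<times>\<^sub>G\<^sub>0 G\<^sub>1\<close>: the
  composition is transported along the comparison isomorphism \<open>w\<close> from the image of this
  pullback to the chosen pullback in the target category.
\<close>

definition image_groupoid ::
  "('o, 'm) cat \<Rightarrow> ('p, 'n) cat \<Rightarrow> ('o, 'm, 'p, 'n) func \<Rightarrow> ('o, 'm) int_groupoid \<Rightarrow>
   ('p, 'n) int_groupoid" where
  "image_groupoid C X I G =
    (let q = pullback C (gd_cod G) (gd_dom G);
         r = pullback X (on_arr I (gd_cod G)) (on_arr I (gd_dom G));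
         w = tuple X r (on_arr I (fst q)) (on_arr I (snd q))
     in \<lparr>gd_obj = on_obj I (gd_obj G), gd_arr = on_obj I (gd_arr G),
         gd_dom = on_arr I (gd_dom G), gd_cod = on_arr I (gd_cod G),
         gd_unit = on_arr I (gd_unit G), gd_inv = on_arr I (gd_inv G),
         gd_comp = on_arr I (gd_comp G) \<cdot>\<^bsub>X\<^esub> inverse_arr X w\<rparr>)"

text \<open>The inclusion of \<open>Ker(dom) \<inter> Ker(cod)\<close> into the object of arrows.\<close>

definition automorphisms_at_0 :: "('o, 'm) cat \<Rightarrow> ('o, 'm) int_groupoid \<Rightarrow> 'm" where
  "automorphisms_at_0 X G = subobj_inter X (kernel X (gd_dom G)) (kernel X (gd_cod G))"

definition group_at_0 :: "('o, 'm) cat \<Rightarrow> ('o, 'm) int_groupoid \<Rightarrow> ('o, 'm) int_group" where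
  "group_at_0 X G =
    (let k = automorphisms_at_0 X G; K = Dom X k; P = product X K K;
         r = pullback X (gd_cod G) (gd_dom G)
     in \<lparr>gp_obj = K,
         gp_mult = factor X k (gd_comp G \<cdot>\<^bsub>X\<^esub> tuple X r (k \<cdot>\<^bsub>X\<^esub> fst P) (k \<cdot>\<^bsub>X\<^esub> snd P)),
         gp_unit = factor X k (gd_unit G \<cdot>\<^bsub>X\<^esub> zero_arr X (terminal X) (gd_obj G)),
         gp_inv = factor X k (gd_inv G \<cdot>\<^bsub>X\<^esub> k)\<rparr>)"

section \<open>Galois groups and fundamental groups\<close>

definition galois_groupoid ::
  "('o, 'm, 'p, 'n) galois_structure \<Rightarrow> 'm \<Rightarrow> ('p, 'n) int_groupoid" where
  "galois_groupoid \<Gamma> p =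
     image_groupoid (baseC \<Gamma>) (baseX \<Gamma>) (functI \<Gamma>) (kernel_pair_groupoid (baseC \<Gamma>) p)"

definition galois_group ::
  "('o, 'm, 'p, 'n) galois_structure \<Rightarrow> 'm \<Rightarrow> ('p, 'n) int_group" where
  "galois_group \<Gamma> p = group_at_0 (baseX \<Gamma>) (galois_groupoid \<Gamma> p)"

text \<open>
  On a morphism \<open>(f, b) : p \<rightarrow> p'\<close>, the restriction of the image under \<open>I\<close> of the induced arrow
  \<open>Eq(p) \<rightarrow> Eq(p')\<close>.
\<close>

definition Gal ::
  "('o, 'm, 'p, 'n) galois_structure \<Rightarrow>
   ('m, 'm \<times> ('m \<times> 'm) \<times> 'm,
    ('p, 'n) int_group, ('p, 'n) int_group \<times> 'n \<times> ('p, 'n) int_group) func" where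
  "Gal \<Gamma> = \<lparr>
     on_obj = galois_group \<Gamma>,
     on_arr = (\<lambda>(p, (f, b), p').
       let C = baseC \<Gamma>; X = baseX \<Gamma>; dc = kernel_pair C p;
           Eqf = tuple C (kernel_pair C p') (f \<cdot>\<^bsub>C\<^esub> fst dc) (f \<cdot>\<^bsub>C\<^esub> snd dc)
       in (galois_group \<Gamma> p,
           factor X (automorphisms_at_0 X (galois_groupoid \<Gamma> p'))
             (on_arr (functI \<Gamma>) Eqf \<cdot>\<^bsub>X\<^esub> automorphisms_at_0 X (galois_groupoid \<Gamma> p)),
           galois_group \<Gamma> p'))\<rparr>"

text \<open>In the following \<open>u B\<close> is the chosen weakly universal normal extension of \<open>B\<close>.\<close>

definition pi1 ::
  "('o, 'm, 'p, 'n) galois_structure \<Rightarrow> ('o \<Rightarrow> 'm) \<Rightarrow>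
   ('o, 'm, ('p, 'n) int_group, ('p, 'n) int_group \<times> 'n \<times> ('p, 'n) int_group) func" where
  "pi1 \<Gamma> u = \<lparr>
     on_obj = (\<lambda>B. on_obj (Gal \<Gamma>) (u B)),
     on_arr = (\<lambda>f.
       let v = u (Dom (baseC \<Gamma>) f); w = u (Cod (baseC \<Gamma>) f)
       in on_arr (Gal \<Gamma>) (v, (SOME g. (v, (g, f), w) \<in> Arr (NExt \<Gamma>), f), w))\<rparr>"

definition kappa ::
  "('o, 'm, 'p, 'n) galois_structure \<Rightarrow> ('o \<Rightarrow> 'm) \<Rightarrow> 'm \<Rightarrow>
   ('p, 'n) int_group \<times> 'n \<times> ('p, 'n) int_group" where
  "kappa \<Gamma> u p =
    (let C = baseC \<Gamma>; B = Cod C p;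
         h = (SOME h. h \<in> hom C (Dom C (u B)) (Dom C p) \<and> p \<cdot>\<^bsub>C\<^esub> h = u B)
     in on_arr (Gal \<Gamma>) (u B, (h, Ide C B), p))"

section \<open>Kan extensions\<close>

text \<open>\<open>(R, \<kappa>)\<close>, with \<open>\<kappa> : R K \<Rightarrow> G\<close>, is a right Kan extension of \<open>G : A \<rightarrow> D\<close> along \<open>K : A \<rightarrow> C\<close>.\<close>

definition right_kan_extension ::
  "('a, 'k) cat \<Rightarrow> ('o, 'm) cat \<Rightarrow> ('p, 'n) cat \<Rightarrow> ('a, 'k, 'o, 'm) func \<Rightarrow>
   ('a, 'k, 'p, 'n) func \<Rightarrow> ('o, 'm, 'p, 'n) func \<Rightarrow> ('a \<Rightarrow> 'n) \<Rightarrow> bool" where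
  "right_kan_extension A C D K G R \<kappa> \<longleftrightarrow>
     is_functor A C K \<and> is_functor A D G \<and> is_functor C D R \<and>
     nat_trans A D (comp_func R K) G \<kappa> \<and>
     (\<forall>F \<gamma>. is_functor C D F \<and> nat_trans A D (comp_func F K) G \<gamma> \<longrightarrow>
        (\<exists>\<alpha>. nat_trans C D F R \<alpha> \<and> (\<forall>a \<in> Obj A. \<kappa> a \<cdot>\<^bsub>D\<^esub> \<alpha> (on_obj K a) = \<gamma> a) \<and>
           (\<forall>\<alpha>'. nat_trans C D F R \<alpha>' \<and> (\<forall>a \<in> Obj A. \<kappa> a \<cdot>\<^bsub>D\<^esub> \<alpha>' (on_obj K a) = \<gamma> a) \<longrightarrow>
              (\<forall>c \<in> Obj C. \<alpha>' c = \<alpha> c))))"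

end

theory Submission
  imports Defs
begin

text \<open>
  The right Kan extension of \<open>Gal\<close> along \<open>Cod\<close> at \<open>B\<close> is the limit of \<open>Gal(p, 0)\<close> over all arrows from
  \<open>B\<close> to the codomain of a normal extension \<open>p\<close>. Two facts make this limit the single value at the
  weakly universal normal extension \<open>u\<close> of \<open>B\<close>. Every arrow \<open>f : B \<rightarrow> Cod p\<close> lifts to a morphism
  \<open>(g, f) : u \<rightarrow> p\<close>, because the pullback of \<open>p\<close> along \<open>f\<close> is again a normal extension and \<open>u\<close> factors
  through it (\<open>weakly_universal_lift\<close>). And \<open>Gal(g, f)\<close> does not depend on \<open>g\<close>
  (\<open>galois_map_eq\<close>). From these two facts the universal property follows formally
  (\<open>right_kan_extension_from_lifts\<close>): \<open>\<alpha>\<close> at \<open>B\<close> must be \<open>\<gamma>\<close> at \<open>u\<close>, because \<open>\<kappa>\<close> at \<open>u\<close> is an identity.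

  That \<open>Gal\<close> is a functor into groups, and independent of \<open>g\<close>, is shown with generalized elements.
  Let \<open>p : E \<rightarrow> B\<close> be normal, with kernel pair \<open>d, c : R \<rightarrow> E\<close>. Elements \<open>e\<close>, \<open>e'\<close> of \<open>E\<close> with
  \<open>p e = p e'\<close> represent the arrow \<open>\<eta> (e, e') : \<eta> e \<rightarrow> \<eta> e'\<close> of the Galois groupoid. As \<open>c\<close> is a trivial
  covering, every arrow whose target has the form \<open>\<eta> e'\<close> is represented by a pair \<open>(e, e')\<close>
  (\<open>galois_arr_lift\<close>). By naturality of \<open>\<eta>\<close> the composite of the arrows represented by \<open>(e, e')\<close> and
  \<open>(e', e'')\<close> is represented by \<open>(e, e'')\<close> (\<open>galois_comp_galois_arr\<close>). So a string of automorphisms of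
  \<open>0\<close> can be written, from its end, as a path of elements of \<open>E\<close> ending in \<open>0\<close>, and the group laws
  become evident. If \<open>f\<close> and \<open>f'\<close> are two lifts of \<open>b\<close> to a morphism \<open>p \<rightarrow> p'\<close> and \<open>(n, 0)\<close> represents
  an automorphism of \<open>0\<close>, then \<open>(f n, f' n)\<close> represents \<open>I (f, f')\<close> applied to \<open>\<eta> n = 0\<close>, which is the
  identity at \<open>0\<close>; hence \<open>(f n, 0)\<close> and \<open>(f' n, 0)\<close> represent the same arrow.

  Both the composition of the Galois groupoid and the stability of normal extensions rest on one
  consequence of admissibility: trivial coverings are stable under pullback, and \<open>I\<close> preserves these
  pullbacks (\<open>pullback_trivial_covering\<close>). Since \<open>X\<close> is a reflective full subcategory, its pullbacks
  are pullbacks in \<open>C\<close> (\<open>is_pullback_X\<close>), and all computations take place in \<open>C\<close>.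
\<close>

section \<open>Limits in a category\<close>

lemma hom_iff [simp]: "f \<in> hom C a b \<longleftrightarrow> f \<in> Arr C \<and> Dom C f = a \<and> Cod C f = b"
  by (simp add: hom_def)

locale small_category =
  fixes C :: "('o, 'm) cat" (structure)
  assumes category: "category C"
begin

lemma dom_cod_obj [simp]:
  assumes "f \<in> Arr C"
  shows "Dom C f \<in> Obj C" and "Cod C f \<in> Obj C"
  using category assms by (auto simp: category_def)

lemma ide [simp]:
  assumes "a \<in> Obj C"
  shows "Ide C a \<in> Arr C" and "Dom C (Ide C a) = a" and "Cod C (Ide C a) = a"
  using category assms by (auto simp: category_def)

lemma comp [simp]:
  assumes "f \<in> Arr C" and "g \<in> Arr C" and "Dom C g = Cod C f"
  shows "g \<cdot> f \<in> Arr C" and "Dom C (g \<cdot> f) = Dom C f" and "Cod C (g \<cdot> f) = Cod C g"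
  using category assms by (auto simp: category_def)

lemma comp_ide [simp]:
  assumes "f \<in> Arr C"
  shows "Dom C f = a \<Longrightarrow> f \<cdot> Ide C a = f" and "Cod C f = b \<Longrightarrow> Ide C b \<cdot> f = f"
  using category assms by (auto simp: category_def)

lemma assoc [simp]:
  assumes "f \<in> Arr C" and "g \<in> Arr C" and "h \<in> Arr C" and "Dom C g = Cod C f" and "Dom C h = Cod C g"
  shows "(h \<cdot> g) \<cdot> f = h \<cdot> (g \<cdot> f)"
  using category assms by (simp add: category_def)

text \<open>
  Composites are kept bracketed to the right; the next two rules apply an equation to the first
  two factors of such a composite.
\<close>

lemma comp_cong_left:
  assumes "g \<cdot> f = k" and "f \<in> Arr C" and "g \<in> Arr C" and "Dom C g = Cod C f"
    and "x \<in> Arr C" and "Dom C f = Cod C x"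
  shows "g \<cdot> (f \<cdot> x) = k \<cdot> x"
  using assms assoc by metis

lemma comp_swap_left:
  assumes "g \<cdot> f = k \<cdot> l" and "f \<in> Arr C" and "g \<in> Arr C" and "Dom C g = Cod C f"
    and "l \<in> Arr C" and "k \<in> Arr C" and "Dom C k = Cod C l"
    and "x \<in> Arr C" and "Dom C f = Cod C x"
  shows "g \<cdot> (f \<cdot> x) = k \<cdot> (l \<cdot> x)"
  using assms assoc comp(2) by metis

subsection \<open>Isomorphisms\<close>

lemma is_inverse_unique:
  assumes "is_inverse C f g" and "is_inverse C f g'"
  shows "g = g'"
proof -
  have "g = g \<cdot> (f \<cdot> g')" using assms by (simp add: is_inverse_def)
  also have "\<dots> = (g \<cdot> f) \<cdot> g'" using assms by (subst assoc) (simp_all add: is_inverse_def)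
  also have "\<dots> = g'" using assms by (simp add: is_inverse_def)
  finally show ?thesis .
qed

lemma inverse_arr_eq: "is_inverse C f g \<Longrightarrow> inverse_arr C f = g"
  unfolding inverse_arr_def using is_inverse_unique by blast

subsection \<open>Pullbacks\<close>

lemma pullback_square:
  assumes "is_pullback C f g p q"
  shows "f \<in> Arr C" and "g \<in> Arr C" and "Cod C f = Cod C g" and "p \<in> Arr C" and "q \<in> Arr C"
    and "Dom C q = Dom C p" and "Cod C p = Dom C f" and "Cod C q = Dom C g" and "f \<cdot> p = g \<cdot> q"
  using assms by (simp_all add: is_pullback_def)

lemma pullback_lift:
  assumes "is_pullback C f g p q" and "a \<in> Arr C" and "b \<in> Arr C" and "Dom C a = Dom C b"
    and "Cod C a = Dom C f" and "Cod C b = Dom C g" and "f \<cdot> a = g \<cdot> b"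
  obtains h where "h \<in> hom C (Dom C a) (Dom C p)" and "p \<cdot> h = a" and "q \<cdot> h = b"
  using assms unfolding is_pullback_def by metis

lemma pullback_jointly_monic:
  assumes "is_pullback C f g p q" and "h \<in> Arr C" and "h' \<in> Arr C" and "Dom C h = Dom C h'"
    and "Cod C h = Dom C p" and "Cod C h' = Dom C p" and "p \<cdot> h = p \<cdot> h'" and "q \<cdot> h = q \<cdot> h'"
  shows "h = h'"
proof -
  note sq = pullback_square[OF assms(1)]
  have eq: "f \<cdot> (p \<cdot> h') = g \<cdot> (q \<cdot> h')"
    by (rule comp_swap_left) (use sq assms in simp_all)
  have ex: "\<And>a b. \<lbrakk>a \<in> Arr C; b \<in> Arr C; Dom C a = Dom C b \<and> Cod C a = Dom C f \<and> Cod C b = Dom C g \<and> f \<cdot> a = g \<cdot> b\<rbrakk>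
      \<Longrightarrow> \<exists>!k. k \<in> hom C (Dom C a) (Dom C p) \<and> p \<cdot> k = a \<and> q \<cdot> k = b"
    using assms(1) unfolding is_pullback_def by blast
  have "\<exists>!k. k \<in> hom C (Dom C (p \<cdot> h')) (Dom C p) \<and> p \<cdot> k = p \<cdot> h' \<and> q \<cdot> k = q \<cdot> h'"
    by (rule ex) (use eq sq assms(2-6) in simp_all)
  then show ?thesis using assms sq by auto
qed

lemma is_pullbackI:
  assumes "f \<in> Arr C" and "g \<in> Arr C" and "Cod C f = Cod C g" and "p \<in> Arr C" and "q \<in> Arr C"
    and "Dom C q = Dom C p" and "Cod C p = Dom C f" and "Cod C q = Dom C g" and "f \<cdot> p = g \<cdot> q"
    and lift: "\<And>a b. \<lbrakk>a \<in> Arr C; b \<in> Arr C; Dom C b = Dom C a; Cod C a = Dom C f; Cod C b = Dom C g;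
           f \<cdot> a = g \<cdot> b\<rbrakk> \<Longrightarrow> \<exists>h. h \<in> hom C (Dom C a) (Dom C p) \<and> p \<cdot> h = a \<and> q \<cdot> h = b"
    and monic: "\<And>h h'. \<lbrakk>h \<in> Arr C; h' \<in> Arr C; Dom C h' = Dom C h; Cod C h = Dom C p; Cod C h' = Dom C p;
           p \<cdot> h' = p \<cdot> h; q \<cdot> h' = q \<cdot> h\<rbrakk> \<Longrightarrow> h' = h"
  shows "is_pullback C f g p q"
  unfolding is_pullback_def
proof (intro conjI ballI impI)
  fix a b
  assume ab: "a \<in> Arr C" "b \<in> Arr C"
    "Dom C a = Dom C b \<and> Cod C a = Dom C f \<and> Cod C b = Dom C g \<and> f \<cdot> a = g \<cdot> b"
  then obtain h where h: "h \<in> hom C (Dom C a) (Dom C p)" "p \<cdot> h = a" "q \<cdot> h = b"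
    using lift by metis
  then show "\<exists>!h. h \<in> hom C (Dom C a) (Dom C p) \<and> p \<cdot> h = a \<and> q \<cdot> h = b"
    by (intro ex1I[of _ h]) (auto intro!: monic)
qed (use assms in simp_all)

lemma tuple_pullback:
  assumes "is_pullback C f g (fst P) (snd P)" and "a \<in> Arr C" and "b \<in> Arr C" and "Dom C b = Dom C a"
    and "Cod C a = Dom C f" and "Cod C b = Dom C g" and "f \<cdot> a = g \<cdot> b"
  shows "tuple C P a b \<in> Arr C" and "Dom C (tuple C P a b) = Dom C a"
    and "Cod C (tuple C P a b) = Dom C (fst P)"
    and "fst P \<cdot> tuple C P a b = a" and "snd P \<cdot> tuple C P a b = b"
proof -
  have "\<exists>!h. h \<in> hom C (Dom C a) (Dom C (fst P)) \<and> fst P \<cdot> h = a \<and> snd P \<cdot> h = b"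
    using assms unfolding is_pullback_def by metis
  from theI'[OF this]
  have "tuple C P a b \<in> hom C (Dom C a) (Dom C (fst P)) \<and>
     fst P \<cdot> tuple C P a b = a \<and> snd P \<cdot> tuple C P a b = b"
    unfolding tuple_def .
  then show "tuple C P a b \<in> Arr C" and "Dom C (tuple C P a b) = Dom C a"
    and "Cod C (tuple C P a b) = Dom C (fst P)"
    and "fst P \<cdot> tuple C P a b = a" and "snd P \<cdot> tuple C P a b = b"
    by simp_all
qed

lemma tuple_pullback_unique:
  assumes "is_pullback C f g (fst P) (snd P)" and "h \<in> Arr C" and "Cod C h = Dom C (fst P)"
    and "fst P \<cdot> h = a" and "snd P \<cdot> h = b"
  shows "tuple C P a b = h"
proof -
  note sq = pullback_square[OF assms(1)]
  have eq: "f \<cdot> a = g \<cdot> b"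
    unfolding assms(4)[symmetric] assms(5)[symmetric]
    by (rule comp_swap_left) (use sq assms in simp_all)
  have "Dom C a = Dom C h" and "a \<in> Arr C" and "b \<in> Arr C" and "Dom C b = Dom C h"
    and "Cod C a = Dom C f" and "Cod C b = Dom C g"
    using sq assms by auto
  note t = this
  show ?thesis
    by (rule pullback_jointly_monic[OF assms(1)]) (use tuple_pullback[OF assms(1)] eq t assms in simp_all)
qed

lemma pullback_paste:
  assumes right: "is_pullback C f g p q" and left: "is_pullback C q h p' q'"
  shows "is_pullback C f (g \<cdot> h) (p \<cdot> p') q'"
proof (rule is_pullbackI)
  note r = pullback_square[OF right] and l = pullback_square[OF left]
  show "f \<cdot> p \<cdot> p' = (g \<cdot> h) \<cdot> q'"
  proof -
    have "f \<cdot> p \<cdot> p' = g \<cdot> q \<cdot> p'" by (rule comp_swap_left) (use r l in simp_all)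
    then show ?thesis using r l by simp
  qed
  fix a b assume ab: "a \<in> Arr C" "b \<in> Arr C" "Dom C b = Dom C a" "Cod C a = Dom C f" "Cod C b = Dom C (g \<cdot> h)"
      "f \<cdot> a = (g \<cdot> h) \<cdot> b"
  then have "f \<cdot> a = g \<cdot> (h \<cdot> b)" using r l by simp
  then obtain k where k: "k \<in> hom C (Dom C a) (Dom C p)" "p \<cdot> k = a" "q \<cdot> k = h \<cdot> b"
    using pullback_lift[OF right, of a "h \<cdot> b"] r l ab by auto
  then obtain k' where k': "k' \<in> hom C (Dom C a) (Dom C p')" "p' \<cdot> k' = k" "q' \<cdot> k' = b"
    using pullback_lift[OF left, of k b] r l ab by auto
  then show "\<exists>k. k \<in> hom C (Dom C a) (Dom C (p \<cdot> p')) \<and> (p \<cdot> p') \<cdot> k = a \<and> q' \<cdot> k = b"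
    using k r l by (intro exI[of _ k']) auto
next
  note r = pullback_square[OF right] and l = pullback_square[OF left]
  fix k k' assume k: "k \<in> Arr C" "k' \<in> Arr C" "Dom C k' = Dom C k" "Cod C k = Dom C (p \<cdot> p')"
    "Cod C k' = Dom C (p \<cdot> p')" "(p \<cdot> p') \<cdot> k' = (p \<cdot> p') \<cdot> k" "q' \<cdot> k' = q' \<cdot> k"
  have "q \<cdot> p' \<cdot> k' = h \<cdot> q' \<cdot> k'" by (rule comp_swap_left) (use r l k in simp_all)
  moreover have "q \<cdot> p' \<cdot> k = h \<cdot> q' \<cdot> k" by (rule comp_swap_left) (use r l k in simp_all)
  ultimately have "p' \<cdot> k' = p' \<cdot> k"
    using pullback_jointly_monic[OF right, of "p' \<cdot> k'" "p' \<cdot> k"] r l k by simp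
  then show "k' = k" using pullback_jointly_monic[OF left] r l k by simp
qed (use pullback_square[OF right] pullback_square[OF left] in simp_all)

lemma pullback_cancel:
  assumes right: "is_pullback C f g p q" and outer: "is_pullback C f (g \<cdot> h) (p \<cdot> p') q'"
    and sq: "q \<cdot> p' = h \<cdot> q'"
    and arr: "h \<in> Arr C" "Cod C h = Dom C g" "p' \<in> Arr C" "Cod C p' = Dom C p"
  shows "is_pullback C q h p' q'"
proof (rule is_pullbackI)
  note r = pullback_square[OF right] and o = pullback_square[OF outer]
  fix a b assume ab: "a \<in> Arr C" "b \<in> Arr C" "Dom C b = Dom C a" "Cod C a = Dom C q" "Cod C b = Dom C h"
      "q \<cdot> a = h \<cdot> b"
  have "f \<cdot> (p \<cdot> a) = g \<cdot> (q \<cdot> a)" by (rule comp_swap_left) (use r ab in simp_all)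
  then obtain k where k: "k \<in> hom C (Dom C a) (Dom C p')" "(p \<cdot> p') \<cdot> k = p \<cdot> a" "q' \<cdot> k = b"
    using pullback_lift[OF outer, of "p \<cdot> a" b] r o arr ab by auto
  have "q \<cdot> (p' \<cdot> k) = h \<cdot> (q' \<cdot> k)"
    by (rule comp_swap_left) (use sq r o arr k in simp_all)
  then have "p' \<cdot> k = a"
    using pullback_jointly_monic[OF right, of "p' \<cdot> k" a] r k ab arr by simp
  then show "\<exists>k. k \<in> hom C (Dom C a) (Dom C p') \<and> p' \<cdot> k = a \<and> q' \<cdot> k = b"
    using k by blast
next
  note r = pullback_square[OF right] and o = pullback_square[OF outer]
  fix k k' assume k: "k \<in> Arr C" "k' \<in> Arr C" "Dom C k' = Dom C k" "Cod C k = Dom C p'"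
    "Cod C k' = Dom C p'" "p' \<cdot> k' = p' \<cdot> k" "q' \<cdot> k' = q' \<cdot> k"
  show "k' = k"
    by (rule pullback_jointly_monic[OF outer]) (use r o arr k in simp_all)
qed (use pullback_square[OF right] pullback_square[OF outer] arr sq in simp_all)

text \<open>
  This recognizes the naturality square of \<open>\<eta>\<close> at an arrow \<open>q\<close> as a pullback when \<open>I q\<close> is known
  only up to an isomorphism \<open>j\<close>.
\<close>

lemma pullback_iso_corner:
  assumes pb: "is_pullback C f g p q" and j: "is_inverse C j i" "Dom C j = Dom C f"
  shows "is_pullback C (f \<cdot> i) g (j \<cdot> p) q"
proof (rule is_pullbackI)
  note r = pullback_square[OF pb]
  have ji: "j \<in> Arr C" "i \<in> Arr C" "Dom C i = Cod C j" "Cod C i = Dom C j" "i \<cdot> j = Ide C (Dom C j)" "j \<cdot> i = Ide C (Cod C j)"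
    using j by (simp_all add: is_inverse_def)
  have ijx: "i \<cdot> (j \<cdot> x) = x" if "x \<in> Arr C" "Cod C x = Dom C j" for x
    using comp_cong_left[OF ji(5)] ji that by simp
  have jix: "j \<cdot> (i \<cdot> x) = x" if "x \<in> Arr C" "Cod C x = Cod C j" for x
    using comp_cong_left[OF ji(6)] ji that by simp
  show "(f \<cdot> i) \<cdot> j \<cdot> p = g \<cdot> q" using r ji j ijx by simp
  {
    fix a b assume ab: "a \<in> Arr C" "b \<in> Arr C" "Dom C b = Dom C a" "Cod C a = Dom C (f \<cdot> i)" "Cod C b = Dom C g"
      "(f \<cdot> i) \<cdot> a = g \<cdot> b"
    then obtain k where k: "k \<in> hom C (Dom C a) (Dom C p)" "p \<cdot> k = i \<cdot> a" "q \<cdot> k = b"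
      using pullback_lift[OF pb, of "i \<cdot> a" b] r ji j by auto
    then have "(j \<cdot> p) \<cdot> k = a" using ji j r ab jix by simp
    then show "\<exists>k. k \<in> hom C (Dom C a) (Dom C (j \<cdot> p)) \<and> (j \<cdot> p) \<cdot> k = a \<and> q \<cdot> k = b"
      using k ji j r by (intro exI[of _ k]) simp
  next
    fix k k' assume k: "k \<in> Arr C" "k' \<in> Arr C" "Dom C k' = Dom C k" "Cod C k = Dom C (j \<cdot> p)"
      "Cod C k' = Dom C (j \<cdot> p)" "(j \<cdot> p) \<cdot> k' = (j \<cdot> p) \<cdot> k" "q \<cdot> k' = q \<cdot> k"
    then have "i \<cdot> (j \<cdot> (p \<cdot> k')) = i \<cdot> (j \<cdot> (p \<cdot> k))" using r ji j by simp
    then have "p \<cdot> k' = p \<cdot> k" using ijx r ji j k by simp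
    then show "k' = k" using pullback_jointly_monic[OF pb] r ji j k by simp
  }
qed (use pullback_square[OF pb] j in \<open>simp_all add: is_inverse_def\<close>)

text \<open>
  A full subcategory need not be closed under isomorphisms, so the vertex of a pullback may first
  have to be moved to an isomorphic object, such as its reflection.
\<close>

lemma pullback_iso_vertex:
  assumes pb: "is_pullback C f g p q" and j: "is_inverse C j i" "Cod C j = Dom C p"
  shows "is_pullback C f g (p \<cdot> j) (q \<cdot> j)"
proof (rule is_pullbackI)
  note r = pullback_square[OF pb]
  have ji: "j \<in> Arr C" "i \<in> Arr C" "Dom C i = Cod C j" "Cod C i = Dom C j" "i \<cdot> j = Ide C (Dom C j)" "j \<cdot> i = Ide C (Cod C j)"
    using j by (simp_all add: is_inverse_def)
  have ijx: "i \<cdot> (j \<cdot> x) = x" if "x \<in> Arr C" "Cod C x = Dom C j" for x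
    using comp_cong_left[OF ji(5)] ji that by simp
  have jix: "j \<cdot> (i \<cdot> x) = x" if "x \<in> Arr C" "Cod C x = Cod C j" for x
    using comp_cong_left[OF ji(6)] ji that by simp
  show "f \<cdot> (p \<cdot> j) = g \<cdot> (q \<cdot> j)" by (rule comp_swap_left) (use r ji j in simp_all)
  {
    fix a b assume ab: "a \<in> Arr C" "b \<in> Arr C" "Dom C b = Dom C a" "Cod C a = Dom C f" "Cod C b = Dom C g"
      "f \<cdot> a = g \<cdot> b"
    then obtain k where k: "k \<in> hom C (Dom C a) (Dom C p)" "p \<cdot> k = a" "q \<cdot> k = b"
      using pullback_lift[OF pb, of a b] by auto
    then show "\<exists>k. k \<in> hom C (Dom C a) (Dom C (p \<cdot> j)) \<and> (p \<cdot> j) \<cdot> k = a \<and> (q \<cdot> j) \<cdot> k = b"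
      using jix ji j r by (intro exI[of _ "i \<cdot> k"]) simp
  next
    fix k k' assume k: "k \<in> Arr C" "k' \<in> Arr C" "Dom C k' = Dom C k" "Cod C k = Dom C (p \<cdot> j)"
      "Cod C k' = Dom C (p \<cdot> j)" "(p \<cdot> j) \<cdot> k' = (p \<cdot> j) \<cdot> k" "(q \<cdot> j) \<cdot> k' = (q \<cdot> j) \<cdot> k"
    then have "j \<cdot> k' = j \<cdot> k" using pullback_jointly_monic[OF pb, of "j \<cdot> k'" "j \<cdot> k"] r ji j by simp
    then have "i \<cdot> (j \<cdot> k') = i \<cdot> (j \<cdot> k)" by simp
    then show "k' = k" using ijx r ji j k by simp
  }
qed (use pullback_square[OF pb] j in \<open>simp_all add: is_inverse_def\<close>)

lemma pullback_comparison:
  assumes "is_pullback C f g (fst P) (snd P)" and "is_pullback C f g p q"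
  shows "is_inverse C (tuple C P p q) (tuple C (p, q) (fst P) (snd P))"
proof -
  note sq = pullback_square[OF assms(1)] pullback_square[OF assms(2)]
  note t = tuple_pullback[OF assms(1), of p q] tuple_pullback[of f g "(p, q)" "fst P" "snd P"]
  let ?w = "tuple C P p q" and ?v = "tuple C (p, q) (fst P) (snd P)"
  have w: "?w \<in> Arr C" "Dom C ?w = Dom C p" "Cod C ?w = Dom C (fst P)" "fst P \<cdot> ?w = p" "snd P \<cdot> ?w = q"
    and v: "?v \<in> Arr C" "Dom C ?v = Dom C (fst P)" "Cod C ?v = Dom C p" "p \<cdot> ?v = fst P" "q \<cdot> ?v = snd P"
    using assms sq t by simp_all
  have "?v \<cdot> ?w = Ide C (Dom C p)"
    by (rule pullback_jointly_monic[OF assms(2)])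
      (use sq w v comp_cong_left[OF v(4), of ?w] comp_cong_left[OF v(5), of ?w] in simp_all)
  moreover have "?w \<cdot> ?v = Ide C (Dom C (fst P))"
    by (rule pullback_jointly_monic[OF assms(1)])
      (use sq w v comp_cong_left[OF w(4), of ?v] comp_cong_left[OF w(5), of ?v] in simp_all)
  ultimately show ?thesis using w v by (simp add: is_inverse_def)
qed

lemma pullback_chosen:
  assumes "is_pullback C f g p q"
  shows "is_pullback C f g (fst (pullback C f g)) (snd (pullback C f g))"
  unfolding pullback_def by (rule someI[where x = "(p, q)"]) (use assms in simp)

subsection \<open>Products\<close>

lemma product_span:
  assumes "is_product C x y p q"
  shows "p \<in> Arr C" and "q \<in> Arr C" and "Dom C q = Dom C p" and "Cod C p = x" and "Cod C q = y"
  using assms by (simp_all add: is_product_def)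

lemma product_jointly_monic:
  assumes "is_product C x y p q" and "h \<in> Arr C" and "h' \<in> Arr C" and "Dom C h = Dom C h'"
    and "Cod C h = Dom C p" and "Cod C h' = Dom C p" and "p \<cdot> h = p \<cdot> h'" and "q \<cdot> h = q \<cdot> h'"
  shows "h = h'"
proof -
  note sp = product_span[OF assms(1)]
  have ex: "\<And>a b. \<lbrakk>a \<in> Arr C; b \<in> Arr C; Dom C a = Dom C b \<and> Cod C a = x \<and> Cod C b = y\<rbrakk>
      \<Longrightarrow> \<exists>!k. k \<in> hom C (Dom C a) (Dom C p) \<and> p \<cdot> k = a \<and> q \<cdot> k = b"
    using assms(1) unfolding is_product_def by blast
  have "\<exists>!k. k \<in> hom C (Dom C (p \<cdot> h')) (Dom C p) \<and> p \<cdot> k = p \<cdot> h' \<and> q \<cdot> k = q \<cdot> h'"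
    by (rule ex) (use sp assms(2-6) in simp_all)
  then show ?thesis using assms sp by auto
qed

lemma tuple_product:
  assumes "is_product C x y (fst P) (snd P)" and "a \<in> Arr C" and "b \<in> Arr C" and "Dom C b = Dom C a"
    and "Cod C a = x" and "Cod C b = y"
  shows "tuple C P a b \<in> Arr C" and "Dom C (tuple C P a b) = Dom C a"
    and "Cod C (tuple C P a b) = Dom C (fst P)"
    and "fst P \<cdot> tuple C P a b = a" and "snd P \<cdot> tuple C P a b = b"
proof -
  have "\<exists>!h. h \<in> hom C (Dom C a) (Dom C (fst P)) \<and> fst P \<cdot> h = a \<and> snd P \<cdot> h = b"
    using assms unfolding is_product_def by metis
  from theI'[OF this]
  have "tuple C P a b \<in> hom C (Dom C a) (Dom C (fst P)) \<and>
     fst P \<cdot> tuple C P a b = a \<and> snd P \<cdot> tuple C P a b = b"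
    unfolding tuple_def .
  then show "tuple C P a b \<in> Arr C" and "Dom C (tuple C P a b) = Dom C a"
    and "Cod C (tuple C P a b) = Dom C (fst P)"
    and "fst P \<cdot> tuple C P a b = a" and "snd P \<cdot> tuple C P a b = b"
    by simp_all
qed

lemma tuple_product_comp:
  assumes "is_product C x y (fst P) (snd P)" and "a \<in> Arr C" and "b \<in> Arr C" and "Dom C b = Dom C a"
    and "Cod C a = x" and "Cod C b = y" and "t \<in> Arr C" and "Cod C t = Dom C a"
  shows "tuple C P a b \<cdot> t = tuple C P (a \<cdot> t) (b \<cdot> t)"
proof -
  note sp = product_span[OF assms(1)]
  note t = tuple_product[OF assms(1-6)]
  note t' = tuple_product[OF assms(1), of "a \<cdot> t" "b \<cdot> t"]
  show ?thesis
    by (rule product_jointly_monic[OF assms(1)])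
      (use sp t t' assms comp_cong_left[OF t(4), of t] comp_cong_left[OF t(5), of t] in simp_all)
qed

lemma product_chosen:
  assumes "is_product C x y p q"
  shows "is_product C x y (fst (product C x y)) (snd (product C x y))"
  unfolding product_def by (rule someI[where x = "(p, q)"]) (use assms in simp)

lemma product_of_pullback:
  assumes "is_terminal C t" and "f \<in> hom C x t" and "g \<in> hom C y t" and pb: "is_pullback C f g p q"
  shows "is_product C x y p q"
proof -
  note sq = pullback_square[OF pb]
  have "f \<cdot> a = g \<cdot> b" if "a \<in> Arr C" "b \<in> Arr C" "Dom C a = Dom C b" "Cod C a = x" "Cod C b = y" for a b
  proof -
    have "f \<cdot> a \<in> hom C (Dom C a) t" "g \<cdot> b \<in> hom C (Dom C a) t" using that assms(2,3) by simp_all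
    moreover have "Dom C a \<in> Obj C" using that by simp
    ultimately show ?thesis using assms(1) unfolding is_terminal_def by blast
  qed
  then show ?thesis using pb assms(2,3) sq unfolding is_product_def is_pullback_def by simp
qed

subsection \<open>Factorizations through monomorphisms\<close>

lemma factor_eq:
  assumes "h \<in> Arr C" and "Dom C k = Cod C h" and "k \<in> Arr C" and "k \<cdot> h = f"
    and "\<And>h'. \<lbrakk>h' \<in> Arr C; Dom C h' = Dom C h; Cod C h' = Dom C k; k \<cdot> h' = k \<cdot> h\<rbrakk> \<Longrightarrow> h' = h"
  shows "factor C k f = h"
  unfolding factor_def by (rule the_equality) (use assms in auto)

end

subsection \<open>Pullbacks from finite limits\<close>

text \<open>
  The arrows \<open>3 : 0 \<rightarrow> 2\<close> and \<open>4 : 1 \<rightarrow> 2\<close> are the two legs; every object is its own identity.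
\<close>

definition cospan_shape :: "(nat, nat) cat" where
  "cospan_shape = \<lparr>Obj = {0, 1, 2}, Arr = {0, 1, 2, 3, 4},
     Dom = (\<lambda>t. if t = 3 then 0 else if t = 4 then 1 else t),
     Cod = (\<lambda>t. if t = 3 \<or> t = 4 then 2 else t),
     Ide = (\<lambda>i. i),
     Comp = (\<lambda>s t. if s = 3 \<or> s = 4 then s else t)\<rparr>"

lemma category_cospan_shape: "category cospan_shape"
  by (simp add: category_def cospan_shape_def)

definition cospan_diagram :: "('o, 'm) cat \<Rightarrow> 'm \<Rightarrow> 'm \<Rightarrow> (nat, nat, 'o, 'm) func" where
  "cospan_diagram C f g =
    (let ob = (\<lambda>i. if i = 0 then Dom C f else if i = 1 then Dom C g else Cod C f)
     in \<lparr>on_obj = ob, on_arr = (\<lambda>t. if t = 3 then f else if t = 4 then g else Ide C (ob t))\<rparr>)"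

context small_category
begin

lemma functor_cospan_diagram:
  assumes "f \<in> Arr C" and "g \<in> Arr C" and "Cod C f = Cod C g"
  shows "is_functor cospan_shape C (cospan_diagram C f g)"
  unfolding is_functor_def
  by (intro conjI category category_cospan_shape)
    (use assms in \<open>simp_all add: cospan_shape_def cospan_diagram_def\<close>)

lemma pullback_exists:
  assumes "finitely_complete C" and arr: "f \<in> Arr C" "g \<in> Arr C" "Cod C f = Cod C g"
  obtains p q where "is_pullback C f g p q"
proof -
  let ?J = cospan_shape and ?D = "cospan_diagram C f g"
  have "finite (Obj ?J)" and "finite (Arr ?J)" by (simp_all add: cospan_shape_def)
  then obtain a l where lim: "is_limit ?J C ?D a l"
    using assms(1) functor_cospan_diagram[OF arr] unfolding finitely_complete_def by blast
  have cone_iff: "is_cone ?J C ?D b m \<longleftrightarrow> b \<in> Obj C \<and>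
      m 0 \<in> hom C b (Dom C f) \<and> m 1 \<in> hom C b (Dom C g) \<and> m 2 \<in> hom C b (Cod C f) \<and>
      f \<cdot> m 0 = m 2 \<and> g \<cdot> m 1 = m 2" for b m
    using arr by (auto simp: is_cone_def cospan_shape_def cospan_diagram_def)
  have l: "a \<in> Obj C" "l 0 \<in> hom C a (Dom C f)" "l 1 \<in> hom C a (Dom C g)" "f \<cdot> l 0 = l 2" "g \<cdot> l 1 = l 2"
    using lim unfolding is_limit_def cone_iff by blast+
  have univ: "\<exists>!h. h \<in> hom C b a \<and> l 0 \<cdot> h = m 0 \<and> l 1 \<cdot> h = m 1 \<and> l 2 \<cdot> h = m 2"
    if "is_cone ?J C ?D b m" for b m
    using lim that unfolding is_limit_def by (simp add: cospan_shape_def)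
  have "is_pullback C f g (l 0) (l 1)"
  proof (rule is_pullbackI)
    fix x y assume xy: "x \<in> Arr C" "y \<in> Arr C" "Dom C y = Dom C x" "Cod C x = Dom C f" "Cod C y = Dom C g"
      "f \<cdot> x = g \<cdot> y"
    let ?m = "\<lambda>i::nat. if i = 0 then x else if i = 1 then y else f \<cdot> x"
    have "is_cone ?J C ?D (Dom C x) ?m" unfolding cone_iff using xy arr by simp
    from univ[OF this] show "\<exists>h. h \<in> hom C (Dom C x) (Dom C (l 0)) \<and> l 0 \<cdot> h = x \<and> l 1 \<cdot> h = y"
      using l by auto
  next
    fix h h' assume h: "h \<in> Arr C" "h' \<in> Arr C" "Dom C h' = Dom C h" "Cod C h = Dom C (l 0)"
      "Cod C h' = Dom C (l 0)" "l 0 \<cdot> h' = l 0 \<cdot> h" "l 1 \<cdot> h' = l 1 \<cdot> h"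
    let ?m = "\<lambda>i::nat. l i \<cdot> h"
    have 2: "l 2 \<cdot> k = f \<cdot> (l 0 \<cdot> k)" "l 2 \<cdot> k = g \<cdot> (l 1 \<cdot> k)" if "k \<in> Arr C" "Cod C k = a" for k
      using l arr that comp_cong_left[OF l(4)] comp_cong_left[OF l(5)] by simp_all
    have "l 2 \<in> hom C a (Cod C f)" unfolding l(4)[symmetric] using l(2) arr by simp
    then have "is_cone ?J C ?D (Dom C h) ?m" unfolding cone_iff using h l arr 2 by simp
    from univ[OF this] have "\<exists>!k. k \<in> hom C (Dom C h) a \<and> l 0 \<cdot> k = l 0 \<cdot> h \<and> l 1 \<cdot> k = l 1 \<cdot> h \<and> l 2 \<cdot> k = l 2 \<cdot> h"
      by simp
    moreover have "l 2 \<cdot> h' = l 2 \<cdot> h" using 2 h l by simp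
    ultimately show "h' = h" using h l by auto
  qed (use arr l in simp_all)
  then show thesis by (rule that)
qed

end

subsection \<open>Zero arrows\<close>

locale pointed_category = small_category +
  assumes pointed: "pointed C"
begin

lemma zero_obj_arrows:
  assumes "is_zero_obj C z" and "a \<in> Obj C"
  shows "\<exists>!f. f \<in> hom C a z" and "\<exists>!f. f \<in> hom C z a"
  using assms unfolding is_zero_obj_def is_terminal_def is_initial_def by blast+

text \<open>
  Factorizations through two zero objects \<open>z\<close> and \<open>z'\<close> agree because both are compatible with the
  arrow \<open>z \<rightarrow> z'\<close>.
\<close>

lemma zero_arr_eq:
  assumes z: "is_zero_obj C z" and g: "g \<in> hom C a z" and h: "h \<in> hom C z b"
  shows "zero_arr C a b = h \<cdot> g"
  unfolding zero_arr_def
proof (rule the_equality)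
  show "\<exists>z g' h'. is_zero_obj C z \<and> g' \<in> hom C a z \<and> h' \<in> hom C z b \<and> h \<cdot> g = h' \<cdot> g'"
    using assms by blast
next
  fix f assume "\<exists>z g h. is_zero_obj C z \<and> g \<in> hom C a z \<and> h \<in> hom C z b \<and> f = h \<cdot> g"
  then obtain z' g' h' where z': "is_zero_obj C z'" and g': "g' \<in> hom C a z'" and h': "h' \<in> hom C z' b"
    and f: "f = h' \<cdot> g'" by blast
  have ob: "z \<in> Obj C" "z' \<in> Obj C" "a \<in> Obj C" "b \<in> Obj C" using g g' h by auto
  obtain i where i: "i \<in> hom C z z'" using zero_obj_arrows(1)[OF z' ob(1)] by blast
  have "i \<cdot> g \<in> hom C a z'" using i g by simp
  then have ig: "i \<cdot> g = g'" using zero_obj_arrows(1)[OF z' ob(3)] g' by blast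
  have "h' \<cdot> i \<in> hom C z b" using i h' by simp
  then have hi: "h' \<cdot> i = h" using zero_obj_arrows(2)[OF z ob(4)] h by blast
  have "h \<cdot> g = h' \<cdot> (i \<cdot> g)" unfolding hi[symmetric] using i g h' by simp
  then show "f = h \<cdot> g" using f ig by simp
qed

lemma zero_arr_factors:
  assumes "a \<in> Obj C" and "b \<in> Obj C" and "is_zero_obj C z"
  obtains g h where "g \<in> hom C a z" and "h \<in> hom C z b" and "zero_arr C a b = h \<cdot> g"
proof -
  obtain g where g: "g \<in> hom C a z" using zero_obj_arrows(1)[OF assms(3,1)] by (rule ex1E)
  obtain h where h: "h \<in> hom C z b" using zero_obj_arrows(2)[OF assms(3,2)] by (rule ex1E)
  show thesis by (rule that[OF g h zero_arr_eq[OF assms(3) g h]])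
qed

lemma zero_arr [simp]:
  assumes "a \<in> Obj C" and "b \<in> Obj C"
  shows "zero_arr C a b \<in> Arr C" and "Dom C (zero_arr C a b) = a" and "Cod C (zero_arr C a b) = b"
proof -
  obtain z where "is_zero_obj C z" using pointed unfolding pointed_def by blast
  from zero_arr_factors[OF assms this]
  obtain g h where "g \<in> hom C a z" "h \<in> hom C z b" "zero_arr C a b = h \<cdot> g" .
  then show "zero_arr C a b \<in> Arr C" and "Dom C (zero_arr C a b) = a" and "Cod C (zero_arr C a b) = b"
    by simp_all
qed

lemma comp_zero [simp]:
  assumes "f \<in> Arr C" and "a \<in> Obj C" and "Dom C f = b"
  shows "f \<cdot> zero_arr C a b = zero_arr C a (Cod C f)"
proof -
  obtain z where z: "is_zero_obj C z" using pointed unfolding pointed_def by blast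
  have ob: "a \<in> Obj C" "b \<in> Obj C" using assms by auto
  obtain g h where gh: "g \<in> hom C a z" "h \<in> hom C z b" "zero_arr C a b = h \<cdot> g"
    using zero_arr_factors[OF ob z] .
  then have "zero_arr C a (Cod C f) = (f \<cdot> h) \<cdot> g"
    using assms by (intro zero_arr_eq[OF z]) simp_all
  then show ?thesis using gh assms by simp
qed

lemma zero_comp [simp]:
  assumes "f \<in> Arr C" and "b \<in> Obj C" and "Cod C f = a"
  shows "zero_arr C a b \<cdot> f = zero_arr C (Dom C f) b"
proof -
  obtain z where z: "is_zero_obj C z" using pointed unfolding pointed_def by blast
  have ob: "a \<in> Obj C" "b \<in> Obj C" using assms by auto
  obtain g h where gh: "g \<in> hom C a z" "h \<in> hom C z b" "zero_arr C a b = h \<cdot> g"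
    using zero_arr_factors[OF ob z] .
  then have "zero_arr C (Dom C f) b = h \<cdot> (g \<cdot> f)"
    using assms by (intro zero_arr_eq[OF z]) simp_all
  then show ?thesis using gh assms by simp
qed

lemma zero_obj_iso:
  assumes z: "is_zero_obj C z" and i: "is_inverse C i j" "Dom C i = z"
  shows "is_zero_obj C (Cod C i)"
proof -
  have ij: "i \<in> Arr C" "j \<in> Arr C" "Dom C j = Cod C i" "Cod C j = z" "i \<cdot> j = Ide C (Cod C i)"
    using i by (simp_all add: is_inverse_def)
  have "\<exists>!f. f \<in> hom C a (Cod C i)" if a: "a \<in> Obj C" for a
  proof -
    obtain g where g: "g \<in> hom C a z" "\<And>g'. g' \<in> hom C a z \<Longrightarrow> g' = g"
      using zero_obj_arrows(1)[OF z a] by blast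
    have "f = i \<cdot> g" if f: "f \<in> hom C a (Cod C i)" for f
      using g(2)[of "j \<cdot> f"] comp_cong_left[OF ij(5), of f] ij f i(2) by simp
    then show ?thesis using g(1) ij i(2) by (intro ex1I[of _ "i \<cdot> g"]) simp_all
  qed
  moreover have "\<exists>!f. f \<in> hom C (Cod C i) a" if a: "a \<in> Obj C" for a
  proof -
    obtain g where g: "g \<in> hom C z a" "\<And>g'. g' \<in> hom C z a \<Longrightarrow> g' = g"
      using zero_obj_arrows(2)[OF z a] by blast
    have "f = g \<cdot> j" if f: "f \<in> hom C (Cod C i) a" for f
    proof -
      have "f \<cdot> i = g" using g(2)[of "f \<cdot> i"] ij f i(2) by simp
      moreover have "(f \<cdot> i) \<cdot> j = f" using ij f i(2) by simp
      ultimately show ?thesis by metis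
    qed
    then show ?thesis using g(1) ij i(2) by (intro ex1I[of _ "g \<cdot> j"]) simp_all
  qed
  ultimately show ?thesis using ij by (simp add: is_zero_obj_def is_terminal_def is_initial_def)
qed

end

section \<open>Reflective full subcategories\<close>

text \<open>
  The inclusion is the identity on objects and arrows of \<open>X\<close>, so that the reflector \<open>(Io, Ia)\<close> is
  treated as an endofunctor of \<open>C\<close>, and the counit is replaced by the universal property of the
  unit. The simplification rule for \<open>Arr X\<close> translates statements about \<open>X\<close> into statements about
  \<open>C\<close>.
\<close>

locale reflective_subcategory = pointed_category C
  for C :: "('o, 'm) cat" (structure) +
  fixes X :: "('o, 'm) cat" and Io :: "'o \<Rightarrow> 'o" and Ia :: "'m \<Rightarrow> 'm" and \<eta> :: "'o \<Rightarrow> 'm"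
  assumes category_X: "category X"
    and finitely_complete: "finitely_complete C"
    and Obj_X: "Obj X \<subseteq> Obj C"
    and Arr_X [simp]: "f \<in> Arr X \<longleftrightarrow> f \<in> Arr C \<and> Dom C f \<in> Obj X \<and> Cod C f \<in> Obj X"
    and Dom_X: "f \<in> Arr X \<Longrightarrow> Dom X f = Dom C f"
    and Cod_X: "f \<in> Arr X \<Longrightarrow> Cod X f = Cod C f"
    and Ide_X [simp]: "x \<in> Obj X \<Longrightarrow> Ide X x = Ide C x"
    and Comp_X: "\<lbrakk>f \<in> Arr X; g \<in> Arr X; Dom C g = Cod C f\<rbrakk> \<Longrightarrow> g \<cdot>\<^bsub>X\<^esub> f = g \<cdot> f"
    and Io [simp]: "a \<in> Obj C \<Longrightarrow> Io a \<in> Obj X"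
    and Ia: "f \<in> Arr C \<Longrightarrow> Ia f \<in> hom C (Io (Dom C f)) (Io (Cod C f))"
    and Ia_ide [simp]: "a \<in> Obj C \<Longrightarrow> Ia (Ide C a) = Ide C (Io a)"
    and Ia_comp: "\<lbrakk>f \<in> Arr C; g \<in> Arr C; Dom C g = Cod C f\<rbrakk> \<Longrightarrow> Ia (g \<cdot> f) = Ia g \<cdot> Ia f"
    and eta: "a \<in> Obj C \<Longrightarrow> \<eta> a \<in> hom C a (Io a)"
    and eta_natural: "f \<in> Arr C \<Longrightarrow> Ia f \<cdot> \<eta> (Dom C f) = \<eta> (Cod C f) \<cdot> f"
    and reflect_exists: "\<lbrakk>f \<in> Arr C; Cod C f \<in> Obj X\<rbrakk> \<Longrightarrow>
          \<exists>h. h \<in> hom C (Io (Dom C f)) (Cod C f) \<and> h \<cdot> \<eta> (Dom C f) = f"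
    and reflect_unique: "\<lbrakk>a \<in> Obj C; h \<in> Arr C; h' \<in> Arr C; Dom C h = Io a; Dom C h' = Io a;
          Cod C h \<in> Obj X; Cod C h' = Cod C h; h' \<cdot> \<eta> a = h \<cdot> \<eta> a\<rbrakk> \<Longrightarrow> h' = h"
begin

sublocale X: small_category X
  by unfold_locales (rule category_X)

lemma Obj_XD [simp]: "x \<in> Obj X \<Longrightarrow> x \<in> Obj C"
  using Obj_X by blast

lemma Ia_arr [simp]:
  assumes "f \<in> Arr C"
  shows "Ia f \<in> Arr C" and "Dom C (Ia f) = Io (Dom C f)" and "Cod C (Ia f) = Io (Cod C f)"
  using Ia[OF assms] by simp_all

lemma eta_arr [simp]:
  assumes "a \<in> Obj C"
  shows "\<eta> a \<in> Arr C" and "Dom C (\<eta> a) = a" and "Cod C (\<eta> a) = Io a"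
  using eta[OF assms] by simp_all

lemma X_simps [simp]:
  assumes "f \<in> Arr C" and "Dom C f \<in> Obj X" and "Cod C f \<in> Obj X"
  shows "Dom X f = Dom C f" and "Cod X f = Cod C f"
    and "\<lbrakk>g \<in> Arr C; Dom C g = Cod C f; Cod C g \<in> Obj X\<rbrakk> \<Longrightarrow> g \<cdot>\<^bsub>X\<^esub> f = g \<cdot> f"
  using assms Dom_X Cod_X Comp_X by simp_all

lemma hom_X: "f \<in> hom X a b \<longleftrightarrow> f \<in> hom C a b \<and> a \<in> Obj X \<and> b \<in> Obj X"
  by auto

lemma tuple_X:
  assumes "fst P \<in> Arr X" and "snd P \<in> Arr X" and "Dom C (snd P) = Dom C (fst P)" and "a \<in> Arr X"
  shows "tuple X P a b = tuple C P a b"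
proof -
  have "h \<in> hom X (Dom X a) (Dom X (fst P)) \<and> fst P \<cdot>\<^bsub>X\<^esub> h = a \<and> snd P \<cdot>\<^bsub>X\<^esub> h = b \<longleftrightarrow>
    h \<in> hom C (Dom C a) (Dom C (fst P)) \<and> fst P \<cdot> h = a \<and> snd P \<cdot> h = b" for h
  proof (cases "h \<in> hom C (Dom C a) (Dom C (fst P))")
    case True
    then show ?thesis using assms by simp
  next
    case False
    then have "h \<notin> hom X (Dom X a) (Dom X (fst P))" using assms by (simp add: hom_X del: hom_iff)
    then show ?thesis using False by blast
  qed
  then show ?thesis unfolding tuple_def by simp
qed

lemma factor_X:
  assumes "k \<in> Arr X" and "f \<in> Arr X"
  shows "factor X k f = factor C k f"
proof -
  have "h \<in> hom X (Dom X f) (Dom X k) \<and> k \<cdot>\<^bsub>X\<^esub> h = f \<longleftrightarrow> h \<in> hom C (Dom C f) (Dom C k) \<and> k \<cdot> h = f" for h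
  proof (cases "h \<in> hom C (Dom C f) (Dom C k)")
    case True
    then show ?thesis using assms by auto
  next
    case False
    then have "h \<notin> hom X (Dom X f) (Dom X k)" using assms by (simp add: hom_X del: hom_iff)
    then show ?thesis using False by blast
  qed
  then show ?thesis unfolding factor_def by simp
qed

text \<open>
  Since arrows into objects of \<open>X\<close> factor uniquely through the reflection of their domain, a
  square in \<open>X\<close> that is universal among the objects of \<open>X\<close> is universal among those of \<open>C\<close>.
\<close>

lemma is_pullback_X:
  "is_pullback X f g p q \<longleftrightarrow>
     f \<in> Arr X \<and> g \<in> Arr X \<and> p \<in> Arr X \<and> q \<in> Arr X \<and> is_pullback C f g p q"
proof
  assume pb: "is_pullback X f g p q"
  then have sq: "f \<in> Arr X" "g \<in> Arr X" "p \<in> Arr X" "q \<in> Arr X" "Cod C f = Cod C g"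
    "Dom C q = Dom C p" "Cod C p = Dom C f" "Cod C q = Dom C g" "f \<cdot> p = g \<cdot> q"
    using X.pullback_square[OF pb] by simp_all
  have "is_pullback C f g p q"
  proof (rule is_pullbackI)
    fix a b assume ab: "a \<in> Arr C" "b \<in> Arr C" "Dom C b = Dom C a" "Cod C a = Dom C f" "Cod C b = Dom C g"
      "f \<cdot> a = g \<cdot> b"
    obtain a' where a': "a' \<in> hom C (Io (Dom C a)) (Dom C f)" "a' \<cdot> \<eta> (Dom C a) = a"
      using reflect_exists[of a] ab sq by auto
    obtain b' where b': "b' \<in> hom C (Io (Dom C a)) (Dom C g)" "b' \<cdot> \<eta> (Dom C a) = b"
      using reflect_exists[of b] ab sq by auto
    have "f \<cdot> a' = g \<cdot> b'"
      by (rule reflect_unique[of "Dom C a"]) (use ab a' b' sq in simp_all)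
    then obtain h where h: "h \<in> hom X (Dom X a') (Dom X p)" "p \<cdot>\<^bsub>X\<^esub> h = a'" "q \<cdot>\<^bsub>X\<^esub> h = b'"
      using X.pullback_lift[OF pb, of a' b'] a' b' sq ab by auto
    then have h: "h \<in> hom C (Io (Dom C a)) (Dom C p)" "p \<cdot> h = a'" "q \<cdot> h = b'"
      using a' sq ab by auto
    have "p \<cdot> (h \<cdot> \<eta> (Dom C a)) = a" "q \<cdot> (h \<cdot> \<eta> (Dom C a)) = b"
      using comp_cong_left[OF h(2), of "\<eta> (Dom C a)"] comp_cong_left[OF h(3), of "\<eta> (Dom C a)"]
        h a' b' sq ab by simp_all
    then show "\<exists>h. h \<in> hom C (Dom C a) (Dom C p) \<and> p \<cdot> h = a \<and> q \<cdot> h = b"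
      using h ab by (intro exI[of _ "h \<cdot> \<eta> (Dom C a)"]) simp
  next
    fix h h' assume h: "h \<in> Arr C" "h' \<in> Arr C" "Dom C h' = Dom C h" "Cod C h = Dom C p"
      "Cod C h' = Dom C p" "p \<cdot> h' = p \<cdot> h" "q \<cdot> h' = q \<cdot> h"
    obtain k where k: "k \<in> hom C (Io (Dom C h)) (Dom C p)" "k \<cdot> \<eta> (Dom C h) = h"
      using reflect_exists[of h] h sq by auto
    obtain k' where k': "k' \<in> hom C (Io (Dom C h)) (Dom C p)" "k' \<cdot> \<eta> (Dom C h) = h'"
      using reflect_exists[of h'] h sq by auto
    have "p \<cdot> k' = p \<cdot> k"
      by (rule reflect_unique[of "Dom C h"]) (use h k k' sq in simp_all)
    moreover have "q \<cdot> k' = q \<cdot> k"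
      by (rule reflect_unique[of "Dom C h"]) (use h k k' sq in simp_all)
    ultimately have "k' = k"
      using X.pullback_jointly_monic[OF pb, of k' k] k k' h sq by simp
    then show "h' = h" using k k' by simp
  qed (use sq in simp_all)
  then show "f \<in> Arr X \<and> g \<in> Arr X \<and> p \<in> Arr X \<and> q \<in> Arr X \<and> is_pullback C f g p q"
    using sq by blast
next
  assume "f \<in> Arr X \<and> g \<in> Arr X \<and> p \<in> Arr X \<and> q \<in> Arr X \<and> is_pullback C f g p q"
  then have X: "f \<in> Arr X" "g \<in> Arr X" "p \<in> Arr X" "q \<in> Arr X" and pb: "is_pullback C f g p q"
    by auto
  note sq = pullback_square[OF pb]
  show "is_pullback X f g p q"
  proof (rule X.is_pullbackI)
    fix a b assume ab: "a \<in> Arr X" "b \<in> Arr X" "Dom X b = Dom X a" "Cod X a = Dom X f" "Cod X b = Dom X g"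
      "f \<cdot>\<^bsub>X\<^esub> a = g \<cdot>\<^bsub>X\<^esub> b"
    then obtain h where "h \<in> hom C (Dom C a) (Dom C p)" "p \<cdot> h = a" "q \<cdot> h = b"
      using pullback_lift[OF pb, of a b] sq X by auto
    then show "\<exists>h. h \<in> hom X (Dom X a) (Dom X p) \<and> p \<cdot>\<^bsub>X\<^esub> h = a \<and> q \<cdot>\<^bsub>X\<^esub> h = b"
      using ab X sq by (intro exI[of _ h]) auto
  next
    fix h h' assume "h \<in> Arr X" "h' \<in> Arr X" "Dom X h' = Dom X h" "Cod X h = Dom X p"
      "Cod X h' = Dom X p" "p \<cdot>\<^bsub>X\<^esub> h' = p \<cdot>\<^bsub>X\<^esub> h" "q \<cdot>\<^bsub>X\<^esub> h' = q \<cdot>\<^bsub>X\<^esub> h"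
    then show "h' = h" using pullback_jointly_monic[OF pb, of h' h] X sq by simp
  qed (use X sq in simp_all)
qed

text \<open>
  The projections of a pullback in \<open>C\<close> extend along the unit of its vertex, since they end in \<open>X\<close>.
  This makes the unit invertible, so that the reflection of the vertex is a pullback as well.
\<close>

lemma pullback_X_exists:
  assumes arr: "f \<in> Arr X" "g \<in> Arr X" "Cod C f = Cod C g"
  obtains p q where "is_pullback X f g p q"
proof -
  obtain p q where pb: "is_pullback C f g p q"
    using pullback_exists[OF finitely_complete, of f g] arr by auto
  note sq = pullback_square[OF pb]
  let ?P = "Dom C p"
  have P: "?P \<in> Obj C" using sq by simp
  obtain p' where p': "p' \<in> hom C (Io ?P) (Dom C f)" "p' \<cdot> \<eta> ?P = p"
    using reflect_exists[of p] sq arr by auto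
  obtain q' where q': "q' \<in> hom C (Io ?P) (Dom C g)" "q' \<cdot> \<eta> ?P = q"
    using reflect_exists[of q] sq arr by auto
  have "f \<cdot> p' = g \<cdot> q'"
    by (rule reflect_unique[of ?P]) (use sq p' q' arr in simp_all)
  then obtain r where r: "r \<in> hom C (Io ?P) ?P" "p \<cdot> r = p'" "q \<cdot> r = q'"
    using pullback_lift[OF pb, of p' q'] p' q' by auto
  have r_eta: "r \<cdot> \<eta> ?P = Ide C ?P"
    by (rule pullback_jointly_monic[OF pb])
      (use sq r p' q' comp_cong_left[OF r(2), of "\<eta> ?P"] comp_cong_left[OF r(3), of "\<eta> ?P"] in simp_all)
  moreover have "\<eta> ?P \<cdot> r = Ide C (Io ?P)"
    by (rule reflect_unique[of ?P]) (use r_eta r P in simp_all)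
  ultimately have "is_inverse C r (\<eta> ?P)"
    using r P by (simp add: is_inverse_def)
  then have "is_pullback C f g (p \<cdot> r) (q \<cdot> r)"
    using r by (intro pullback_iso_vertex[OF pb]) auto
  then have "is_pullback X f g (p \<cdot> r) (q \<cdot> r)"
    unfolding is_pullback_X using arr r sq p' q' by simp
  then show thesis by (rule that)
qed

lemma chosen_pullback_X:
  assumes arr: "f \<in> Arr X" "g \<in> Arr X" "Cod C f = Cod C g"
  shows "is_pullback C f g (fst (pullback X f g)) (snd (pullback X f g))"
    and "fst (pullback X f g) \<in> Arr X" and "snd (pullback X f g) \<in> Arr X"
proof -
  obtain p q where "is_pullback X f g p q" using pullback_X_exists[OF arr] .
  from X.pullback_chosen[OF this] show "is_pullback C f g (fst (pullback X f g)) (snd (pullback X f g))"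
    and "fst (pullback X f g) \<in> Arr X" and "snd (pullback X f g) \<in> Arr X"
    unfolding is_pullback_X by blast+
qed

subsection \<open>Zero arrows in a reflective subcategory\<close>

text \<open>
  By the same argument a zero object of \<open>C\<close> is isomorphic to its reflection.
\<close>

lemma zero_obj_X: obtains z where "z \<in> Obj X" and "is_zero_obj C z" and "is_zero_obj X z"
proof -
  obtain z0 where z0: "is_zero_obj C z0" using pointed unfolding pointed_def by blast
  then have ob: "z0 \<in> Obj C" by (simp add: is_zero_obj_def is_initial_def)
  obtain r where r: "r \<in> hom C (Io z0) z0" using zero_obj_arrows(1)[OF z0, of "Io z0"] ob by auto
  have "r \<cdot> \<eta> z0 = Ide C z0"
    using zero_obj_arrows(1)[OF z0 ob] r ob by auto
  moreover have "\<eta> z0 \<cdot> r = Ide C (Io z0)"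
    by (rule reflect_unique[of z0]) (use r ob calculation in simp_all)
  ultimately have "is_inverse C (\<eta> z0) r" using r ob by (simp add: is_inverse_def)
  from zero_obj_iso[OF z0 this] have z: "is_zero_obj C (Io z0)" using ob by simp
  have "is_zero_obj X (Io z0)"
    using ob zero_obj_arrows[OF z] unfolding is_zero_obj_def is_terminal_def is_initial_def hom_X
    by simp
  then show thesis by (rule that[OF Io[OF ob] z])
qed

sublocale X: pointed_category X
proof unfold_locales
  obtain z where "is_zero_obj X z" using zero_obj_X .
  then show "pointed X" unfolding pointed_def ..
qed

lemma zero_arr_X [simp]:
  assumes "a \<in> Obj X" and "b \<in> Obj X"
  shows "zero_arr X a b = zero_arr C a b"
proof -
  obtain z where z: "z \<in> Obj X" "is_zero_obj C z" "is_zero_obj X z" using zero_obj_X .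
  obtain g h where gh: "g \<in> hom C a z" "h \<in> hom C z b" "zero_arr C a b = h \<cdot> g"
    using zero_arr_factors[OF assms[THEN Obj_XD] z(2)] .
  have "zero_arr X a b = h \<cdot>\<^bsub>X\<^esub> g"
    using gh z assms by (intro X.zero_arr_eq[OF z(3)]) (simp_all add: hom_X del: hom_iff)
  then show ?thesis using gh z assms by simp
qed

lemma Ia_zero [simp]:
  assumes "a \<in> Obj C" and "b \<in> Obj C"
  shows "Ia (zero_arr C a b) = zero_arr C (Io a) (Io b)"
  by (rule reflect_unique[of a]) (use assms eta_natural[of "zero_arr C a b"] in simp_all)

text \<open>
  A kernel is a pullback along the arrow from a zero object.
\<close>

lemma kernel_X:
  assumes f: "f \<in> Arr X"
  shows "is_kernel X f (kernel X f)"
proof -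
  obtain z where z: "z \<in> Obj X" "is_zero_obj C z" "is_zero_obj X z" using zero_obj_X .
  let ?o = "zero_arr C z (Cod C f)"
  obtain k q where pb: "is_pullback X f ?o k q"
    using pullback_X_exists[of f ?o] f z by auto
  then have arr: "k \<in> Arr X" "q \<in> Arr X" and pbC: "is_pullback C f ?o k q"
    unfolding is_pullback_X by blast+
  note sq = pullback_square[OF pbC]
  have q: "zero_arr C (Dom C a) (Cod C f) = ?o \<cdot> a" if "a \<in> Arr C" "Cod C a = z" for a
    using that f by simp
  have uq: "a = b" if "a \<in> hom C t z" "b \<in> hom C t z" for a b t
  proof -
    have "t \<in> Obj C" using that by auto
    then show ?thesis using zero_obj_arrows(1)[OF z(2), of t] that by blast
  qed
  have "is_kernel X f k"
    unfolding is_kernel_def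
  proof (intro conjI ballI impI)
    show "f \<cdot>\<^bsub>X\<^esub> k = zero_arr X (Dom X k) (Cod X f)" using sq arr f z by simp
  next
    fix a assume a: "a \<in> Arr X" "Cod X a = Dom X f \<and> f \<cdot>\<^bsub>X\<^esub> a = zero_arr X (Dom X a) (Cod X f)"
    let ?b = "zero_arr C (Dom C a) z"
    have ob: "Dom C a \<in> Obj C" using a by simp
    have "f \<cdot> a = ?o \<cdot> ?b" using a f z by auto
    then obtain h where h: "h \<in> hom C (Dom C a) (Dom C k)" "k \<cdot> h = a" "q \<cdot> h = ?b"
      using pullback_lift[OF pbC, of a ?b] a f z by auto
    moreover have "h' = h" if "h' \<in> hom C (Dom C a) (Dom C k)" "k \<cdot> h' = a" for h'
      by (rule pullback_jointly_monic[OF pbC])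
        (use h that ob sq z uq[of "q \<cdot> h'" "Dom C a" ?b] in simp_all)
    moreover have "h' \<in> hom X (Dom X a) (Dom X k) \<and> k \<cdot>\<^bsub>X\<^esub> h' = a \<longleftrightarrow>
        h' \<in> hom C (Dom C a) (Dom C k) \<and> k \<cdot> h' = a" for h'
    proof (cases "h' \<in> hom C (Dom C a) (Dom C k)")
      case True
      then show ?thesis using a arr by auto
    next
      case False
      then have "h' \<notin> hom X (Dom X a) (Dom X k)" using a arr by (simp add: hom_X del: hom_iff)
      then show ?thesis using False by blast
    qed
    ultimately show "\<exists>!h. h \<in> hom X (Dom X a) (Dom X k) \<and> k \<cdot>\<^bsub>X\<^esub> h = a"
      by blast
  qed (use f arr sq in simp_all)
  then show ?thesis unfolding kernel_def by (rule someI)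
qed

lemma product_X_exists:
  assumes "x \<in> Obj X" and "y \<in> Obj X"
  obtains p q where "is_product X x y p q"
proof -
  obtain z where z: "z \<in> Obj X" "is_zero_obj C z" "is_zero_obj X z" using zero_obj_X .
  obtain p q where pb: "is_pullback X (zero_arr X x z) (zero_arr X y z) p q"
    using pullback_X_exists[of "zero_arr X x z" "zero_arr X y z"] assms z by auto
  have "is_product X x y p q"
    by (rule X.product_of_pullback[OF _ _ _ pb, of z])
      (use z assms in \<open>simp_all add: is_zero_obj_def\<close>)
  then show thesis by (rule that)
qed

lemma terminal_X:
  shows "terminal X \<in> Obj X" and "a \<in> Obj X \<Longrightarrow> terminal_arr X a \<in> hom X a (terminal X)"
proof -
  obtain z where z: "is_zero_obj X z" using zero_obj_X .
  then have "is_terminal X z" by (simp add: is_zero_obj_def)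
  then have "is_terminal X (terminal X)" unfolding terminal_def by (rule someI)
  then show "terminal X \<in> Obj X" and "a \<in> Obj X \<Longrightarrow> terminal_arr X a \<in> hom X a (terminal X)"
    unfolding is_terminal_def terminal_arr_def by (blast, metis theI')
qed

end

section \<open>Admissible Galois structures\<close>

context small_category
begin

lemma pullback_stableD:
  assumes "pullback_stable C M" and "f \<in> M" and "is_pullback C f g p q"
  shows "q \<in> M"
proof -
  have "g \<in> Arr C" "Cod C g = Cod C f" using pullback_square[OF assms(3)] by simp_all
  then show ?thesis using assms unfolding pullback_stable_def by blast
qed

lemma pullback_stable_exists:
  assumes "pullback_stable C M" and "f \<in> M" and "g \<in> Arr C" and "Cod C g = Cod C f"
  obtains p q where "is_pullback C f g p q"
  using assms unfolding pullback_stable_def by blast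

lemma hom_slice_class:
  "t \<in> hom (slice_class C E B) f g \<longleftrightarrow>
     f \<in> E \<and> g \<in> E \<and> f \<in> Arr C \<and> g \<in> Arr C \<and> Cod C f = B \<and> Cod C g = B \<and>
     (\<exists>h. t = (f, h, g) \<and> h \<in> hom C (Dom C f) (Dom C g) \<and> g \<cdot> h = f)"
  by (cases t) (auto simp: hom_def slice_class_def slice_def full_subcategory_def)

lemma Obj_slice_class: "f \<in> Obj (slice_class C E B) \<longleftrightarrow> f \<in> Arr C \<and> Cod C f = B \<and> f \<in> E"
  by (simp add: slice_class_def slice_def full_subcategory_def)

end

text \<open>
  The functor \<open>H\<close> being an inclusion, the classes of the Galois structure satisfy \<open>F \<subseteq> E\<close>, and \<open>H\<^sup>D\<close>
  sends \<open>k\<close> to its pullback along \<open>\<eta> D\<close>.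
\<close>

locale admissible_galois_structure = reflective_subcategory C X Io Ia \<eta>
  for C :: "('o, 'm) cat" (structure) and X :: "('o, 'm) cat" and Io :: "'o \<Rightarrow> 'o" and Ia :: "'m \<Rightarrow> 'm"
    and \<eta> :: "'o \<Rightarrow> 'm" +
  fixes \<Gamma> :: "('o, 'm, 'o, 'm) galois_structure"
  assumes Gamma [simp]: "baseC \<Gamma> = C" "baseX \<Gamma> = X" "on_obj (functI \<Gamma>) = Io" "on_arr (functI \<Gamma>) = Ia"
      "unitG \<Gamma> = \<eta>"
    and H_arr: "f \<in> Arr X \<Longrightarrow> on_arr (functH \<Gamma>) f = f"
    and E_arr: "f \<in> classE \<Gamma> \<Longrightarrow> f \<in> Arr C"
    and F_arr: "f \<in> classF \<Gamma> \<Longrightarrow> f \<in> Arr X"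
    and E_stable: "pullback_stable C (classE \<Gamma>)"
    and F_stable: "pullback_stable X (classF \<Gamma>)"
    and F_in_E: "f \<in> classF \<Gamma> \<Longrightarrow> f \<in> classE \<Gamma>"
    and I_fibration: "f \<in> classE \<Gamma> \<Longrightarrow> Ia f \<in> classF \<Gamma>"
    and admissible: "admissible \<Gamma>"
    and monadic_stable: "pullback_stable C {p. monadic_extension \<Gamma> p}"
begin

lemma on_obj_functHB: "k \<in> Arr X \<Longrightarrow> on_obj (functHB \<Gamma> D) k = snd (pullback C k (\<eta> D))"
  by (simp add: functHB_def comp_func_def pullback_functor_def slice_functor_def H_arr)

lemma on_arr_functHB:
  assumes "f \<in> Arr X" and "h \<in> Arr X" and "g \<in> Arr X"
  shows "on_arr (functHB \<Gamma> D) (f, h, g) =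
    (snd (pullback C f (\<eta> D)),
     tuple C (pullback C g (\<eta> D)) (h \<cdot> fst (pullback C f (\<eta> D))) (snd (pullback C f (\<eta> D))),
     snd (pullback C g (\<eta> D)))"
  using assms
  by (simp add: functHB_def comp_func_def pullback_functor_def slice_functor_def H_arr del: Arr_X)

text \<open>
  Let \<open>q\<close> be the pullback of the fibration \<open>k\<close> of \<open>X\<close> along \<open>\<eta>\<close>. The functor \<open>H\<^sup>D\<close> has a left
  adjoint sending a fibration to its image under \<open>I\<close>; being full and faithful, it has an
  invertible counit, so that \<open>I q\<close> is \<open>k\<close> up to an isomorphism \<open>j\<close>. Fullness provides \<open>j\<close>, as the arrow
  over the unit \<open>q \<rightarrow> H\<^sup>D (I q)\<close>, and faithfulness one of the two equations that make it invertible.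
\<close>

lemma I_pullback_along_eta:
  assumes k: "k \<in> classF \<Gamma>" and pb: "is_pullback C k (\<eta> D) \<rho> q" and D: "D \<in> Obj C"
  obtains j i where "is_inverse C j i" and "j \<in> hom C (Dom C k) (Io (Dom C q))"
    and "j \<cdot> \<rho> = \<eta> (Dom C q)" and "Ia q \<cdot> j = k"
proof -
  note sq = pullback_square[OF pb]
  have kX: "k \<in> Arr X" and kE: "k \<in> classE \<Gamma>" using k F_arr F_in_E by blast+
  have kD: "Cod C k = Io D" using sq D by simp
  let ?P = "Dom C q"
  have P: "?P \<in> Obj C" "Cod C q = D" using sq D by simp_all
  define \<rho>0 q0 where "\<rho>0 = fst (pullback C k (\<eta> D))" and "q0 = snd (pullback C k (\<eta> D))"
  have pb0: "is_pullback C k (\<eta> D) \<rho>0 q0"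
    unfolding \<rho>0_def q0_def by (rule pullback_chosen[OF pb])
  note sq0 = pullback_square[OF pb0]
  have qE: "q \<in> classE \<Gamma>" and q0E: "q0 \<in> classE \<Gamma>"
    using pullback_stableD[OF E_stable kE] pb pb0 by blast+
  have Iq: "Ia q \<in> classF \<Gamma>" "Ia q \<in> Arr X" "Cod C (Ia q) = Io D" "Ia q \<in> classE \<Gamma>"
    using I_fibration[OF qE] F_in_E sq P by auto
  define s1 q1 where "s1 = fst (pullback C (Ia q) (\<eta> D))" and "q1 = snd (pullback C (Ia q) (\<eta> D))"
  have pb1: "is_pullback C (Ia q) (\<eta> D) s1 q1"
  proof -
    obtain a b where "is_pullback C (Ia q) (\<eta> D) a b"
      using pullback_exists[OF finitely_complete, of "Ia q" "\<eta> D"] sq P D by auto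
    then show ?thesis unfolding s1_def q1_def by (rule pullback_chosen)
  qed
  note sq1 = pullback_square[OF pb1]
  have q1E: "q1 \<in> classE \<Gamma>"
    by (rule pullback_stableD[OF E_stable Iq(4) pb1])
  \<comment> \<open>\<open>s\<close> and \<open>t\<close> compare \<open>q\<close> with the chosen pullback \<open>q0 = H\<^sup>D k\<close>\<close>
  obtain s where s: "s \<in> hom C (Dom C \<rho>0) ?P" "\<rho> \<cdot> s = \<rho>0" "q \<cdot> s = q0"
    using pullback_lift[OF pb, of \<rho>0 q0] sq sq0 by auto
  obtain t where t: "t \<in> hom C ?P (Dom C \<rho>0)" "\<rho>0 \<cdot> t = \<rho>" "q0 \<cdot> t = q"
    using pullback_lift[OF pb0, of \<rho> q] sq sq0 by auto
  have st: "s \<cdot> t = Ide C ?P"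
    by (rule pullback_jointly_monic[OF pb])
      (use sq s t comp_cong_left[OF s(2), of t] comp_cong_left[OF s(3), of t] in simp_all)
  \<comment> \<open>\<open>h\<close> is the unit \<open>q0 \<rightarrow> H\<^sup>D (I q)\<close>, up to the comparison \<open>s\<close>\<close>
  have "Ia q \<cdot> (\<eta> ?P \<cdot> s) = \<eta> D \<cdot> (q \<cdot> s)"
    by (rule comp_swap_left) (use sq s P D eta_natural[of q] in simp_all)
  then obtain h where h: "h \<in> hom C (Dom C q0) (Dom C q1)" "s1 \<cdot> h = \<eta> ?P \<cdot> s" "q1 \<cdot> h = q0"
    using pullback_lift[OF pb1, of "\<eta> ?P \<cdot> s" q0] sq sq0 sq1 s P D by auto
  let ?A = "slice_class X (classF \<Gamma>) (Io D)" and ?B = "slice_class C (classE \<Gamma>) D"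
  have full: "full ?A ?B (functHB \<Gamma> D)" and faithful: "faithful ?A (functHB \<Gamma> D)"
    using admissible D by (simp_all add: admissible_def)
  have ob: "k \<in> Obj ?A" "Ia q \<in> Obj ?A"
    using k kX kD Iq by (simp_all add: X.Obj_slice_class)
  have "(q0, h, q1) \<in> hom ?B (on_obj (functHB \<Gamma> D) k) (on_obj (functHB \<Gamma> D) (Ia q))"
    unfolding on_obj_functHB[OF kX] on_obj_functHB[OF Iq(2)] q0_def[symmetric] q1_def[symmetric] hom_slice_class
    using q0E q1E sq0 sq1 h D by simp
  then obtain x where x: "x \<in> hom ?A k (Ia q)" "on_arr (functHB \<Gamma> D) x = (q0, h, q1)"
    using full ob unfolding full_def by blast
  then obtain j where xj: "x = (k, j, Ia q)" "j \<in> hom X (Dom X k) (Dom X (Ia q))" "Ia q \<cdot>\<^bsub>X\<^esub> j = k"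
    unfolding X.hom_slice_class by blast
  have j1: "j \<in> hom C (Dom C k) (Io ?P)" "j \<in> Arr X" using xj(2)[unfolded hom_X] kX Iq sq by simp_all
  moreover have "Ia q \<cdot>\<^bsub>X\<^esub> j = Ia q \<cdot> j" using j1 sq(5) P D by simp
  ultimately have j: "j \<in> hom C (Dom C k) (Io ?P)" "Ia q \<cdot> j = k" "j \<in> Arr X"
    using xj(3) by simp_all
  have "h = tuple C (pullback C (Ia q) (\<eta> D)) (j \<cdot> \<rho>0) q0"
    using x(2) unfolding xj(1) on_arr_functHB[OF kX j(3) Iq(2)] \<rho>0_def q0_def by simp
  moreover have "Ia q \<cdot> (j \<cdot> \<rho>0) = \<eta> D \<cdot> q0"
    using comp_cong_left[OF j(2), of \<rho>0] j sq sq0 by simp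
  ultimately have "s1 \<cdot> h = j \<cdot> \<rho>0"
    using tuple_pullback(4)[OF pb1[unfolded s1_def q1_def], of "j \<cdot> \<rho>0" q0] j sq sq0 P D
    unfolding s1_def by simp
  then have j0: "j \<cdot> \<rho>0 = \<eta> ?P \<cdot> s" using h by simp
  have j\<rho>: "j \<cdot> \<rho> = \<eta> ?P"
  proof -
    have "j \<cdot> \<rho> = (j \<cdot> \<rho>0) \<cdot> t" using t j sq0 by simp
    also have "\<dots> = \<eta> ?P" unfolding j0 using s t st P by simp
    finally show ?thesis .
  qed
  obtain r where r: "r \<in> hom C (Io ?P) (Dom C k)" "r \<cdot> \<eta> ?P = \<rho>"
    using reflect_exists[of \<rho>] sq kX by auto
  have "j \<cdot> r = Ide C (Io ?P)"
    by (rule reflect_unique[of ?P]) (use P j r j\<rho> in simp_all)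
  moreover have "r \<cdot> j = Ide C (Dom C k)"
  proof -
    have kr: "k \<cdot> r = Ia q"
    proof (rule reflect_unique[of ?P])
      show "(k \<cdot> r) \<cdot> \<eta> ?P = Ia q \<cdot> \<eta> ?P"
        using r P sq kX eta_natural[of q] by simp
    qed (use P r kX sq D in simp_all)
    have krj: "k \<cdot> (r \<cdot> j) = k" using comp_cong_left[OF kr, of j] kX r j by simp
    \<comment> \<open>hence \<open>H\<^sup>D\<close> sends \<open>r \<cdot> j\<close> and the identity of \<open>k\<close> to the same arrow\<close>
    have rj\<rho>0: "(r \<cdot> j) \<cdot> \<rho>0 = \<rho>0"
    proof -
      have "(r \<cdot> j) \<cdot> \<rho>0 = r \<cdot> (\<eta> ?P \<cdot> s)" unfolding j0[symmetric] using r(1) j(1) sq0 by simp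
      also have "\<dots> = \<rho> \<cdot> s" by (rule comp_cong_left[OF r(2)]) (use r(1) s(1) P(1) in simp_all)
      also have "\<dots> = \<rho>0" by (rule s(2))
      finally show ?thesis .
    qed
    have rjX: "r \<cdot> j \<in> Arr X" using r j kX by simp
    have idX: "Ide C (Dom C k) \<in> Arr X" using kX by simp
    have "on_arr (functHB \<Gamma> D) (k, r \<cdot> j, k) = on_arr (functHB \<Gamma> D) (k, Ide C (Dom C k), k)"
      unfolding on_arr_functHB[OF kX rjX kX] on_arr_functHB[OF kX idX kX] \<rho>0_def[symmetric] rj\<rho>0
      using sq0 by simp
    moreover have "(k, r \<cdot> j, k) \<in> hom ?A k k" "(k, Ide C (Dom C k), k) \<in> hom ?A k k"
      unfolding X.hom_slice_class using k kX kD r j krj by simp_all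
    ultimately have "(k, r \<cdot> j, k) = (k, Ide C (Dom C k), k)"
      using faithful ob(1) unfolding faithful_def inj_on_def by blast
    then show ?thesis by simp
  qed
  ultimately have "is_inverse C j r" using j r by (simp add: is_inverse_def)
  then show thesis using that j j\<rho> by blast
qed

lemma trivial_covering_iff:
  "trivial_covering \<Gamma> f \<longleftrightarrow>
     f \<in> classE \<Gamma> \<and> is_pullback C (Ia f) (\<eta> (Cod C f)) (\<eta> (Dom C f)) f"
  using E_arr[of f] by (auto simp: trivial_covering_def H_arr)

text \<open>
  A trivial covering \<open>f\<close> is a pullback of \<open>I f\<close>, hence its pullback \<open>q\<close> along \<open>g\<close> is the pullback along
  \<open>\<eta>\<close> of the pullback \<open>k\<close> of \<open>I f\<close> along \<open>I g\<close>; and \<open>k\<close> is \<open>I q\<close> by the previous lemma.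
\<close>

lemma pullback_trivial_covering:
  assumes f: "trivial_covering \<Gamma> f" and pb: "is_pullback C f g p q"
  shows "trivial_covering \<Gamma> q" and "is_pullback C (Ia f) (Ia g) (Ia p) (Ia q)"
proof -
  note sq = pullback_square[OF pb]
  have fE: "f \<in> classE \<Gamma>" and triv: "is_pullback C (Ia f) (\<eta> (Cod C f)) (\<eta> (Dom C f)) f"
    using f trivial_covering_iff by blast+
  have qE: "q \<in> classE \<Gamma>"
    by (rule pullback_stableD[OF E_stable fE pb])
  let ?D = "Dom C g" and ?P = "Dom C q"
  have ob: "?D \<in> Obj C" "?P \<in> Obj C" using sq by simp_all
  have If: "Ia f \<in> classF \<Gamma>" by (rule I_fibration[OF fE])
  have "Ia g \<in> Arr X" "Cod X (Ia g) = Cod X (Ia f)" using sq by simp_all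
  from X.pullback_stable_exists[OF F_stable If this]
  obtain k1 k where pbkX: "is_pullback X (Ia f) (Ia g) k1 k" .
  have kF: "k \<in> classF \<Gamma>" by (rule X.pullback_stableD[OF F_stable If pbkX])
  from pbkX have pbk: "is_pullback C (Ia f) (Ia g) k1 k" and arr: "k1 \<in> Arr X" "k \<in> Arr X"
    using is_pullback_X by blast+
  note sqk = pullback_square[OF pbk]
  have nat_p: "Ia p \<cdot> \<eta> ?P = \<eta> (Dom C f) \<cdot> p" and nat_q: "Ia q \<cdot> \<eta> ?P = \<eta> ?D \<cdot> q"
    and nat_g: "Ia g \<cdot> \<eta> ?D = \<eta> (Cod C f) \<cdot> g"
    using eta_natural[of p] eta_natural[of q] eta_natural[of g] sq by simp_all
  have outer: "is_pullback C (Ia f) (Ia g \<cdot> \<eta> ?D) (\<eta> (Dom C f) \<cdot> p) q"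
    unfolding nat_g by (rule pullback_paste[OF triv pb])
  note sqo = pullback_square[OF outer]
  have "Ia f \<cdot> (\<eta> (Dom C f) \<cdot> p) = Ia g \<cdot> (\<eta> ?D \<cdot> q)"
    using sqo sq by simp
  then obtain \<rho> where \<rho>: "\<rho> \<in> hom C (Dom C p) (Dom C k1)" "k1 \<cdot> \<rho> = \<eta> (Dom C f) \<cdot> p" "k \<cdot> \<rho> = \<eta> ?D \<cdot> q"
    using pullback_lift[OF pbk, of "\<eta> (Dom C f) \<cdot> p" "\<eta> ?D \<cdot> q"] sq by auto
  have pb\<rho>: "is_pullback C k (\<eta> ?D) \<rho> q"
    by (rule pullback_cancel[OF pbk]) (use outer \<rho> sq in simp_all)
  obtain j i where ji: "is_inverse C j i" and j: "j \<in> hom C (Dom C k) (Io ?P)" "j \<cdot> \<rho> = \<eta> ?P" "Ia q \<cdot> j = k"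
    using I_pullback_along_eta[OF kF pb\<rho> ob(1)] .
  have i: "i \<in> hom C (Io ?P) (Dom C k)" "i \<cdot> j = Ide C (Dom C k)" "j \<cdot> i = Ide C (Io ?P)"
    using ji j by (simp_all add: is_inverse_def)
  have i\<eta>: "i \<cdot> \<eta> ?P = \<rho>"
    using comp_cong_left[OF i(2), of \<rho>] i j \<rho> sq sqk by simp
  have Iq: "k \<cdot> i = Ia q"
  proof -
    have "k \<cdot> i = Ia q \<cdot> (j \<cdot> i)"
      by (rule comp_cong_left[OF j(3), symmetric]) (use i(1) j(1) sq in simp_all)
    also have "\<dots> = Ia q" unfolding i(3) using sq by simp
    finally show ?thesis .
  qed
  have Ip: "k1 \<cdot> i = Ia p"
  proof (rule reflect_unique[of ?P])
    show "(k1 \<cdot> i) \<cdot> \<eta> ?P = Ia p \<cdot> \<eta> ?P"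
      using nat_p i\<eta> i \<rho> sqk sq ob by simp
  qed (use i sq sqk arr ob in simp_all)
  have "is_inverse C i j" using ji by (auto simp: is_inverse_def)
  from pullback_iso_vertex[OF pbk this] show "is_pullback C (Ia f) (Ia g) (Ia p) (Ia q)"
    using i sqk Ip Iq by simp
  from pullback_iso_corner[OF pb\<rho> ji] have "is_pullback C (Ia q) (\<eta> ?D) (\<eta> ?P) q"
    using j Iq by simp
  then show "trivial_covering \<Gamma> q" using qE sq by (simp add: trivial_covering_iff)
qed

subsection \<open>Normal extensions\<close>

lemma normal_extension_arr: "normal_extension \<Gamma> p \<Longrightarrow> p \<in> Arr C"
  using E_arr by (simp add: normal_extension_def monadic_extension_def)

lemma kernel_pair_pullback:
  assumes "p \<in> Arr C"
  shows "is_pullback C p p (fst (kernel_pair C p)) (snd (kernel_pair C p))"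
  unfolding kernel_pair_def
  using pullback_exists[OF finitely_complete assms assms] pullback_chosen by metis

lemma normal_extension_iff:
  "normal_extension \<Gamma> p \<longleftrightarrow> monadic_extension \<Gamma> p \<and> trivial_covering \<Gamma> (snd (kernel_pair C p))"
  by (simp add: normal_extension_def pullback_functor_def kernel_pair_def)

text \<open>
  If \<open>q\<close> is the pullback of \<open>p\<close> along \<open>b\<close>, the second projection of \<open>Eq(q)\<close> is a pullback of that of
  \<open>Eq(p)\<close>, by pasting, and so again a trivial covering.
\<close>

lemma normal_extension_pullback:
  assumes p: "normal_extension \<Gamma> p" and pb: "is_pullback C p b e q"
  shows "normal_extension \<Gamma> q"
proof -
  note sq = pullback_square[OF pb]
  let ?d = "fst (kernel_pair C p)" and ?c = "snd (kernel_pair C p)"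
  let ?d' = "fst (kernel_pair C q)" and ?c' = "snd (kernel_pair C q)"
  note kp = kernel_pair_pullback[OF sq(1)] and kq = kernel_pair_pullback[OF sq(5)]
  note sqp = pullback_square[OF kp] and sqq = pullback_square[OF kq]
  have "monadic_extension \<Gamma> p" using p by (simp add: normal_extension_def)
  then have mon: "monadic_extension \<Gamma> q"
    using pullback_stableD[OF monadic_stable _ pb] by simp
  have outer: "is_pullback C p (p \<cdot> e) (e \<cdot> ?d') ?c'"
    unfolding sq(9) by (rule pullback_paste[OF pb kq])
  have "p \<cdot> (e \<cdot> ?d') = (p \<cdot> e) \<cdot> ?c'" by (rule pullback_square(9)[OF outer])
  also have "\<dots> = p \<cdot> (e \<cdot> ?c')" by (rule assoc) (use sq(1-8) sqq in simp_all)
  finally obtain t where t: "t \<in> hom C (Dom C ?d') (Dom C ?d)" "?d \<cdot> t = e \<cdot> ?d'" "?c \<cdot> t = e \<cdot> ?c'"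
    using pullback_lift[OF kp, of "e \<cdot> ?d'" "e \<cdot> ?c'"] sq(1-8) sqq by auto
  have "is_pullback C ?c e t ?c'"
    by (rule pullback_cancel[OF kp]) (use outer t sq in simp_all)
  then have "trivial_covering \<Gamma> ?c'"
    using p pullback_trivial_covering(1) unfolding normal_extension_iff by blast
  then show ?thesis using mon by (simp add: normal_extension_iff)
qed

end

section \<open>The Galois groupoid through generalized elements\<close>

context admissible_galois_structure
begin

text \<open>
  Generalized elements \<open>e\<close>, \<open>e'\<close> of \<open>Dom p\<close> are related when they form an element of \<open>Eq(p)\<close>.
\<close>

definition related :: "'m \<Rightarrow> 'm \<Rightarrow> 'm \<Rightarrow> bool" where
  "related p e e' \<longleftrightarrow> e \<in> Arr C \<and> e' \<in> Arr C \<and> Dom C e' = Dom C e \<and>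
     Cod C e = Dom C p \<and> Cod C e' = Dom C p \<and> p \<cdot> e = p \<cdot> e'"

text \<open>
  The arrow from \<open>\<eta> e\<close> to \<open>\<eta> e'\<close> of the Galois groupoid that is represented by the element \<open>(e, e')\<close>
  of \<open>Eq(p)\<close>.
\<close>

definition galois_arr :: "'m \<Rightarrow> 'm \<Rightarrow> 'm \<Rightarrow> 'm" where
  "galois_arr p e e' = \<eta> (Dom C (fst (kernel_pair C p))) \<cdot> tuple C (kernel_pair C p) e e'"

text \<open>
  Composition of generalized arrows, in diagrammatic order: the target of \<open>g\<close> is the source of \<open>h\<close>.
\<close>

definition galois_comp :: "'m \<Rightarrow> 'm \<Rightarrow> 'm \<Rightarrow> 'm" where
  "galois_comp p g h = gd_comp (galois_groupoid \<Gamma> p) \<cdot>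
     tuple C (pullback X (Ia (snd (kernel_pair C p))) (Ia (fst (kernel_pair C p)))) g h"

lemma galois_groupoid_simps:
  "gd_obj (galois_groupoid \<Gamma> p) = Io (Dom C p)"
  "gd_dom (galois_groupoid \<Gamma> p) = Ia (fst (kernel_pair C p))"
  "gd_cod (galois_groupoid \<Gamma> p) = Ia (snd (kernel_pair C p))"
  "gd_unit (galois_groupoid \<Gamma> p) = Ia (tuple C (kernel_pair C p) (Ide C (Dom C p)) (Ide C (Dom C p)))"
  "gd_inv (galois_groupoid \<Gamma> p) = Ia (tuple C (kernel_pair C p) (snd (kernel_pair C p)) (fst (kernel_pair C p)))"
  by (simp_all add: galois_groupoid_def image_groupoid_def kernel_pair_groupoid_def Let_def)

context
  fixes p
  assumes p: "normal_extension \<Gamma> p"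
begin

text \<open>
  Outside this context these become functions \<open>d p\<close>, \<open>c p\<close>, \<open>R p\<close> and \<open>pair p\<close> of the extension.
\<close>

abbreviation (input) "d \<equiv> fst (kernel_pair C p)"
abbreviation (input) "c \<equiv> snd (kernel_pair C p)"
abbreviation (input) "R \<equiv> Dom C (fst (kernel_pair C p))"
abbreviation (input) "pair \<equiv> tuple C (kernel_pair C p)"

lemma p_arr: "p \<in> Arr C"
  by (rule normal_extension_arr[OF p])

lemmas kp = kernel_pair_pullback[OF p_arr]

lemma kp_arr:
  shows "d \<in> Arr C" and "c \<in> Arr C" and "Dom C c = R" and "Cod C d = Dom C p" and "Cod C c = Dom C p"
    and "p \<cdot> d = p \<cdot> c"
  using pullback_square[OF kp] by simp_all

lemma c_trivial: "trivial_covering \<Gamma> c"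
  using p by (simp add: normal_extension_iff)

lemma pair:
  assumes "related p e e'"
  shows "pair e e' \<in> Arr C" and "Dom C (pair e e') = Dom C e" and "Cod C (pair e e') = R"
    and "d \<cdot> pair e e' = e" and "c \<cdot> pair e e' = e'"
  using tuple_pullback[OF kp, of e e'] assms unfolding related_def by blast+

lemma pair_unique:
  assumes "h \<in> Arr C" and "Cod C h = R" and "d \<cdot> h = e" and "c \<cdot> h = e'"
  shows "pair e e' = h"
  by (rule tuple_pullback_unique[OF kp]) (use assms in simp_all)

lemma related_refl:
  assumes "e \<in> Arr C" and "Cod C e = Dom C p"
  shows "related p e e"
  using assms by (simp add: related_def)

lemma related_sym: "related p e e' \<Longrightarrow> related p e' e"
  by (simp add: related_def)

lemma related_trans: "related p e e' \<Longrightarrow> related p e' e'' \<Longrightarrow> related p e e''"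
  by (simp add: related_def)

lemma related_projections:
  assumes "h \<in> Arr C" and "Cod C h = R"
  shows "related p (d \<cdot> h) (c \<cdot> h)"
proof -
  have "p \<cdot> (d \<cdot> h) = p \<cdot> (c \<cdot> h)"
    by (rule comp_swap_left) (use kp_arr p_arr assms in simp_all)
  then show ?thesis using kp_arr assms by (simp add: related_def)
qed

lemma galois_arr:
  assumes r: "related p e e'"
  shows "galois_arr p e e' \<in> Arr C" and "Dom C (galois_arr p e e') = Dom C e"
    and "Cod C (galois_arr p e e') = Io R"
    and "Ia d \<cdot> galois_arr p e e' = \<eta> (Dom C p) \<cdot> e"
    and "Ia c \<cdot> galois_arr p e e' = \<eta> (Dom C p) \<cdot> e'"
proof -
  note pr = pair[OF r]
  have R: "R \<in> Obj C" using kp_arr by simp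
  show "galois_arr p e e' \<in> Arr C" and "Dom C (galois_arr p e e') = Dom C e"
    and "Cod C (galois_arr p e e') = Io R"
    unfolding galois_arr_def using pr R by simp_all
  have "Ia d \<cdot> (\<eta> R \<cdot> pair e e') = \<eta> (Dom C p) \<cdot> (d \<cdot> pair e e')"
    by (rule comp_swap_left) (use eta_natural[of d] kp_arr p_arr pr R in simp_all)
  then show "Ia d \<cdot> galois_arr p e e' = \<eta> (Dom C p) \<cdot> e" unfolding galois_arr_def pr .
  have "Ia c \<cdot> (\<eta> R \<cdot> pair e e') = \<eta> (Dom C p) \<cdot> (c \<cdot> pair e e')"
    by (rule comp_swap_left) (use eta_natural[of c] kp_arr p_arr pr R in simp_all)
  then show "Ia c \<cdot> galois_arr p e e' = \<eta> (Dom C p) \<cdot> e'" unfolding galois_arr_def pr .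
qed

text \<open>
  As \<open>c\<close> is the pullback of \<open>I c\<close> along \<open>\<eta>\<close>, an arrow of the Galois groupoid whose target comes from
  a generalized element of \<open>E\<close> is itself given by a pair of generalized elements of \<open>E\<close>.
\<close>

lemma galois_arr_lift:
  assumes g: "g \<in> Arr C" "Cod C g = Io R" and e': "e' \<in> Arr C" "Dom C e' = Dom C g" "Cod C e' = Dom C p"
    and eq: "Ia c \<cdot> g = \<eta> (Dom C p) \<cdot> e'"
  obtains e where "related p e e'" and "g = galois_arr p e e'"
proof -
  have pb: "is_pullback C (Ia c) (\<eta> (Dom C p)) (\<eta> R) c"
    using c_trivial kp_arr by (simp add: trivial_covering_iff)
  obtain h where h: "h \<in> hom C (Dom C g) R" "\<eta> R \<cdot> h = g" "c \<cdot> h = e'"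
    using pullback_lift[OF pb, of g e'] assms kp_arr p_arr by auto
  have "related p (d \<cdot> h) e'" using related_projections[of h] h by simp
  moreover have "pair (d \<cdot> h) e' = h" by (rule pair_unique) (use h in simp_all)
  then have "g = galois_arr p (d \<cdot> h) e'" using h by (simp add: galois_arr_def)
  ultimately show thesis by (rule that)
qed

lemma galois_arr_comp:
  assumes r: "related p e e'" and t: "t \<in> Arr C" "Cod C t = Dom C e"
  shows "galois_arr p e e' \<cdot> t = galois_arr p (e \<cdot> t) (e' \<cdot> t)"
proof -
  note pr = pair[OF r]
  have R: "R \<in> Obj C" using kp_arr by simp
  have "pair (e \<cdot> t) (e' \<cdot> t) = pair e e' \<cdot> t"
    by (rule pair_unique)
      (use pr t kp_arr comp_cong_left[OF pr(4), of t] comp_cong_left[OF pr(5), of t] in simp_all)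
  then show ?thesis using pr t R by (simp add: galois_arr_def)
qed

text \<open>
  The pair \<open>(e, e)\<close> represents the identity at \<open>\<eta> e\<close>. Identities are the image under \<open>I\<close> of the
  diagonal of \<open>Eq(p)\<close>, so the identity at \<open>0\<close> is a zero arrow.
\<close>

lemma galois_arr_refl:
  assumes e: "e \<in> Arr C" "Cod C e = Dom C p" and \<eta>e: "\<eta> (Dom C p) \<cdot> e = zero_arr C (Dom C e) (Io (Dom C p))"
  shows "galois_arr p e e = zero_arr C (Dom C e) (Io R)"
proof -
  let ?i = "Ide C (Dom C p)" and ?E = "Dom C p"
  have R: "R \<in> Obj C" and E: "?E \<in> Obj C" using kp_arr p_arr by simp_all
  have ri: "related p ?i ?i" by (rule related_refl) (use E in simp_all)
  note pi = pair[OF ri]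
  have "pair e e = pair ?i ?i \<cdot> e"
    by (rule pair_unique)
      (use pi e E kp_arr comp_cong_left[OF pi(4), of e] comp_cong_left[OF pi(5), of e] in simp_all)
  then have "galois_arr p e e = \<eta> R \<cdot> (pair ?i ?i \<cdot> e)" by (simp add: galois_arr_def)
  also have "\<dots> = Ia (pair ?i ?i) \<cdot> (\<eta> ?E \<cdot> e)"
    by (rule comp_swap_left) (use eta_natural[of "pair ?i ?i"] pi e E R in simp_all)
  also have "\<dots> = zero_arr C (Dom C e) (Io R)" unfolding \<eta>e using pi e E by simp
  finally show ?thesis .
qed

lemma galois_inv_galois_arr:
  assumes r: "related p e e'"
  shows "Ia (pair c d) \<cdot> galois_arr p e e' = galois_arr p e' e"
proof -
  note pr = pair[OF r]
  have R: "R \<in> Obj C" using kp_arr by simp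
  have rs: "related p c d"
    using related_sym[OF related_projections[of "Ide C R"]] R kp_arr by simp
  note ps = pair[OF rs]
  have "pair e' e = pair c d \<cdot> pair e e'"
    by (rule pair_unique)
      (use pr ps kp_arr comp_cong_left[OF ps(4), of "pair e e'"] comp_cong_left[OF ps(5), of "pair e e'"] in simp_all)
  then have "galois_arr p e' e = \<eta> R \<cdot> (pair c d \<cdot> pair e e')" by (simp add: galois_arr_def)
  also have "\<dots> = Ia (pair c d) \<cdot> (\<eta> R \<cdot> pair e e')"
    by (rule comp_swap_left) (use eta_natural[of "pair c d"] pr ps R kp_arr in simp_all)
  finally show ?thesis by (simp add: galois_arr_def)
qed

text \<open>
  As \<open>c\<close> is a trivial covering, \<open>I\<close> preserves the pullback \<open>q\<close> of composable pairs in \<open>Eq(p)\<close>, so it is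
  isomorphic, by \<open>v\<close>, to the pullback of composable pairs in the Galois groupoid.
\<close>

lemma galois_groupoid_comp:
  obtains q r v m where "is_pullback C c d (fst q) (snd q)"
    and "r = pullback X (Ia c) (Ia d)"
    and "is_pullback C (Ia c) (Ia d) (fst r) (snd r)" and "fst r \<in> Arr X" and "snd r \<in> Arr X"
    and "is_pullback C (Ia c) (Ia d) (Ia (fst q)) (Ia (snd q))"
    and "v \<in> hom C (Dom C (fst r)) (Io (Dom C (fst q)))"
    and "Ia (fst q) \<cdot> v = fst r" and "Ia (snd q) \<cdot> v = snd r"
    and "m \<in> hom C (Dom C (fst q)) R"
    and "d \<cdot> m = d \<cdot> fst q" and "c \<cdot> m = c \<cdot> snd q"
    and "gd_comp (galois_groupoid \<Gamma> p) = Ia m \<cdot> v"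
proof -
  have R: "R \<in> Obj C" using kp_arr by simp
  define q where "q = pullback C c d"
  define r where "r = pullback X (Ia c) (Ia d)"
  have q: "is_pullback C c d (fst q) (snd q)"
    unfolding q_def using pullback_exists[OF finitely_complete, of c d] kp_arr pullback_chosen by metis
  note sq = pullback_square[OF q]
  have Iq: "is_pullback C (Ia c) (Ia d) (Ia (fst q)) (Ia (snd q))"
    by (rule pullback_trivial_covering(2)[OF c_trivial q])
  have r: "is_pullback C (Ia c) (Ia d) (fst r) (snd r)" "fst r \<in> Arr X" "snd r \<in> Arr X"
    unfolding r_def by (rule chosen_pullback_X; use kp_arr p_arr R in simp)+
  note sr = pullback_square[OF r(1)]
  let ?w = "tuple C r (Ia (fst q)) (Ia (snd q))" and ?v = "tuple C (Ia (fst q), Ia (snd q)) (fst r) (snd r)"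
  have w: "is_inverse C ?w ?v" by (rule pullback_comparison[OF r(1) Iq])
  have v: "?v \<in> Arr C" "Dom C ?v = Dom C (fst r)" "Cod C ?v = Io (Dom C (fst q))"
    "Ia (fst q) \<cdot> ?v = fst r" "Ia (snd q) \<cdot> ?v = snd r"
    using tuple_pullback[of "Ia c" "Ia d" "(Ia (fst q), Ia (snd q))" "fst r" "snd r"] Iq sr sq by simp_all
  have w_arr: "?w \<in> Arr C" "Dom C ?w = Io (Dom C (fst q))" "Cod C ?w = Dom C (fst r)"
    using w v by (auto simp: is_inverse_def)
  have ob: "Dom C (fst q) \<in> Obj C" "Dom C (fst r) \<in> Obj X" using sq r by simp_all
  have "tuple X r (Ia (fst q)) (Ia (snd q)) = ?w"
    by (rule tuple_X) (use r sr sq kp_arr R in simp_all)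
  moreover have "is_inverse X ?w ?v"
    using w w_arr v ob by (simp add: is_inverse_def)
  ultimately have inv: "inverse_arr X (tuple X r (Ia (fst q)) (Ia (snd q))) = ?v"
    using X.inverse_arr_eq by simp
  let ?m = "pair (d \<cdot> fst q) (c \<cdot> snd q)"
  have rel: "related p (d \<cdot> fst q) (c \<cdot> snd q)"
  proof -
    have "related p (d \<cdot> fst q) (c \<cdot> fst q)" "related p (d \<cdot> snd q) (c \<cdot> snd q)"
      by (rule related_projections; use sq kp_arr in simp)+
    then show ?thesis unfolding sq(9) by (rule related_trans)
  qed
  note pm = pair[OF rel]
  have m: "?m \<in> Arr C" "Dom C ?m = Dom C (fst q)" "Cod C ?m = R" using pm sq kp_arr by simp_all
  have "gd_comp (galois_groupoid \<Gamma> p) = Ia ?m \<cdot>\<^bsub>X\<^esub> ?v"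
    unfolding inv[symmetric] unfolding r_def q_def
    by (simp add: galois_groupoid_def image_groupoid_def kernel_pair_groupoid_def Let_def)
  then have comp_eq: "gd_comp (galois_groupoid \<Gamma> p) = Ia ?m \<cdot> ?v"
    using v m ob R by simp
  show thesis
    by (rule that[OF q r_def r Iq _ v(4,5) _ pm(4,5) comp_eq]) (use v m in simp_all)
qed

lemma gd_comp:
  "gd_comp (galois_groupoid \<Gamma> p) \<in> hom C (Dom C (fst (pullback X (Ia c) (Ia d)))) (Io R)"
proof (rule galois_groupoid_comp)
  fix q r v m
  assume "r = pullback X (Ia c) (Ia d)"
    and "v \<in> hom C (Dom C (fst r)) (Io (Dom C (fst q)))" and "m \<in> hom C (Dom C (fst q)) R"
    and "gd_comp (galois_groupoid \<Gamma> p) = Ia m \<cdot> v"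
  then show ?thesis by simp
qed

text \<open>
  The last claim holds because \<open>\<eta>\<close> is natural: it sends the composable pair \<open>((e0, e1), (e1, e2))\<close> of
  \<open>Eq(p)\<close>, with composite \<open>(e0, e2)\<close>, to a composable pair of the Galois groupoid.
\<close>

lemma galois_comp:
  assumes g: "g \<in> Arr C" "Cod C g = Io R" and h: "h \<in> Arr C" "Cod C h = Io R" "Dom C h = Dom C g"
    and eq: "Ia c \<cdot> g = Ia d \<cdot> h"
  shows "galois_comp p g h \<in> Arr C" and "Dom C (galois_comp p g h) = Dom C g"
    and "Cod C (galois_comp p g h) = Io R"
    and "\<lbrakk>t \<in> Arr C; Cod C t = Dom C g\<rbrakk> \<Longrightarrow> galois_comp p g h \<cdot> t = galois_comp p (g \<cdot> t) (h \<cdot> t)"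
    and "\<lbrakk>related p e0 e1; related p e1 e2; g = galois_arr p e0 e1; h = galois_arr p e1 e2\<rbrakk> \<Longrightarrow>
         galois_comp p g h = galois_arr p e0 e2"
proof -
  have R: "R \<in> Obj C" using kp_arr by simp
  obtain q r v m where q: "is_pullback C c d (fst q) (snd q)"
    and r_def: "r = pullback X (Ia c) (Ia d)"
    and r: "is_pullback C (Ia c) (Ia d) (fst r) (snd r)" "fst r \<in> Arr X" "snd r \<in> Arr X"
    and Iq: "is_pullback C (Ia c) (Ia d) (Ia (fst q)) (Ia (snd q))"
    and v: "v \<in> hom C (Dom C (fst r)) (Io (Dom C (fst q)))"
      "Ia (fst q) \<cdot> v = fst r" "Ia (snd q) \<cdot> v = snd r"
    and m: "m \<in> hom C (Dom C (fst q)) R" "d \<cdot> m = d \<cdot> fst q" "c \<cdot> m = c \<cdot> snd q"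
    and comp_eq: "gd_comp (galois_groupoid \<Gamma> p) = Ia m \<cdot> v"
    using galois_groupoid_comp .
  note sq = pullback_square[OF q] and sr = pullback_square[OF r(1)]
  have ob: "Dom C (fst q) \<in> Obj C" "Dom C (fst r) \<in> Obj X" using sq r by simp_all
  let ?t = "tuple C r g h"
  have t: "?t \<in> Arr C" "Dom C ?t = Dom C g" "Cod C ?t = Dom C (fst r)" "fst r \<cdot> ?t = g" "snd r \<cdot> ?t = h"
    using tuple_pullback[OF r(1), of g h] g h eq kp_arr by simp_all
  have gc: "galois_comp p g h = Ia m \<cdot> (v \<cdot> ?t)"
    unfolding galois_comp_def comp_eq r_def[symmetric] using v(1) m(1) t by simp
  show "galois_comp p g h \<in> Arr C" and "Dom C (galois_comp p g h) = Dom C g"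
    and "Cod C (galois_comp p g h) = Io R"
    unfolding gc using v(1) m(1) t by simp_all
  show "galois_comp p g h \<cdot> x = galois_comp p (g \<cdot> x) (h \<cdot> x)" if x: "x \<in> Arr C" "Cod C x = Dom C g" for x
  proof -
    have "tuple C r (g \<cdot> x) (h \<cdot> x) = ?t \<cdot> x"
      by (rule tuple_pullback_unique[OF r(1)])
        (use t x sr comp_cong_left[OF t(4), of x] comp_cong_left[OF t(5), of x] in simp_all)
    then show ?thesis
      unfolding galois_comp_def comp_eq r_def[symmetric] using v(1) m(1) t x by simp
  qed
  show "galois_comp p g h = galois_arr p e0 e2"
    if e: "related p e0 e1" "related p e1 e2" and gh: "g = galois_arr p e0 e1" "h = galois_arr p e1 e2"
  proof -
    note p1 = pair[OF e(1)] and p2 = pair[OF e(2)] and rel = e[unfolded related_def]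
    let ?s = "tuple C q (pair e0 e1) (pair e1 e2)"
    have s: "?s \<in> Arr C" "Dom C ?s = Dom C e0" "Cod C ?s = Dom C (fst q)"
      "fst q \<cdot> ?s = pair e0 e1" "snd q \<cdot> ?s = pair e1 e2"
      using tuple_pullback[OF q, of "pair e0 e1" "pair e1 e2"] p1 p2 kp_arr rel by simp_all
    have "v \<cdot> ?t = \<eta> (Dom C (fst q)) \<cdot> ?s"
    proof (rule pullback_jointly_monic[OF Iq])
      have "Ia (fst q) \<cdot> (v \<cdot> ?t) = g"
        using comp_cong_left[OF v(2), of ?t] v t sq by simp
      moreover have "Ia (fst q) \<cdot> (\<eta> (Dom C (fst q)) \<cdot> ?s) = \<eta> R \<cdot> (fst q \<cdot> ?s)"
        by (rule comp_swap_left) (use eta_natural[of "fst q"] s sq kp_arr R in simp_all)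
      ultimately show "Ia (fst q) \<cdot> (v \<cdot> ?t) = Ia (fst q) \<cdot> (\<eta> (Dom C (fst q)) \<cdot> ?s)"
        unfolding s(4) gh galois_arr_def by simp
      have "Ia (snd q) \<cdot> (v \<cdot> ?t) = h"
        using comp_cong_left[OF v(3), of ?t] v t sq by simp
      moreover have "Ia (snd q) \<cdot> (\<eta> (Dom C (fst q)) \<cdot> ?s) = \<eta> R \<cdot> (snd q \<cdot> ?s)"
        by (rule comp_swap_left) (use eta_natural[of "snd q"] s sq kp_arr R in simp_all)
      ultimately show "Ia (snd q) \<cdot> (v \<cdot> ?t) = Ia (snd q) \<cdot> (\<eta> (Dom C (fst q)) \<cdot> ?s)"
        unfolding s(5) gh galois_arr_def by simp
    qed (use v t s sq ob galois_arr[OF e(1)] gh in simp_all)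
    then have "galois_comp p g h = Ia m \<cdot> (\<eta> (Dom C (fst q)) \<cdot> ?s)" unfolding gc by simp
    also have "\<dots> = \<eta> R \<cdot> (m \<cdot> ?s)"
      by (rule comp_swap_left) (use eta_natural[of m] s m ob R in simp_all)
    also have "m \<cdot> ?s = pair e0 e2"
    proof (rule pair_unique[symmetric])
      have "d \<cdot> (m \<cdot> ?s) = (d \<cdot> fst q) \<cdot> ?s"
        by (rule comp_cong_left[OF m(2)]) (use m s kp_arr in simp_all)
      also have "\<dots> = d \<cdot> (fst q \<cdot> ?s)" by (rule assoc) (use s sq kp_arr in simp_all)
      finally show "d \<cdot> (m \<cdot> ?s) = e0" unfolding s(4) p1(4) .
      have "c \<cdot> (m \<cdot> ?s) = (c \<cdot> snd q) \<cdot> ?s"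
        by (rule comp_cong_left[OF m(3)]) (use m s kp_arr in simp_all)
      also have "\<dots> = c \<cdot> (snd q \<cdot> ?s)" by (rule assoc) (use s sq kp_arr in simp_all)
      finally show "c \<cdot> (m \<cdot> ?s) = e2" unfolding s(5) p2(5) .
    qed (use m s in simp_all)
    finally show ?thesis by (simp add: galois_arr_def)
  qed
qed

lemma galois_comp_galois_arr:
  assumes "related p e0 e1" and "related p e1 e2"
  shows "galois_comp p (galois_arr p e0 e1) (galois_arr p e1 e2) = galois_arr p e0 e2"
  by (rule galois_comp(5)[OF _ _ _ _ _ _ assms refl refl])
    (use galois_arr[OF assms(1)] galois_arr[OF assms(2)] assms in \<open>simp_all add: related_def\<close>)

end

end

section \<open>The Galois group\<close>

context reflective_subcategory
begin

text \<open>
  This gives access to the kernels of \<open>X\<close> with all composites formed in \<open>C\<close>.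
\<close>

lemma kernel_X_facts:
  assumes f: "f \<in> Arr X"
  shows "kernel X f \<in> Arr X" and "Cod C (kernel X f) = Dom C f"
    and "f \<cdot> kernel X f = zero_arr C (Dom C (kernel X f)) (Cod C f)"
    and "\<lbrakk>a \<in> Arr X; Cod C a = Dom C f; f \<cdot> a = zero_arr C (Dom C a) (Cod C f)\<rbrakk> \<Longrightarrow>
         \<exists>h. h \<in> hom C (Dom C a) (Dom C (kernel X f)) \<and> kernel X f \<cdot> h = a"
    and "\<lbrakk>h \<in> Arr X; h' \<in> Arr X; Dom C h' = Dom C h; Cod C h = Dom C (kernel X f);
          Cod C h' = Dom C (kernel X f); kernel X f \<cdot> h = kernel X f \<cdot> h'\<rbrakk> \<Longrightarrow> h = h'"
proof -
  let ?k = "kernel X f"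
  have K: "is_kernel X f ?k" by (rule kernel_X[OF f])
  then have k: "?k \<in> Arr X" "Cod X ?k = Dom X f" "f \<cdot>\<^bsub>X\<^esub> ?k = zero_arr X (Dom X ?k) (Cod X f)"
    and ex: "\<And>a. \<lbrakk>a \<in> Arr X; Cod X a = Dom X f; f \<cdot>\<^bsub>X\<^esub> a = zero_arr X (Dom X a) (Cod X f)\<rbrakk> \<Longrightarrow>
      \<exists>!h. h \<in> hom X (Dom X a) (Dom X ?k) \<and> ?k \<cdot>\<^bsub>X\<^esub> h = a"
    unfolding is_kernel_def by blast+
  show kX: "?k \<in> Arr X" by (rule k)
  show kf: "Cod C ?k = Dom C f" using k f by simp
  have "f \<cdot>\<^bsub>X\<^esub> ?k = f \<cdot> ?k" using kX kf f by simp
  then show kz: "f \<cdot> ?k = zero_arr C (Dom C ?k) (Cod C f)" using k(3) kX f by simp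
  show "\<exists>h. h \<in> hom C (Dom C a) (Dom C ?k) \<and> ?k \<cdot> h = a"
    if a: "a \<in> Arr X" "Cod C a = Dom C f" "f \<cdot> a = zero_arr C (Dom C a) (Cod C f)" for a
  proof -
    have "f \<cdot>\<^bsub>X\<^esub> a = f \<cdot> a" using a(1,2) f by simp
    then have "\<exists>!h. h \<in> hom X (Dom X a) (Dom X ?k) \<and> ?k \<cdot>\<^bsub>X\<^esub> h = a"
      using a f by (intro ex) simp_all
    then obtain h where h: "h \<in> hom X (Dom X a) (Dom X ?k)" "?k \<cdot>\<^bsub>X\<^esub> h = a" by blast
    have h1: "h \<in> hom C (Dom C a) (Dom C ?k)" using h(1)[unfolded hom_X] a(1) kX by simp
    then have "?k \<cdot>\<^bsub>X\<^esub> h = ?k \<cdot> h" using a(1) kX by simp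
    then show ?thesis using h(2) h1 by auto
  qed
  show "h = h'" if h: "h \<in> Arr X" "h' \<in> Arr X" "Dom C h' = Dom C h" "Cod C h = Dom C ?k"
      "Cod C h' = Dom C ?k" "?k \<cdot> h = ?k \<cdot> h'" for h h'
  proof -
    let ?a = "?k \<cdot> h"
    have a: "?a \<in> Arr X" "Cod C ?a = Dom C f" "Dom C ?a = Dom C h" using h kX kf f by simp_all
    have "f \<cdot> (?k \<cdot> h) = zero_arr C (Dom C ?k) (Cod C f) \<cdot> h"
      by (rule comp_cong_left[OF kz]) (use h kX kf f in simp_all)
    then have z: "f \<cdot> ?a = zero_arr C (Dom C ?a) (Cod C f)" using h f kX by simp
    have fa: "f \<cdot>\<^bsub>X\<^esub> ?a = f \<cdot> ?a" using a f by simp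
    have "\<exists>!h. h \<in> hom X (Dom X ?a) (Dom X ?k) \<and> ?k \<cdot>\<^bsub>X\<^esub> h = ?a"
      by (rule ex) (use a z f fa in simp_all)
    moreover have "h \<in> hom X (Dom X ?a) (Dom X ?k) \<and> ?k \<cdot>\<^bsub>X\<^esub> h = ?a"
      using h(1-5) kX kf f by simp
    moreover have "h' \<in> hom X (Dom X ?a) (Dom X ?k) \<and> ?k \<cdot>\<^bsub>X\<^esub> h' = ?a"
      using h(1-5) kX kf f unfolding h(6) by simp
    ultimately show ?thesis by blast
  qed
qed

lemma product_X:
  assumes "x \<in> Obj X" and "y \<in> Obj X"
  shows "is_product X x y (fst (product X x y)) (snd (product X x y))"
proof -
  obtain p q where "is_product X x y p q" using product_X_exists[OF assms] .
  then show ?thesis by (rule X.product_chosen)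
qed

end

context admissible_galois_structure
begin

text \<open>
  The generalized elements of the Galois group, seen as arrows of the Galois groupoid. Their domains
  are restricted to \<open>X\<close> because the kernels defining the Galois group are formed in \<open>X\<close>.
\<close>

definition automorphism_of_0 :: "'m \<Rightarrow> 'm \<Rightarrow> bool" where
  "automorphism_of_0 p a \<longleftrightarrow> a \<in> Arr C \<and> Dom C a \<in> Obj X \<and> Cod C a = Io (Dom C (fst (kernel_pair C p))) \<and>
     Ia (fst (kernel_pair C p)) \<cdot> a = zero_arr C (Dom C a) (Io (Dom C p)) \<and>
     Ia (snd (kernel_pair C p)) \<cdot> a = zero_arr C (Dom C a) (Io (Dom C p))"

abbreviation incl :: "'m \<Rightarrow> 'm" where
  "incl p \<equiv> automorphisms_at_0 X (galois_groupoid \<Gamma> p)"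

context
  fixes p
  assumes p: "normal_extension \<Gamma> p"
begin

lemma incl:
  shows "incl p \<in> Arr C" and "Dom C (incl p) \<in> Obj X" and "Cod C (incl p) = Io (R p)"
    and "automorphism_of_0 p (incl p)"
    and "automorphism_of_0 p a \<Longrightarrow> \<exists>h. h \<in> hom C (Dom C a) (Dom C (incl p)) \<and> incl p \<cdot> h = a"
    and "\<lbrakk>h \<in> Arr C; h' \<in> Arr C; Dom C h \<in> Obj X; Dom C h' = Dom C h; Cod C h = Dom C (incl p);
          Cod C h' = Dom C (incl p); incl p \<cdot> h = incl p \<cdot> h'\<rbrakk> \<Longrightarrow> h = h'"
proof -
  let ?d = "fst (kernel_pair C p)" and ?c = "snd (kernel_pair C p)"
  note kp = kp_arr[OF p] and pa = p_arr[OF p]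
  have Id: "Ia ?d \<in> Arr X" and Ic: "Ia ?c \<in> Arr X" using kp pa by simp_all
  have R: "R p \<in> Obj C" using kp by simp
  let ?k = "kernel X (Ia ?d)" and ?l = "kernel X (Ia ?c)"
  note k = kernel_X_facts[OF Id] and l = kernel_X_facts[OF Ic]
  have kl: "Cod C ?k = Cod C ?l" using k(2) l(2) kp by simp
  let ?P = "pullback X ?k ?l"
  note P = chosen_pullback_X[OF k(1) l(1) kl]
  note sP = pullback_square[OF P(1)]
  have i0: "incl p = ?k \<cdot>\<^bsub>X\<^esub> fst ?P"
    by (simp add: automorphisms_at_0_def subobj_inter_def galois_groupoid_simps)
  have i: "incl p = ?k \<cdot> fst ?P"
    unfolding i0 using k(1) P sP by simp
  then have i': "incl p = ?l \<cdot> snd ?P" using sP by simp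
  show arr: "incl p \<in> Arr C" and "Dom C (incl p) \<in> Obj X" and "Cod C (incl p) = Io (R p)"
    unfolding i using k(1,2) P(2) sP kp by simp_all
  have "Ia ?d \<cdot> (?k \<cdot> fst ?P) = zero_arr C (Dom C ?k) (Cod C (Ia ?d)) \<cdot> fst ?P"
    by (rule comp_cong_left[OF k(3)]) (use k(1,2) sP kp in simp_all)
  then have dz: "Ia ?d \<cdot> incl p = zero_arr C (Dom C (incl p)) (Io (Dom C p))"
    unfolding i using k(1) sP P(2) kp pa by simp
  have "Ia ?c \<cdot> (?l \<cdot> snd ?P) = zero_arr C (Dom C ?l) (Cod C (Ia ?c)) \<cdot> snd ?P"
    by (rule comp_cong_left[OF l(3)]) (use l(1,2) sP kp in simp_all)
  then have cz: "Ia ?c \<cdot> incl p = zero_arr C (Dom C (incl p)) (Io (Dom C p))"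
    unfolding i' using l(1) sP(4-8) P(3) kp pa by simp
  show "automorphism_of_0 p (incl p)"
    unfolding automorphism_of_0_def using arr dz cz k(1,2) P(2) sP kp unfolding i by simp
  show "\<exists>h. h \<in> hom C (Dom C a) (Dom C (incl p)) \<and> incl p \<cdot> h = a" if a: "automorphism_of_0 p a"
  proof -
    note a = a[unfolded automorphism_of_0_def]
    have aX: "a \<in> Arr X" using a R by simp
    obtain x where x: "x \<in> hom C (Dom C a) (Dom C ?k)" "?k \<cdot> x = a"
      using k(4)[OF aX] a kp by auto
    obtain y where y: "y \<in> hom C (Dom C a) (Dom C ?l)" "?l \<cdot> y = a"
      using l(4)[OF aX] a kp by auto
    obtain h where h: "h \<in> hom C (Dom C x) (Dom C (fst ?P))" "fst ?P \<cdot> h = x" "snd ?P \<cdot> h = y"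
      using pullback_lift[OF P(1), of x y] x y by auto
    have "incl p \<cdot> h = ?k \<cdot> (fst ?P \<cdot> h)"
      unfolding i by (rule assoc) (use h(1) k(1) sP in simp_all)
    then have "incl p \<cdot> h = a" unfolding h(2) x(2) .
    then show ?thesis using h x(1) sP unfolding i by (intro exI[of _ h]) simp
  qed
  show "h = h'" if h: "h \<in> Arr C" "h' \<in> Arr C" "Dom C h \<in> Obj X" "Dom C h' = Dom C h"
    "Cod C h = Dom C (incl p)" "Cod C h' = Dom C (incl p)" "incl p \<cdot> h = incl p \<cdot> h'"
  proof (rule pullback_jointly_monic[OF P(1) h(1,2) h(4)[symmetric]])
    have PX: "Dom C (fst ?P) \<in> Obj X" "Cod C (fst ?P) \<in> Obj X" "Cod C (snd ?P) \<in> Obj X"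
      using P(2,3) by simp_all
    show hP: "Cod C h = Dom C (fst ?P)" "Cod C h' = Dom C (fst ?P)"
      using h(5,6) k(1) sP unfolding i by simp_all
    have eq1: "?k \<cdot> (fst ?P \<cdot> h) = ?k \<cdot> (fst ?P \<cdot> h')"
      using h(7) k(1) sP(4-8) h(1,2) hP unfolding i by simp
    show "fst ?P \<cdot> h = fst ?P \<cdot> h'"
      by (rule k(5)[OF _ _ _ _ _ eq1]) (use sP(4-8) h(1-4) hP PX in simp_all)
    have eq2: "?l \<cdot> (snd ?P \<cdot> h) = ?l \<cdot> (snd ?P \<cdot> h')"
      using h(7) l(1) sP(4-8) h(1,2) hP unfolding i' by simp
    show "snd ?P \<cdot> h = snd ?P \<cdot> h'"
      by (rule l(5)[OF _ _ _ _ _ eq2]) (use sP(4-8) h(1-4) hP PX in simp_all)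
  qed
qed

lemma automorphism_of_0_galois_arr:
  assumes "related p n m" and "Dom C n \<in> Obj X"
    and "\<eta> (Dom C p) \<cdot> n = zero_arr C (Dom C n) (Io (Dom C p))"
    and "\<eta> (Dom C p) \<cdot> m = zero_arr C (Dom C n) (Io (Dom C p))"
  shows "automorphism_of_0 p (galois_arr p n m)"
  using galois_arr[OF p assms(1)] assms by (simp add: automorphism_of_0_def)

lemma galois_arr_zero:
  assumes "T \<in> Obj C"
  shows "galois_arr p (zero_arr C T (Dom C p)) (zero_arr C T (Dom C p)) = zero_arr C T (Io (R p))"
  using galois_arr_refl[OF p, of "zero_arr C T (Dom C p)"] assms p_arr[OF p] by simp

text \<open>
  Any \<open>m\<close> with \<open>\<eta> m = 0\<close> may be prescribed as the end of the representing pair \<open>(n, m)\<close>, and then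
  \<open>\<eta> n = 0\<close>. Applied repeatedly, this represents a string of automorphisms by a path of elements.
\<close>

lemma automorphism_of_0_lift:
  assumes a: "automorphism_of_0 p a"
    and m: "m \<in> Arr C" "Dom C m = Dom C a" "Cod C m = Dom C p"
    and "\<eta> (Dom C p) \<cdot> m = zero_arr C (Dom C a) (Io (Dom C p))"
  obtains n where "related p n m" and "a = galois_arr p n m" and "Dom C n = Dom C a"
    and "\<eta> (Dom C p) \<cdot> n = zero_arr C (Dom C a) (Io (Dom C p))"
proof -
  note a' = a[unfolded automorphism_of_0_def]
  have arr: "a \<in> Arr C" "Cod C a = Io (R p)" and "Ia (c p) \<cdot> a = \<eta> (Dom C p) \<cdot> m"
    using a' assms(5) by simp_all
  then obtain n where n: "related p n m" "a = galois_arr p n m"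
    using galois_arr_lift[OF p arr m] by blast
  moreover have "Dom C n = Dom C a" using n m by (simp add: related_def)
  moreover have "\<eta> (Dom C p) \<cdot> n = zero_arr C (Dom C a) (Io (Dom C p))"
    using galois_arr(4)[OF p n(1)] a' n(2) by simp
  ultimately show thesis by (rule that)
qed

lemma automorphism_of_0_lift_zero:
  assumes a: "automorphism_of_0 p a"
  obtains n where "related p n (zero_arr C (Dom C a) (Dom C p))"
    and "a = galois_arr p n (zero_arr C (Dom C a) (Dom C p))" and "Dom C n = Dom C a"
    and "\<eta> (Dom C p) \<cdot> n = zero_arr C (Dom C a) (Io (Dom C p))"
proof -
  have ob: "Dom C a \<in> Obj C" "Dom C p \<in> Obj C" using a p_arr[OF p] by (simp_all add: automorphism_of_0_def)
  show thesis
    by (rule automorphism_of_0_lift[OF a, of "zero_arr C (Dom C a) (Dom C p)"]) (use ob that in simp_all)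
qed

lemma galois_comp_automorphisms:
  assumes a: "automorphism_of_0 p a" and b: "automorphism_of_0 p b" and ab: "Dom C b = Dom C a"
  shows "galois_comp p a b \<in> Arr C" and "Dom C (galois_comp p a b) = Dom C a"
    and "Cod C (galois_comp p a b) = Io (R p)"
    and "\<lbrakk>t \<in> Arr C; Cod C t = Dom C a\<rbrakk> \<Longrightarrow> galois_comp p a b \<cdot> t = galois_comp p (a \<cdot> t) (b \<cdot> t)"
    and "automorphism_of_0 p (galois_comp p a b)"
proof -
  note a' = a[unfolded automorphism_of_0_def] and b' = b[unfolded automorphism_of_0_def]
  have eq: "Ia (c p) \<cdot> a = Ia (d p) \<cdot> b" using a' b' ab by simp
  have A: "a \<in> Arr C" "Cod C a = Io (R p)" "b \<in> Arr C" "Cod C b = Io (R p)" using a' b' by simp_all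
  note g = galois_comp[OF p A ab eq]
  show "galois_comp p a b \<in> Arr C" and "Dom C (galois_comp p a b) = Dom C a"
    and "Cod C (galois_comp p a b) = Io (R p)"
    and "\<lbrakk>t \<in> Arr C; Cod C t = Dom C a\<rbrakk> \<Longrightarrow> galois_comp p a b \<cdot> t = galois_comp p (a \<cdot> t) (b \<cdot> t)"
    by (fact g(1) g(2) g(3) | rule g(4))+
  obtain m where m: "related p m (zero_arr C (Dom C b) (Dom C p))"
    "b = galois_arr p m (zero_arr C (Dom C b) (Dom C p))" "Dom C m = Dom C b"
    "\<eta> (Dom C p) \<cdot> m = zero_arr C (Dom C b) (Io (Dom C p))"
    using automorphism_of_0_lift_zero[OF b] .
  have m': "m \<in> Arr C" "Dom C m = Dom C a" "Cod C m = Dom C p"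
    "\<eta> (Dom C p) \<cdot> m = zero_arr C (Dom C a) (Io (Dom C p))"
    using m ab by (simp_all add: related_def)
  obtain n where n: "related p n m" "a = galois_arr p n m" "Dom C n = Dom C a"
    "\<eta> (Dom C p) \<cdot> n = zero_arr C (Dom C a) (Io (Dom C p))"
    using automorphism_of_0_lift[OF a m'] .
  have "galois_comp p a b = galois_arr p n (zero_arr C (Dom C b) (Dom C p))"
    using galois_comp_galois_arr[OF p n(1) m(1)] n(2) m(2) by simp
  moreover have "automorphism_of_0 p (galois_arr p n (zero_arr C (Dom C b) (Dom C p)))"
    by (rule automorphism_of_0_galois_arr)
      (use related_trans[OF p n(1) m(1)] n(3,4) a' b' ab p_arr[OF p] in simp_all)
  ultimately show "automorphism_of_0 p (galois_comp p a b)" by simp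
qed

text \<open>
  Represent \<open>z\<close>, \<open>y\<close> and \<open>x\<close>, in this order, by pairs \<open>(m, 0)\<close>, \<open>(l, m)\<close> and \<open>(n, l)\<close>. Both composites
  are then represented by \<open>(n, 0)\<close>.
\<close>

lemma galois_comp_assoc:
  assumes x: "automorphism_of_0 p x" and y: "automorphism_of_0 p y" and z: "automorphism_of_0 p z"
    and dom: "Dom C y = Dom C x" "Dom C z = Dom C x"
  shows "galois_comp p (galois_comp p x y) z = galois_comp p x (galois_comp p y z)"
proof -
  let ?o = "zero_arr C (Dom C z) (Dom C p)"
  obtain m where m: "related p m ?o" "z = galois_arr p m ?o" "Dom C m = Dom C z"
    "\<eta> (Dom C p) \<cdot> m = zero_arr C (Dom C z) (Io (Dom C p))"
    using automorphism_of_0_lift_zero[OF z] .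
  have m': "m \<in> Arr C" "Dom C m = Dom C y" "Cod C m = Dom C p"
    "\<eta> (Dom C p) \<cdot> m = zero_arr C (Dom C y) (Io (Dom C p))"
    using m dom by (simp_all add: related_def)
  obtain l where l: "related p l m" "y = galois_arr p l m" "Dom C l = Dom C y"
    "\<eta> (Dom C p) \<cdot> l = zero_arr C (Dom C y) (Io (Dom C p))"
    using automorphism_of_0_lift[OF y m'] .
  have l': "l \<in> Arr C" "Dom C l = Dom C x" "Cod C l = Dom C p"
    "\<eta> (Dom C p) \<cdot> l = zero_arr C (Dom C x) (Io (Dom C p))"
    using l dom by (simp_all add: related_def)
  obtain n where n: "related p n l" "x = galois_arr p n l"
    using automorphism_of_0_lift[OF x l'] .
  have "galois_comp p (galois_comp p x y) z = galois_arr p n ?o"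
    unfolding n(2) l(2) galois_comp_galois_arr[OF p n(1) l(1)]
    by (subst m(2)) (rule galois_comp_galois_arr[OF p related_trans[OF p n(1) l(1)] m(1)])
  moreover have "galois_comp p y z = galois_arr p l ?o"
    unfolding l(2) by (subst m(2)) (rule galois_comp_galois_arr[OF p l(1) m(1)])
  then have "galois_comp p x (galois_comp p y z) = galois_arr p n ?o"
    unfolding n(2) using galois_comp_galois_arr[OF p n(1) related_trans[OF p l(1) m(1)]] by simp
  ultimately show ?thesis by simp
qed

text \<open>
  If \<open>(n, 0)\<close> represents \<open>x\<close>, the zero arrow is represented both by \<open>(n, n)\<close> and by \<open>(0, 0)\<close>.
\<close>

lemma galois_comp_zero:
  assumes x: "automorphism_of_0 p x"
  shows "galois_comp p (zero_arr C (Dom C x) (Io (R p))) x = x"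
    and "galois_comp p x (zero_arr C (Dom C x) (Io (R p))) = x"
proof -
  let ?o = "zero_arr C (Dom C x) (Dom C p)"
  have ob: "Dom C x \<in> Obj C" "Dom C p \<in> Obj C"
    using x p_arr[OF p] by (simp_all add: automorphism_of_0_def)
  obtain n where n: "related p n ?o" "x = galois_arr p n ?o" "Dom C n = Dom C x"
    "\<eta> (Dom C p) \<cdot> n = zero_arr C (Dom C x) (Io (Dom C p))"
    using automorphism_of_0_lift_zero[OF x] .
  have n': "n \<in> Arr C" "Cod C n = Dom C p" using n(1) by (simp_all add: related_def)
  have "zero_arr C (Dom C x) (Io (R p)) = galois_arr p n n"
    using galois_arr_refl[OF p n'] n by simp
  then show "galois_comp p (zero_arr C (Dom C x) (Io (R p))) x = x"
    using galois_comp_galois_arr[OF p related_refl[OF p n'] n(1)] n(2) by simp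
  have "related p ?o ?o" by (rule related_refl[OF p]) (use ob in simp_all)
  then show "galois_comp p x (zero_arr C (Dom C x) (Io (R p))) = x"
    using galois_comp_galois_arr[OF p n(1), of ?o] n(2) galois_arr_zero[OF ob(1)] by simp
qed

lemma galois_comp_inv:
  assumes x: "automorphism_of_0 p x"
  defines "y \<equiv> Ia (pair p (c p) (d p)) \<cdot> x"
  shows "automorphism_of_0 p y" and "Dom C y = Dom C x"
    and "galois_comp p y x = zero_arr C (Dom C x) (Io (R p))"
    and "galois_comp p x y = zero_arr C (Dom C x) (Io (R p))"
proof -
  let ?o = "zero_arr C (Dom C x) (Dom C p)"
  have ob: "Dom C x \<in> Obj C" "Dom C p \<in> Obj C" "Dom C x \<in> Obj X"
    using x p_arr[OF p] by (simp_all add: automorphism_of_0_def)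
  obtain n where n: "related p n ?o" "x = galois_arr p n ?o" "Dom C n = Dom C x"
    "\<eta> (Dom C p) \<cdot> n = zero_arr C (Dom C x) (Io (Dom C p))"
    using automorphism_of_0_lift_zero[OF x] .
  have n': "n \<in> Arr C" "Cod C n = Dom C p" using n(1) by (simp_all add: related_def)
  have y: "y = galois_arr p ?o n"
    unfolding y_def using galois_inv_galois_arr[OF p n(1)] n(2) by simp
  have r: "related p ?o n" by (rule related_sym[OF p n(1)])
  show "automorphism_of_0 p y"
    unfolding y by (rule automorphism_of_0_galois_arr[OF r]) (use ob n in simp_all)
  show "Dom C y = Dom C x" unfolding y using galois_arr(2)[OF p r] ob by simp
  have "galois_comp p y x = galois_arr p ?o ?o"
    using galois_comp_galois_arr[OF p r n(1)] y n(2) by simp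
  then show "galois_comp p y x = zero_arr C (Dom C x) (Io (R p))"
    using galois_arr_zero ob by simp
  have "galois_comp p x y = galois_arr p n n"
    using galois_comp_galois_arr[OF p n(1) r] y n(2) by simp
  then show "galois_comp p x y = zero_arr C (Dom C x) (Io (R p))"
    using galois_arr_refl[OF p n'] n by simp
qed

end

definition galois_mult :: "'m \<Rightarrow> 'm \<Rightarrow> 'm \<Rightarrow> 'm" where
  "galois_mult p a b = gp_mult (galois_group \<Gamma> p) \<cdot>\<^bsub>X\<^esub>
     tuple X (product X (Dom C (incl p)) (Dom C (incl p))) a b"

context
  fixes p
  assumes p: "normal_extension \<Gamma> p"
begin

abbreviation (input) "K \<equiv> Dom C (incl p)"
abbreviation (input) "P \<equiv> product X (Dom C (incl p)) (Dom C (incl p))"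

lemma factor_incl:
  assumes a: "automorphism_of_0 p a"
  shows "factor X (incl p) a \<in> Arr C" and "Dom C (factor X (incl p) a) = Dom C a"
    and "Cod C (factor X (incl p) a) = K" and "incl p \<cdot> factor X (incl p) a = a"
proof -
  have R: "R p \<in> Obj C" using kp_arr[OF p] by simp
  have aX: "a \<in> Arr X" "Dom C a \<in> Obj X" using a R by (simp_all add: automorphism_of_0_def)
  have kX: "incl p \<in> Arr X" using incl(1-3)[OF p] R by simp
  obtain h where h: "h \<in> hom C (Dom C a) K" "incl p \<cdot> h = a" using incl(5)[OF p a] by blast
  have "factor X (incl p) a = h"
    unfolding factor_X[OF kX aX(1)]
  proof (rule factor_eq)
    show "h' = h" if "h' \<in> Arr C" "Dom C h' = Dom C h" "Cod C h' = K" "incl p \<cdot> h' = incl p \<cdot> h" for h'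
      by (rule incl(6)[OF p]) (use that h aX in simp_all)
  qed (use h incl(1)[OF p] in simp_all)
  then show "factor X (incl p) a \<in> Arr C" and "Dom C (factor X (incl p) a) = Dom C a"
    and "Cod C (factor X (incl p) a) = K" and "incl p \<cdot> factor X (incl p) a = a"
    using h by simp_all
qed

lemma incl_comp:
  assumes "x \<in> Arr C" and "Dom C x \<in> Obj X" and "Cod C x = K"
  shows "automorphism_of_0 p (incl p \<cdot> x)"
proof -
  note i = incl(1-4)[OF p, unfolded automorphism_of_0_def] and kp = kp_arr[OF p] and pa = p_arr[OF p]
  have d: "Ia (d p) \<cdot> (incl p \<cdot> x) = zero_arr C K (Io (Dom C p)) \<cdot> x"
    by (rule comp_cong_left) (use i kp assms in simp_all)
  have c: "Ia (c p) \<cdot> (incl p \<cdot> x) = zero_arr C K (Io (Dom C p)) \<cdot> x"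
    by (rule comp_cong_left) (use i kp assms in simp_all)
  show ?thesis unfolding automorphism_of_0_def d c using i kp pa assms by simp
qed

lemma Dom_incl: "Dom X (incl p) = K"
  using incl(1-3)[OF p] kp_arr[OF p] by simp

lemma galois_group_simps:
  "gp_obj (galois_group \<Gamma> p) = K"
  "gp_unit (galois_group \<Gamma> p) =
     factor X (incl p) (gd_unit (galois_groupoid \<Gamma> p) \<cdot>\<^bsub>X\<^esub> zero_arr X (terminal X) (Io (Dom C p)))"
  "gp_inv (galois_group \<Gamma> p) = factor X (incl p) (Ia (pair p (c p) (d p)) \<cdot>\<^bsub>X\<^esub> incl p)"
  by (simp_all add: galois_group_def group_at_0_def Let_def galois_groupoid_simps Dom_incl)

lemma K_obj: "K \<in> Obj X" "K \<in> Obj C"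
  using incl(2)[OF p] by simp_all

lemma P_arr:
  shows "fst P \<in> Arr C" and "snd P \<in> Arr C" and "Dom C (snd P) = Dom C (fst P)" and "Dom C (fst P) \<in> Obj X"
    and "Cod C (fst P) = K" and "Cod C (snd P) = K"
proof -
  note sp = X.product_span[OF product_X[OF K_obj(1) K_obj(1)]]
  then show "fst P \<in> Arr C" and "snd P \<in> Arr C" and "Dom C (snd P) = Dom C (fst P)" and "Dom C (fst P) \<in> Obj X"
    and "Cod C (fst P) = K" and "Cod C (snd P) = K"
    by simp_all
qed

lemma gp_mult:
  shows "gp_mult (galois_group \<Gamma> p) \<in> Arr C"
    and "Dom C (gp_mult (galois_group \<Gamma> p)) = Dom C (fst P)"
    and "Cod C (gp_mult (galois_group \<Gamma> p)) = K"
    and "incl p \<cdot> gp_mult (galois_group \<Gamma> p) = galois_comp p (incl p \<cdot> fst P) (incl p \<cdot> snd P)"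
proof -
  note i = incl(1-4)[OF p] and kp = kp_arr[OF p] and pa = p_arr[OF p] and Pa = P_arr
  have R: "R p \<in> Obj C" using kp by simp
  let ?r = "pullback X (Ia (c p)) (Ia (d p))"
  let ?a = "incl p \<cdot> fst P" and ?b = "incl p \<cdot> snd P"
  have ab: "automorphism_of_0 p ?a" "automorphism_of_0 p ?b" using incl_comp Pa by simp_all
  have ab_dom: "Dom C ?b = Dom C ?a" "Dom C ?a = Dom C (fst P)" using Pa i by simp_all
  note gc = galois_comp_automorphisms[OF p ab ab_dom(1)]
  have eqX: "incl p \<cdot>\<^bsub>X\<^esub> fst P = ?a" "incl p \<cdot>\<^bsub>X\<^esub> snd P = ?b" using Pa i R by simp_all
  have r: "is_pullback C (Ia (c p)) (Ia (d p)) (fst ?r) (snd ?r)" "fst ?r \<in> Arr X" "snd ?r \<in> Arr X"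
    by (rule chosen_pullback_X; use kp pa R in simp)+
  note sr = pullback_square[OF r(1)]
  have aX: "?a \<in> Arr X" using ab R by (simp add: automorphism_of_0_def)
  have t: "tuple X ?r ?a ?b = tuple C ?r ?a ?b"
    by (rule tuple_X[OF r(2,3) sr(6) aX])
  have tC: "tuple C ?r ?a ?b \<in> Arr C" "Dom C (tuple C ?r ?a ?b) = Dom C ?a"
    "Cod C (tuple C ?r ?a ?b) = Dom C (fst ?r)"
    using tuple_pullback[OF r(1), of ?a ?b] ab ab_dom kp unfolding automorphism_of_0_def by simp_all
  have "gd_comp (galois_groupoid \<Gamma> p) \<cdot>\<^bsub>X\<^esub> tuple X ?r ?a ?b = galois_comp p ?a ?b"
    unfolding galois_comp_def t using gd_comp[OF p] tC r(2) aX R by simp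
  then have m: "gp_mult (galois_group \<Gamma> p) = factor X (incl p) (galois_comp p ?a ?b)"
    by (simp add: galois_group_def group_at_0_def Let_def galois_groupoid_simps Dom_incl eqX)
  show "gp_mult (galois_group \<Gamma> p) \<in> Arr C"
    and "Dom C (gp_mult (galois_group \<Gamma> p)) = Dom C (fst P)"
    and "Cod C (gp_mult (galois_group \<Gamma> p)) = K"
    and "incl p \<cdot> gp_mult (galois_group \<Gamma> p) = galois_comp p ?a ?b"
    unfolding m using factor_incl[OF gc(5)] gc(2) ab_dom by simp_all
qed

lemma tuple_P:
  assumes "a \<in> Arr C" and "b \<in> Arr C" and "Dom C b = Dom C a" and "Dom C a \<in> Obj X"
    and "Cod C a = K" and "Cod C b = K"
  shows "tuple X P a b \<in> Arr C" and "Dom C (tuple X P a b) = Dom C a"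
    and "Cod C (tuple X P a b) = Dom C (fst P)"
    and "fst P \<cdot> tuple X P a b = a" and "snd P \<cdot> tuple X P a b = b"
proof -
  have aX: "a \<in> Arr X" "b \<in> Arr X" "Dom X b = Dom X a" "Cod X a = K" "Cod X b = K"
    using assms K_obj by simp_all
  note t = X.tuple_product[OF product_X[OF K_obj(1) K_obj(1)] aX]
  show t1: "tuple X P a b \<in> Arr C" "Dom C (tuple X P a b) = Dom C a" "Cod C (tuple X P a b) = Dom C (fst P)"
    using t(1-3) P_arr aX assms by simp_all
  have "fst P \<cdot>\<^bsub>X\<^esub> tuple X P a b = fst P \<cdot> tuple X P a b" "snd P \<cdot>\<^bsub>X\<^esub> tuple X P a b = snd P \<cdot> tuple X P a b"
    using t1 P_arr assms K_obj by simp_all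
  then show "fst P \<cdot> tuple X P a b = a" and "snd P \<cdot> tuple X P a b = b" using t(4,5) by simp_all
qed

lemma galois_mult:
  assumes ab: "a \<in> Arr C" "b \<in> Arr C" "Dom C b = Dom C a" "Dom C a \<in> Obj X" "Cod C a = K" "Cod C b = K"
  shows "galois_mult p a b \<in> Arr C" and "Dom C (galois_mult p a b) = Dom C a"
    and "Cod C (galois_mult p a b) = K"
    and "incl p \<cdot> galois_mult p a b = galois_comp p (incl p \<cdot> a) (incl p \<cdot> b)"
proof -
  note t = tuple_P[OF ab] and m = gp_mult and i = incl(1-4)[OF p]
  let ?t = "tuple X P a b" and ?m = "gp_mult (galois_group \<Gamma> p)"
  have e: "galois_mult p a b = ?m \<cdot> ?t"
    unfolding galois_mult_def using t m K_obj P_arr ab by simp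
  show "galois_mult p a b \<in> Arr C" and "Dom C (galois_mult p a b) = Dom C a"
    and "Cod C (galois_mult p a b) = K"
    unfolding e using t m by simp_all
  have AB: "automorphism_of_0 p (incl p \<cdot> fst P)" "automorphism_of_0 p (incl p \<cdot> snd P)"
    using incl_comp P_arr by simp_all
  have dom: "Dom C (incl p \<cdot> snd P) = Dom C (incl p \<cdot> fst P)" "Dom C (incl p \<cdot> fst P) = Dom C (fst P)"
    using i P_arr by simp_all
  have "incl p \<cdot> galois_mult p a b = galois_comp p (incl p \<cdot> fst P) (incl p \<cdot> snd P) \<cdot> ?t"
    unfolding e by (rule comp_cong_left[OF m(4)]) (use t m i in simp_all)
  also have "\<dots> = galois_comp p ((incl p \<cdot> fst P) \<cdot> ?t) ((incl p \<cdot> snd P) \<cdot> ?t)"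
    by (rule galois_comp_automorphisms(4)[OF p AB dom(1)]) (use t dom(2) in simp_all)
  also have "(incl p \<cdot> fst P) \<cdot> ?t = incl p \<cdot> a"
  proof -
    have "(incl p \<cdot> fst P) \<cdot> ?t = incl p \<cdot> (fst P \<cdot> ?t)" by (rule assoc) (use t P_arr i in simp_all)
    then show ?thesis unfolding t(4) .
  qed
  also have "(incl p \<cdot> snd P) \<cdot> ?t = incl p \<cdot> b"
  proof -
    have "(incl p \<cdot> snd P) \<cdot> ?t = incl p \<cdot> (snd P \<cdot> ?t)" by (rule assoc) (use t P_arr i in simp_all)
    then show ?thesis unfolding t(5) .
  qed
  finally show "incl p \<cdot> galois_mult p a b = galois_comp p (incl p \<cdot> a) (incl p \<cdot> b)" .
qed

lemma galois_mult_assoc: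
  assumes x: "x \<in> Arr C" "Dom C x \<in> Obj X" "Cod C x = K"
    and y: "y \<in> Arr C" "Dom C y = Dom C x" "Cod C y = K"
    and z: "z \<in> Arr C" "Dom C z = Dom C x" "Cod C z = K"
  shows "galois_mult p (galois_mult p x y) z = galois_mult p x (galois_mult p y z)"
proof -
  note i = incl(1-4)[OF p]
  have xy: "galois_mult p x y \<in> Arr C" "Dom C (galois_mult p x y) = Dom C x" "Cod C (galois_mult p x y) = K"
    "incl p \<cdot> galois_mult p x y = galois_comp p (incl p \<cdot> x) (incl p \<cdot> y)"
    using galois_mult[of x y] x y by simp_all
  have yz: "galois_mult p y z \<in> Arr C" "Dom C (galois_mult p y z) = Dom C x" "Cod C (galois_mult p y z) = K"
    "incl p \<cdot> galois_mult p y z = galois_comp p (incl p \<cdot> y) (incl p \<cdot> z)"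
    using galois_mult[of y z] x y z by simp_all
  have l: "galois_mult p (galois_mult p x y) z \<in> Arr C" "Dom C (galois_mult p (galois_mult p x y) z) = Dom C x"
    "Cod C (galois_mult p (galois_mult p x y) z) = K"
    "incl p \<cdot> galois_mult p (galois_mult p x y) z =
       galois_comp p (galois_comp p (incl p \<cdot> x) (incl p \<cdot> y)) (incl p \<cdot> z)"
    using galois_mult[of "galois_mult p x y" z] xy x z by simp_all
  have r: "galois_mult p x (galois_mult p y z) \<in> Arr C" "Dom C (galois_mult p x (galois_mult p y z)) = Dom C x"
    "Cod C (galois_mult p x (galois_mult p y z)) = K"
    "incl p \<cdot> galois_mult p x (galois_mult p y z) =
       galois_comp p (incl p \<cdot> x) (galois_comp p (incl p \<cdot> y) (incl p \<cdot> z))"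
    using galois_mult[of x "galois_mult p y z"] yz x by simp_all
  have null: "automorphism_of_0 p (incl p \<cdot> x)" "automorphism_of_0 p (incl p \<cdot> y)" "automorphism_of_0 p (incl p \<cdot> z)"
    by (rule incl_comp; use x y z in simp)+
  have "galois_comp p (galois_comp p (incl p \<cdot> x) (incl p \<cdot> y)) (incl p \<cdot> z) =
      galois_comp p (incl p \<cdot> x) (galois_comp p (incl p \<cdot> y) (incl p \<cdot> z))"
    by (rule galois_comp_assoc[OF p null]) (use x y z i in simp_all)
  then have eq: "incl p \<cdot> galois_mult p (galois_mult p x y) z = incl p \<cdot> galois_mult p x (galois_mult p y z)"
    unfolding l(4) r(4) .
  show ?thesis
    by (rule incl(6)[OF p l(1) r(1) _ _ l(3) r(3) eq]) (use l(2) r(2) x in simp_all)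
qed

lemma gp_unit:
  shows "gp_unit (galois_group \<Gamma> p) \<in> Arr C"
    and "Dom C (gp_unit (galois_group \<Gamma> p)) = terminal X"
    and "Cod C (gp_unit (galois_group \<Gamma> p)) = K"
    and "incl p \<cdot> gp_unit (galois_group \<Gamma> p) = zero_arr C (terminal X) (Io (R p))"
proof -
  note i = incl(1-4)[OF p] and kp = kp_arr[OF p] and pa = p_arr[OF p] and T = terminal_X(1)
  have R: "R p \<in> Obj C" and E: "Dom C p \<in> Obj C" using kp pa by simp_all
  let ?i = "Ide C (Dom C p)" and ?z = "zero_arr C (terminal X) (Io (R p))"
  have ri: "related p ?i ?i" by (rule related_refl[OF p]) (use E in simp_all)
  note pr = pair[OF p ri]
  have "gd_unit (galois_groupoid \<Gamma> p) \<cdot>\<^bsub>X\<^esub> zero_arr X (terminal X) (Io (Dom C p)) = ?z"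
    unfolding galois_groupoid_simps using pr E R T by simp
  then have u: "gp_unit (galois_group \<Gamma> p) = factor X (incl p) ?z" by (simp add: galois_group_simps)
  have "automorphism_of_0 p ?z" using kp R E T by (simp add: automorphism_of_0_def)
  note f = factor_incl[OF this]
  show "gp_unit (galois_group \<Gamma> p) \<in> Arr C"
    and "Dom C (gp_unit (galois_group \<Gamma> p)) = terminal X"
    and "Cod C (gp_unit (galois_group \<Gamma> p)) = K"
    and "incl p \<cdot> gp_unit (galois_group \<Gamma> p) = zero_arr C (terminal X) (Io (R p))"
    unfolding u using f R T by simp_all
qed

lemma gp_inv:
  shows "gp_inv (galois_group \<Gamma> p) \<in> Arr C" and "Dom C (gp_inv (galois_group \<Gamma> p)) = K"
    and "Cod C (gp_inv (galois_group \<Gamma> p)) = K"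
    and "incl p \<cdot> gp_inv (galois_group \<Gamma> p) = Ia (pair p (c p) (d p)) \<cdot> incl p"
proof -
  note i = incl(1-4)[OF p] and kp = kp_arr[OF p]
  have R: "R p \<in> Obj C" using kp by simp
  note inv = galois_comp_inv[OF p i(4)]
  have "related p (c p) (d p)"
    using related_sym[OF p related_projections[OF p, of "Ide C (R p)"]] R kp by simp
  note pr = pair[OF p this]
  have "Ia (pair p (c p) (d p)) \<cdot>\<^bsub>X\<^esub> incl p = Ia (pair p (c p) (d p)) \<cdot> incl p"
    using pr i R kp by simp
  then have u: "gp_inv (galois_group \<Gamma> p) = factor X (incl p) (Ia (pair p (c p) (d p)) \<cdot> incl p)"
    by (simp add: galois_group_simps)
  show "gp_inv (galois_group \<Gamma> p) \<in> Arr C" and "Dom C (gp_inv (galois_group \<Gamma> p)) = K"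
    and "Cod C (gp_inv (galois_group \<Gamma> p)) = K"
    and "incl p \<cdot> gp_inv (galois_group \<Gamma> p) = Ia (pair p (c p) (d p)) \<cdot> incl p"
    unfolding u using factor_incl[OF inv(1)] inv(2) by simp_all
qed

text \<open>
  Composing with the monomorphism \<open>incl p\<close> turns the multiplication into \<open>galois_comp\<close> and the unit
  into a zero arrow, so the group laws reduce to those for automorphisms of \<open>0\<close>.
\<close>

lemma is_int_group_galois_group: "is_int_group X (galois_group \<Gamma> p)"
proof -
  let ?G = "galois_group \<Gamma> p"
  note i = incl(1-4)[OF p] and kp = kp_arr[OF p] and K = K_obj and Pa = P_arr
  have R: "R p \<in> Obj C" using kp by simp
  let ?o = "gp_unit ?G \<cdot>\<^bsub>X\<^esub> terminal_arr X K"
  have ta: "terminal_arr X K \<in> hom C K (terminal X)" using terminal_X(2)[OF K(1)] hom_X by blast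
  have o': "?o = gp_unit ?G \<cdot> terminal_arr X K" using ta gp_unit K terminal_X(1) by simp
  have o: "?o \<in> Arr C" "Dom C ?o = K" "Cod C ?o = K" unfolding o' using ta gp_unit by simp_all
  have io: "incl p \<cdot> ?o = zero_arr C K (Io (R p))"
  proof -
    have "incl p \<cdot> ?o = zero_arr C (terminal X) (Io (R p)) \<cdot> terminal_arr X K"
      unfolding o' by (rule comp_cong_left[OF gp_unit(4)]) (use ta gp_unit i in simp_all)
    then show ?thesis using ta R by simp
  qed
  have id: "Ide C K \<in> Arr C" "Dom C (Ide C K) = K" "Cod C (Ide C K) = K" using K by simp_all
  have iid: "incl p \<cdot> Ide C K = incl p" using i by simp
  let ?Q = "product X (Dom C (fst P)) K"
  note Q = X.product_span[OF product_X[OF Pa(4) K(1)]]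
  have Qa: "fst ?Q \<in> Arr C" "snd ?Q \<in> Arr C" "Dom C (snd ?Q) = Dom C (fst ?Q)" "Dom C (fst ?Q) \<in> Obj X"
    "Cod C (fst ?Q) = Dom C (fst P)" "Cod C (snd ?Q) = K"
    using Q Pa K by simp_all
  let ?x = "fst P \<cdot> fst ?Q" and ?y = "snd P \<cdot> fst ?Q" and ?z = "snd ?Q"
  have xyz: "?x \<in> Arr C" "?y \<in> Arr C" "?z \<in> Arr C" "Dom C ?x = Dom C ?z" "Dom C ?y = Dom C ?z"
    "Dom C ?z \<in> Obj X" "Cod C ?x = K" "Cod C ?y = K" "Cod C ?z = K"
    using Qa Pa by simp_all
  have xX: "fst P \<cdot>\<^bsub>X\<^esub> fst ?Q = ?x" "snd P \<cdot>\<^bsub>X\<^esub> fst ?Q = ?y" using Qa Pa K by simp_all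
  have mult_assoc: "galois_mult p (galois_mult p ?x ?y) ?z = galois_mult p ?x (galois_mult p ?y ?z)"
    by (rule galois_mult_assoc) (use xyz in simp_all)
  have unitl: "galois_mult p ?o (Ide C K) = Ide C K"
    by (rule incl(6)[OF p])
      (use galois_mult[of ?o "Ide C K"] o id K io iid galois_comp_zero(1)[OF p i(4)] in simp_all)
  have unitr: "galois_mult p (Ide C K) ?o = Ide C K"
    by (rule incl(6)[OF p])
      (use galois_mult[of "Ide C K" ?o] o id K io iid galois_comp_zero(2)[OF p i(4)] in simp_all)
  note inv = galois_comp_inv[OF p i(4)]
  have invl: "galois_mult p (gp_inv ?G) (Ide C K) = ?o"
    by (rule incl(6)[OF p])
      (use galois_mult[of "gp_inv ?G" "Ide C K"] gp_inv o id K io iid inv in simp_all)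
  have invr: "galois_mult p (Ide C K) (gp_inv ?G) = ?o"
    by (rule incl(6)[OF p])
      (use galois_mult[of "Ide C K" "gp_inv ?G"] gp_inv o id K io iid inv in simp_all)
  have DP: "Dom X (fst P) = Dom C (fst P)" using Pa K by simp
  show ?thesis
    unfolding is_int_group_def Let_def galois_group_simps(1) DP xX galois_mult_def[symmetric]
      Ide_X[OF K(1)]
    using mult_assoc unitl unitr invl invr gp_mult(1-3) gp_unit(1-3) gp_inv(1-3) K Pa terminal_X(1)
    by simp
qed

end

end

section \<open>Functoriality of the Galois group\<close>

context small_category
begin

text \<open>
  Products enter because multiplications are arrows out of the chosen products, which have to be
  actual products for homomorphisms to compose.
\<close>

lemma category_Gp:
  assumes prod: "\<And>x y. \<lbrakk>x \<in> Obj C; y \<in> Obj C\<rbrakk> \<Longrightarrow> is_product C x y (fst (product C x y)) (snd (product C x y))"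
  shows "category (Gp C)"
proof -
  have grp: "gp_obj G \<in> Obj C" "gp_mult G \<in> Arr C"
      "Dom C (gp_mult G) = Dom C (fst (product C (gp_obj G) (gp_obj G)))" "Cod C (gp_mult G) = gp_obj G"
    if "is_int_group C G" for G
    using that unfolding is_int_group_def Let_def by simp_all
  have ide: "int_group_hom C G G (Ide C (gp_obj G))" if G: "is_int_group C G" for G
  proof -
    let ?P = "product C (gp_obj G) (gp_obj G)"
    note g = grp[OF G] and P = prod[OF grp(1)[OF G] grp(1)[OF G]]
    note sp = product_span[OF P] and t = tuple_product[OF P, of "fst ?P" "snd ?P"]
    have o: "Dom C (fst ?P) \<in> Obj C" using sp by simp
    have "tuple C ?P (fst ?P) (snd ?P) = Ide C (Dom C (fst ?P))"
      by (rule product_jointly_monic[OF P]) (use sp t o in simp_all)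
    then show ?thesis unfolding int_group_hom_def Let_def using g sp by simp
  qed
  have comp: "int_group_hom C G G'' (f' \<cdot> f)"
    if G: "is_int_group C G" and G': "is_int_group C G'" and G'': "is_int_group C G''"
      and f: "int_group_hom C G G' f" and f': "int_group_hom C G' G'' f'" for G G' G'' f f'
  proof -
    let ?P = "product C (gp_obj G) (gp_obj G)" and ?P' = "product C (gp_obj G') (gp_obj G')"
      and ?P'' = "product C (gp_obj G'') (gp_obj G'')"
    note P = prod[OF grp(1)[OF G] grp(1)[OF G]] and P' = prod[OF grp(1)[OF G'] grp(1)[OF G']]
      and P'' = prod[OF grp(1)[OF G''] grp(1)[OF G'']]
    note sp = product_span[OF P] product_span[OF P'] product_span[OF P'']
    note g = grp[OF G] grp[OF G'] grp[OF G'']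
    let ?t = "tuple C ?P' (f \<cdot> fst ?P) (f \<cdot> snd ?P)" and ?t' = "tuple C ?P'' (f' \<cdot> fst ?P') (f' \<cdot> snd ?P')"
    have fa: "f \<in> hom C (gp_obj G) (gp_obj G')" "f' \<in> hom C (gp_obj G') (gp_obj G'')"
      and fm: "f \<cdot> gp_mult G = gp_mult G' \<cdot> ?t" and fm': "f' \<cdot> gp_mult G' = gp_mult G'' \<cdot> ?t'"
      using f f' unfolding int_group_hom_def Let_def by blast+
    have t: "?t \<in> Arr C" "Dom C ?t = Dom C (fst ?P)" "Cod C ?t = Dom C (fst ?P')"
      "fst ?P' \<cdot> ?t = f \<cdot> fst ?P" "snd ?P' \<cdot> ?t = f \<cdot> snd ?P"
      using tuple_product[OF P', of "f \<cdot> fst ?P" "f \<cdot> snd ?P"] fa sp by simp_all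
    have t': "?t' \<in> Arr C" "Dom C ?t' = Dom C (fst ?P')" "Cod C ?t' = Dom C (fst ?P'')"
      using tuple_product[OF P'', of "f' \<cdot> fst ?P'" "f' \<cdot> snd ?P'"] fa sp by simp_all
    have "?t' \<cdot> ?t = tuple C ?P'' ((f' \<cdot> fst ?P') \<cdot> ?t) ((f' \<cdot> snd ?P') \<cdot> ?t)"
      by (rule tuple_product_comp[OF P'']) (use fa sp t in simp_all)
    also have "(f' \<cdot> fst ?P') \<cdot> ?t = (f' \<cdot> f) \<cdot> fst ?P" using fa sp t by simp
    also have "(f' \<cdot> snd ?P') \<cdot> ?t = (f' \<cdot> f) \<cdot> snd ?P" using fa sp t by simp
    finally have tt: "?t' \<cdot> ?t = tuple C ?P'' ((f' \<cdot> f) \<cdot> fst ?P) ((f' \<cdot> f) \<cdot> snd ?P)" .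
    have "(f' \<cdot> f) \<cdot> gp_mult G = f' \<cdot> (f \<cdot> gp_mult G)" by (rule assoc) (use fa g in simp_all)
    also have "\<dots> = f' \<cdot> (gp_mult G' \<cdot> ?t)" unfolding fm ..
    also have "\<dots> = gp_mult G'' \<cdot> (?t' \<cdot> ?t)"
      by (rule comp_swap_left[OF fm']) (use fa g t t' in simp_all)
    finally show ?thesis unfolding int_group_hom_def Let_def tt using fa by simp
  qed
  have arr: "\<exists>G h G'. t = (G, h, G') \<and> is_int_group C G \<and> is_int_group C G' \<and> int_group_hom C G G' h \<and>
      h \<in> hom C (gp_obj G) (gp_obj G')" if "t \<in> Arr (Gp C)" for t
    using that by (cases t) (simp add: Gp_def int_group_hom_def)
  show ?thesis
    unfolding category_def
  proof (intro conjI ballI impI)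
    fix G assume "G \<in> Obj (Gp C)"
    then show "Ide (Gp C) G \<in> hom (Gp C) G G" using ide by (simp add: Gp_def)
  next
    fix t assume t: "t \<in> Arr (Gp C)"
    obtain G h G' where t': "t = (G, h, G')" "is_int_group C G" "is_int_group C G'" "int_group_hom C G G' h"
      "h \<in> hom C (gp_obj G) (gp_obj G')" using arr[OF t] by blast
    show "Dom (Gp C) t \<in> Obj (Gp C)" "Cod (Gp C) t \<in> Obj (Gp C)"
      "t \<cdot>\<^bsub>Gp C\<^esub> Ide (Gp C) (Dom (Gp C) t) = t" "Ide (Gp C) (Cod (Gp C) t) \<cdot>\<^bsub>Gp C\<^esub> t = t"
      using t'(2,3,5) by (simp_all add: t'(1) Gp_def)
    fix s assume s: "s \<in> Arr (Gp C)"
    obtain H k H' where s': "s = (H, k, H')" "is_int_group C H" "is_int_group C H'" "int_group_hom C H H' k"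
      "k \<in> hom C (gp_obj H) (gp_obj H')" using arr[OF s] by blast
    show "s \<cdot>\<^bsub>Gp C\<^esub> t \<in> hom (Gp C) (Dom (Gp C) t) (Cod (Gp C) s)" if "Dom (Gp C) s = Cod (Gp C) t"
    proof -
      have H: "H = G'" using that by (simp add: t'(1) s'(1) Gp_def)
      have "int_group_hom C G H' (k \<cdot> h)" by (rule comp[OF t'(2,3) s'(3) t'(4) s'(4)[unfolded H]])
      then show ?thesis using t'(2) s'(3) by (simp add: t'(1) s'(1) Gp_def)
    qed
    fix r assume r: "r \<in> Arr (Gp C)" and st: "Dom (Gp C) s = Cod (Gp C) t \<and> Dom (Gp C) r = Cod (Gp C) s"
    obtain L l L' where r': "r = (L, l, L')" "l \<in> hom C (gp_obj L) (gp_obj L')" using arr[OF r] by blast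
    show "(r \<cdot>\<^bsub>Gp C\<^esub> s) \<cdot>\<^bsub>Gp C\<^esub> t = r \<cdot>\<^bsub>Gp C\<^esub> (s \<cdot>\<^bsub>Gp C\<^esub> t)"
    proof -
      have "H = G'" "L = H'" using st by (simp_all add: t'(1) s'(1) r'(1) Gp_def)
      then have "(l \<cdot> k) \<cdot> h = l \<cdot> (k \<cdot> h)" using t'(5) s'(5) r'(2) by simp
      then show ?thesis by (simp add: t'(1) s'(1) r'(1) Gp_def)
    qed
  qed
qed

lemma category_arrow_category: "category (arrow_category C)"
proof -
  have square: "q' \<cdot> (f' \<cdot> f) = (b' \<cdot> b) \<cdot> p"
    if a: "p \<in> Arr C" "q \<in> Arr C" "q' \<in> Arr C" "f \<in> hom C (Dom C p) (Dom C q)" "b \<in> hom C (Cod C p) (Cod C q)"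
      "f' \<in> hom C (Dom C q) (Dom C q')" "b' \<in> hom C (Cod C q) (Cod C q')"
      and e: "q \<cdot> f = b \<cdot> p" "q' \<cdot> f' = b' \<cdot> q" for p q q' f b f' b'
  proof -
    have "q' \<cdot> (f' \<cdot> f) = b' \<cdot> (q \<cdot> f)" by (rule comp_swap_left[OF e(2)]) (use a in simp_all)
    then show ?thesis unfolding e(1) using a by simp
  qed
  have arr: "\<exists>p f b p'. t = (p, (f, b), p') \<and> p \<in> Arr C \<and> p' \<in> Arr C \<and> f \<in> hom C (Dom C p) (Dom C p') \<and>
      b \<in> hom C (Cod C p) (Cod C p') \<and> p' \<cdot> f = b \<cdot> p" if "t \<in> Arr (arrow_category C)" for t
    using that by (cases t) (auto simp: arrow_category_def)
  show ?thesis
    unfolding category_def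
  proof (intro conjI ballI impI)
    fix p assume "p \<in> Obj (arrow_category C)"
    then show "Ide (arrow_category C) p \<in> hom (arrow_category C) p p" by (simp add: arrow_category_def)
  next
    fix t assume t: "t \<in> Arr (arrow_category C)"
    obtain p f b p' where t': "t = (p, (f, b), p')" "p \<in> Arr C" "p' \<in> Arr C" "f \<in> hom C (Dom C p) (Dom C p')"
      "b \<in> hom C (Cod C p) (Cod C p')" "p' \<cdot> f = b \<cdot> p" using arr[OF t] by blast
    show "Dom (arrow_category C) t \<in> Obj (arrow_category C)" "Cod (arrow_category C) t \<in> Obj (arrow_category C)"
      "t \<cdot>\<^bsub>arrow_category C\<^esub> Ide (arrow_category C) (Dom (arrow_category C) t) = t"
      "Ide (arrow_category C) (Cod (arrow_category C) t) \<cdot>\<^bsub>arrow_category C\<^esub> t = t"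
      using t'(2-5) by (simp_all add: t'(1) arrow_category_def)
    fix s assume s: "s \<in> Arr (arrow_category C)"
    obtain q g e q' where s': "s = (q, (g, e), q')" "q \<in> Arr C" "q' \<in> Arr C" "g \<in> hom C (Dom C q) (Dom C q')"
      "e \<in> hom C (Cod C q) (Cod C q')" "q' \<cdot> g = e \<cdot> q" using arr[OF s] by blast
    show "s \<cdot>\<^bsub>arrow_category C\<^esub> t \<in> hom (arrow_category C) (Dom (arrow_category C) t) (Cod (arrow_category C) s)"
      if "Dom (arrow_category C) s = Cod (arrow_category C) t"
    proof -
      have q: "q = p'" using that by (simp add: t'(1) s'(1) arrow_category_def)
      have "q' \<cdot> (g \<cdot> f) = (e \<cdot> b) \<cdot> p"
        by (rule square[OF t'(2,3) s'(3) t'(4,5) s'(4,5)[unfolded q] t'(6) s'(6)[unfolded q]])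
      then show ?thesis using t'(2-5) s'(2-5) q by (simp add: t'(1) s'(1) arrow_category_def)
    qed
    fix r assume r: "r \<in> Arr (arrow_category C)"
      and st: "Dom (arrow_category C) s = Cod (arrow_category C) t \<and> Dom (arrow_category C) r = Cod (arrow_category C) s"
    obtain m h a m' where r': "r = (m, (h, a), m')" "h \<in> hom C (Dom C m) (Dom C m')" "a \<in> hom C (Cod C m) (Cod C m')"
      using arr[OF r] by blast
    show "(r \<cdot>\<^bsub>arrow_category C\<^esub> s) \<cdot>\<^bsub>arrow_category C\<^esub> t = r \<cdot>\<^bsub>arrow_category C\<^esub> (s \<cdot>\<^bsub>arrow_category C\<^esub> t)"
    proof -
      have "q = p'" "m = q'" using st by (simp_all add: t'(1) s'(1) r'(1) arrow_category_def)
      then show ?thesis using t'(4,5) s'(4,5) r'(2,3) by (simp add: t'(1) s'(1) r'(1) arrow_category_def)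
    qed
  qed
qed

lemma category_full_subcategory:
  assumes "category C"
  shows "category (full_subcategory C S)"
  using assms unfolding category_def full_subcategory_def by simp

end

context admissible_galois_structure
begin

lemma Obj_NExt: "p \<in> Obj (NExt \<Gamma>) \<longleftrightarrow> normal_extension \<Gamma> p"
  using normal_extension_arr by (auto simp: NExt_def full_subcategory_def arrow_category_def)

lemma Arr_NExt: "(p, (f, b), p') \<in> Arr (NExt \<Gamma>) \<longleftrightarrow>
    normal_extension \<Gamma> p \<and> normal_extension \<Gamma> p' \<and>
    f \<in> hom C (Dom C p) (Dom C p') \<and> b \<in> hom C (Cod C p) (Cod C p') \<and> p' \<cdot> f = b \<cdot> p"
  using normal_extension_arr by (auto simp: NExt_def full_subcategory_def arrow_category_def)

lemma NExt_simps:
  "Dom (NExt \<Gamma>) (p, t, p') = p" "Cod (NExt \<Gamma>) (p, t, p') = p'"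
  "Ide (NExt \<Gamma>) p = (p, (Ide C (Dom C p), Ide C (Cod C p)), p)"
  "(q, (f', b'), q') \<cdot>\<^bsub>NExt \<Gamma>\<^esub> (p, (f, b), p') = (p, (f' \<cdot> f, b' \<cdot> b), q')"
  by (simp_all add: NExt_def full_subcategory_def arrow_category_def)

lemma category_NExt: "category (NExt \<Gamma>)"
proof -
  interpret A: small_category "arrow_category C" by unfold_locales (rule category_arrow_category)
  show ?thesis unfolding NExt_def Gamma by (rule A.category_full_subcategory[OF A.category])
qed

definition galois_map :: "'m \<Rightarrow> 'm \<Rightarrow> 'm \<Rightarrow> 'm" where
  "galois_map p f p' = factor X (incl p')
     (Ia (pair p' (f \<cdot> d p) (f \<cdot> c p)) \<cdot>\<^bsub>X\<^esub> incl p)"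

lemma Gal_simps:
  "on_obj (Gal \<Gamma>) p = galois_group \<Gamma> p"
  "on_arr (Gal \<Gamma>) (p, (f, b), p') = (galois_group \<Gamma> p, galois_map p f p', galois_group \<Gamma> p')"
  by (simp_all add: Gal_def galois_map_def Let_def)

context
  fixes p f b p'
  assumes fb: "(p, (f, b), p') \<in> Arr (NExt \<Gamma>)"
begin

lemma morphism:
  shows "normal_extension \<Gamma> p" and "normal_extension \<Gamma> p'" and "f \<in> Arr C" and "Dom C f = Dom C p"
    and "Cod C f = Dom C p'" and "b \<in> Arr C" and "Dom C b = Cod C p" and "Cod C b = Cod C p'"
    and "p' \<cdot> f = b \<cdot> p" and "p \<in> Arr C" and "p' \<in> Arr C"
  using fb normal_extension_arr unfolding Arr_NExt by auto

abbreviation (input) "\<phi> \<equiv> Ia (pair p' (f \<cdot> d p) (f \<cdot> c p))"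

lemma related_map:
  assumes "related p e e'"
  shows "related p' (f \<cdot> e) (f \<cdot> e')"
proof -
  note r = assms[unfolded related_def]
  have "p' \<cdot> (f \<cdot> e) = b \<cdot> (p \<cdot> e)" "p' \<cdot> (f \<cdot> e') = b \<cdot> (p \<cdot> e')"
    by (rule comp_swap_left[OF morphism(9)]; use morphism r in simp)+
  then show ?thesis using r morphism(3-5) by (simp add: related_def)
qed

lemma map_galois_arr:
  assumes r: "related p e e'"
  shows "\<phi> \<cdot> galois_arr p e e' = galois_arr p' (f \<cdot> e) (f \<cdot> e')"
proof -
  note M = morphism and kp = kp_arr[OF morphism(1)] and pr = pair[OF morphism(1) r]
  have R: "R p \<in> Obj C" using kp by simp
  have "related p (d p) (c p)" using related_projections[OF M(1), of "Ide C (R p)"] R kp by simp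
  note q = pair[OF M(2) related_map[OF this]]
  let ?q = "pair p' (f \<cdot> d p) (f \<cdot> c p)"
  have "pair p' (f \<cdot> e) (f \<cdot> e') = ?q \<cdot> pair p e e'"
  proof (rule pair_unique[OF M(2)])
    have "d p' \<cdot> (?q \<cdot> pair p e e') = (f \<cdot> d p) \<cdot> pair p e e'"
      by (rule comp_cong_left[OF q(4)]) (use q pr kp kp_arr[OF M(2)] M(3-5) in simp_all)
    also have "\<dots> = f \<cdot> (d p \<cdot> pair p e e')" by (rule assoc) (use pr kp M(3-5) in simp_all)
    finally show "d p' \<cdot> (?q \<cdot> pair p e e') = f \<cdot> e" unfolding pr .
    have "c p' \<cdot> (?q \<cdot> pair p e e') = (f \<cdot> c p) \<cdot> pair p e e'"
      by (rule comp_cong_left[OF q(5)]) (use q pr kp kp_arr[OF M(2)] M(3-5) in simp_all)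
    also have "\<dots> = f \<cdot> (c p \<cdot> pair p e e')" by (rule assoc) (use pr kp M(3-5) in simp_all)
    finally show "c p' \<cdot> (?q \<cdot> pair p e e') = f \<cdot> e'" unfolding pr .
  qed (use q pr kp M(3-5) in simp_all)
  then have "galois_arr p' (f \<cdot> e) (f \<cdot> e') = \<eta> (R p') \<cdot> (?q \<cdot> pair p e e')" by (simp add: galois_arr_def)
  also have "\<dots> = \<phi> \<cdot> (\<eta> (R p) \<cdot> pair p e e')"
    by (rule comp_swap_left) (use eta_natural[of ?q] q pr kp kp_arr[OF M(2)] M(3-5) R in simp_all)
  finally show ?thesis by (simp add: galois_arr_def)
qed

lemma phi_arr: "\<phi> \<in> Arr C" "Dom C \<phi> = Io (R p)" "Cod C \<phi> = Io (R p')"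
proof -
  note M = morphism and kp = kp_arr[OF morphism(1)]
  have R: "R p \<in> Obj C" using kp by simp
  have "related p (d p) (c p)" using related_projections[OF M(1), of "Ide C (R p)"] R kp by simp
  note q = pair[OF M(2) related_map[OF this]]
  show "\<phi> \<in> Arr C" "Dom C \<phi> = Io (R p)" "Cod C \<phi> = Io (R p')" using q M(3-5) kp by simp_all
qed

lemma eta_map:
  assumes "n \<in> Arr C" and "Cod C n = Dom C p" and "\<eta> (Dom C p) \<cdot> n = zero_arr C T (Io (Dom C p))"
    and "T \<in> Obj C"
  shows "\<eta> (Dom C p') \<cdot> (f \<cdot> n) = zero_arr C T (Io (Dom C p'))"
proof -
  note M = morphism(3-5,10,11)
  have "\<eta> (Dom C p') \<cdot> (f \<cdot> n) = Ia f \<cdot> (\<eta> (Dom C p) \<cdot> n)"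
    by (rule comp_swap_left) (use eta_natural[of f] M assms(1,2) in simp_all)
  then show ?thesis unfolding assms(3) using M assms(4) by simp
qed

lemma map_automorphism_of_0:
  assumes a: "automorphism_of_0 p a"
  shows "automorphism_of_0 p' (\<phi> \<cdot> a)"
proof -
  note M = morphism(3-5,10,11)
  have ob: "Dom C a \<in> Obj C" "Dom C a \<in> Obj X" "Dom C p \<in> Obj C" using a M by (simp_all add: automorphism_of_0_def)
  let ?o = "zero_arr C (Dom C a) (Dom C p)"
  obtain n where n: "related p n ?o" "a = galois_arr p n ?o" "Dom C n = Dom C a"
    "\<eta> (Dom C p) \<cdot> n = zero_arr C (Dom C a) (Io (Dom C p))"
    using automorphism_of_0_lift_zero[OF morphism(1) a] .
  have n': "n \<in> Arr C" "Cod C n = Dom C p" using n(1) by (simp_all add: related_def)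
  have "\<phi> \<cdot> a = galois_arr p' (f \<cdot> n) (f \<cdot> ?o)" using map_galois_arr[OF n(1)] n(2) by simp
  moreover have "automorphism_of_0 p' (galois_arr p' (f \<cdot> n) (f \<cdot> ?o))"
    by (rule automorphism_of_0_galois_arr[OF morphism(2) related_map[OF n(1)]])
      (use eta_map[OF n' n(4) ob(1)] n' n(3) M ob in simp_all)
  ultimately show ?thesis by simp
qed

lemma map_galois_comp:
  assumes x: "automorphism_of_0 p x" and y: "automorphism_of_0 p y" and xy: "Dom C y = Dom C x"
  shows "\<phi> \<cdot> galois_comp p x y = galois_comp p' (\<phi> \<cdot> x) (\<phi> \<cdot> y)"
proof -
  note M = morphism
  let ?o = "zero_arr C (Dom C y) (Dom C p)"
  obtain m where m: "related p m ?o" "y = galois_arr p m ?o" "Dom C m = Dom C y"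
    "\<eta> (Dom C p) \<cdot> m = zero_arr C (Dom C y) (Io (Dom C p))"
    using automorphism_of_0_lift_zero[OF M(1) y] .
  have m': "m \<in> Arr C" "Dom C m = Dom C x" "Cod C m = Dom C p"
    "\<eta> (Dom C p) \<cdot> m = zero_arr C (Dom C x) (Io (Dom C p))"
    using m xy by (simp_all add: related_def)
  obtain n where n: "related p n m" "x = galois_arr p n m"
    using automorphism_of_0_lift[OF M(1) x m'] .
  have "galois_comp p x y = galois_arr p n ?o"
    using galois_comp_galois_arr[OF M(1) n(1) m(1)] m(2) n(2) by simp
  then have "\<phi> \<cdot> galois_comp p x y = galois_arr p' (f \<cdot> n) (f \<cdot> ?o)"
    using map_galois_arr[OF related_trans[OF M(1) n(1) m(1)]] by simp
  moreover have "\<phi> \<cdot> x = galois_arr p' (f \<cdot> n) (f \<cdot> m)" "\<phi> \<cdot> y = galois_arr p' (f \<cdot> m) (f \<cdot> ?o)"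
    using map_galois_arr[OF n(1)] map_galois_arr[OF m(1)] n(2) m(2) by simp_all
  ultimately show ?thesis
    using galois_comp_galois_arr[OF M(2) related_map[OF n(1)] related_map[OF m(1)]] by simp
qed

lemma galois_map:
  shows "galois_map p f p' \<in> Arr C" and "Dom C (galois_map p f p') = K p"
    and "Cod C (galois_map p f p') = K p'" and "incl p' \<cdot> galois_map p f p' = \<phi> \<cdot> incl p"
proof -
  note M = morphism and i = incl(1-4)[OF morphism(1)]
  have R: "R p \<in> Obj C" "R p' \<in> Obj C" using kp_arr[OF M(1)] kp_arr[OF M(2)] by simp_all
  have "\<phi> \<cdot>\<^bsub>X\<^esub> incl p = \<phi> \<cdot> incl p" using phi_arr i R by simp
  then have g: "galois_map p f p' = factor X (incl p') (\<phi> \<cdot> incl p)" by (simp add: galois_map_def)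
  show "galois_map p f p' \<in> Arr C" and "Dom C (galois_map p f p') = K p"
    and "Cod C (galois_map p f p') = K p'" and "incl p' \<cdot> galois_map p f p' = \<phi> \<cdot> incl p"
    unfolding g using factor_incl[OF M(2) map_automorphism_of_0[OF i(4)]] phi_arr i by simp_all
qed

text \<open>
  With \<open>x\<close> an identity this describes \<open>galois_map p f p'\<close> completely: \<open>incl p\<close> is the generic
  automorphism of \<open>0\<close>, represented by some \<open>(n, 0)\<close>, and is sent to the arrow represented by
  \<open>(f n, f 0)\<close>.
\<close>

lemma galois_map_elements:
  assumes x: "x \<in> Arr C" "Cod C x = K p" and n: "related p n m" "incl p \<cdot> x = galois_arr p n m"
  shows "incl p' \<cdot> (galois_map p f p' \<cdot> x) = galois_arr p' (f \<cdot> n) (f \<cdot> m)"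
proof -
  note i = incl(1-4)[OF morphism(1)] incl(1-4)[OF morphism(2)]
  have "incl p' \<cdot> (galois_map p f p' \<cdot> x) = \<phi> \<cdot> (incl p \<cdot> x)"
    by (rule comp_swap_left[OF galois_map(4)]) (use galois_map phi_arr i x in simp_all)
  then show ?thesis unfolding n(2) map_galois_arr[OF n(1)] .
qed

lemma int_group_hom_galois_map:
  "int_group_hom X (galois_group \<Gamma> p) (galois_group \<Gamma> p') (galois_map p f p')"
proof -
  note M = morphism and g = galois_map
  note m = gp_mult[OF M(1)] and m' = gp_mult[OF M(2)] and Pa = P_arr[OF M(1)] and Pa' = P_arr[OF M(2)]
  note i = incl(1-4)[OF M(1)] and i' = incl(1-4)[OF M(2)] and K = K_obj[OF M(1)] K_obj[OF M(2)]
  let ?g = "galois_map p f p'" and ?m = "gp_mult (galois_group \<Gamma> p)"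
  let ?a = "?g \<cdot> fst (P p)" and ?b = "?g \<cdot> snd (P p)"
  have ab: "?a \<in> Arr C" "?b \<in> Arr C" "Dom C ?b = Dom C ?a" "Dom C ?a \<in> Obj X" "Cod C ?a = K p'" "Cod C ?b = K p'"
    using g Pa by simp_all
  note gm = galois_mult[OF M(2) ab]
  have null: "automorphism_of_0 p (incl p \<cdot> fst (P p))" "automorphism_of_0 p (incl p \<cdot> snd (P p))"
    by (rule incl_comp[OF M(1)]; use Pa in simp)+
  have "incl p' \<cdot> (?g \<cdot> ?m) = \<phi> \<cdot> (incl p \<cdot> ?m)"
    by (rule comp_swap_left[OF g(4)]) (use g phi_arr i i' m in simp_all)
  also have "\<dots> = galois_comp p' (\<phi> \<cdot> (incl p \<cdot> fst (P p))) (\<phi> \<cdot> (incl p \<cdot> snd (P p)))"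
    unfolding m(4) by (rule map_galois_comp[OF null]) (use i Pa in simp_all)
  also have "\<phi> \<cdot> (incl p \<cdot> fst (P p)) = incl p' \<cdot> ?a"
    by (rule comp_swap_left[OF g(4)[symmetric]]) (use g phi_arr i i' Pa in simp_all)
  also have "\<phi> \<cdot> (incl p \<cdot> snd (P p)) = incl p' \<cdot> ?b"
    by (rule comp_swap_left[OF g(4)[symmetric]]) (use g phi_arr i i' Pa in simp_all)
  also have "galois_comp p' (incl p' \<cdot> ?a) (incl p' \<cdot> ?b) = incl p' \<cdot> galois_mult p' ?a ?b"
    by (rule gm(4)[symmetric])
  finally have eq: "incl p' \<cdot> (?g \<cdot> ?m) = incl p' \<cdot> galois_mult p' ?a ?b" .
  have gmm: "?g \<cdot> ?m = galois_mult p' ?a ?b"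
    by (rule incl(6)[OF M(2) _ gm(1) _ _ _ gm(3) eq]) (use g m gm(2) Pa in simp_all)
  have X: "?g \<cdot>\<^bsub>X\<^esub> fst (P p) = ?a" "?g \<cdot>\<^bsub>X\<^esub> snd (P p) = ?b" "?g \<cdot>\<^bsub>X\<^esub> ?m = ?g \<cdot> ?m"
    using g Pa m K by simp_all
  have "?g \<in> hom X (K p) (K p')" using g K by simp
  then show ?thesis
    unfolding int_group_hom_def Let_def galois_group_simps(1)[OF M(1)] galois_group_simps(1)[OF M(2)] X
      galois_mult_def[symmetric] using gmm by blast
qed

end

text \<open>
  Two morphisms \<open>f\<close>, \<open>f'\<close> over the same \<open>b\<close> induce functors of Galois groupoids that are related by the
  natural transformation \<open>\<eta> (f, f')\<close>. At \<open>0\<close> this transformation is the identity, so that both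
  functors agree on automorphisms of \<open>0\<close>.
\<close>

lemma galois_map_eq:
  assumes fb: "(p, (f, b), p') \<in> Arr (NExt \<Gamma>)" and fb': "(p, (f', b), p') \<in> Arr (NExt \<Gamma>)"
  shows "galois_map p f p' = galois_map p f' p'"
proof -
  note M = morphism[OF fb] and M' = morphism[OF fb']
  note i = incl(1-4)[OF M(1)] and i' = incl(1-4)[OF M(2)] and K = K_obj[OF M(1)]
  let ?o = "zero_arr C (K p) (Dom C p)" and ?o' = "zero_arr C (K p) (Dom C p')"
  have ob: "Dom C p \<in> Obj C" "Dom C p' \<in> Obj C" using M by simp_all
  obtain n where n: "related p n ?o" "incl p = galois_arr p n ?o" "Dom C n = K p"
    "\<eta> (Dom C p) \<cdot> n = zero_arr C (K p) (Io (Dom C p))"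
    using automorphism_of_0_lift_zero[OF M(1) i(4)] .
  have n': "n \<in> Arr C" "Cod C n = Dom C p" using n(1) by (simp_all add: related_def)
  have fo: "f \<cdot> ?o = ?o'" "f' \<cdot> ?o = ?o'" using M M' K by simp_all
  have inn: "incl p \<cdot> Ide C (K p) = galois_arr p n ?o" using n(2) i by simp
  have g: "incl p' \<cdot> galois_map p f p' = galois_arr p' (f \<cdot> n) ?o'"
    using galois_map_elements[OF fb _ _ n(1) inn] K galois_map[OF fb] fo by simp
  have g': "incl p' \<cdot> galois_map p f' p' = galois_arr p' (f' \<cdot> n) ?o'"
    using galois_map_elements[OF fb' _ _ n(1) inn] K galois_map[OF fb'] fo by simp
  have rff: "related p' f f'" using M M' by (simp add: related_def)
  note pr = pair[OF M(2) rff]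
  have r: "related p' (f \<cdot> n) (f' \<cdot> n)" and r': "related p' (f' \<cdot> n) ?o'"
  proof -
    have "p' \<cdot> (f \<cdot> n) = p' \<cdot> (f' \<cdot> n)"
      by (rule comp_swap_left) (use M(3-5,9,11) M'(3-5,9) n' in simp_all)
    then show "related p' (f \<cdot> n) (f' \<cdot> n)" using M(3-5) M'(3-5) n' by (simp add: related_def)
    show "related p' (f' \<cdot> n) ?o'" using related_map[OF fb' n(1)] fo by simp
  qed
  have R: "R p' \<in> Obj C" using kp_arr[OF M(2)] by simp
  have "galois_arr p' (f \<cdot> n) (f' \<cdot> n) = galois_arr p' f f' \<cdot> n"
    by (rule galois_arr_comp[OF M(2) rff, symmetric]) (use n' M in simp_all)
  also have "\<dots> = \<eta> (R p') \<cdot> (pair p' f f' \<cdot> n)" using pr n' M(3-5) R by (simp add: galois_arr_def)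
  also have "\<dots> = Ia (pair p' f f') \<cdot> (\<eta> (Dom C p) \<cdot> n)"
    by (rule comp_swap_left) (use eta_natural[of "pair p' f f'"] pr M(3-5) ob R n' in simp_all)
  also have "\<dots> = zero_arr C (K p) (Io (R p'))" unfolding n(4) using pr M(3-5) ob K by simp
  finally have z: "galois_arr p' (f \<cdot> n) (f' \<cdot> n) = zero_arr C (K p) (Io (R p'))" .
  have null: "automorphism_of_0 p' (galois_arr p' (f' \<cdot> n) ?o')"
    unfolding g'[symmetric] by (rule incl_comp[OF M(2)]) (use galois_map[OF fb'] K in simp_all)
  \<comment> \<open>composing the identity at \<open>0\<close>, represented by \<open>(f n, f' n)\<close>, with \<open>(f' n, 0)\<close> gives \<open>(f n, 0)\<close>\<close>
  have "galois_arr p' (f \<cdot> n) ?o' = galois_comp p' (zero_arr C (K p) (Io (R p'))) (galois_arr p' (f' \<cdot> n) ?o')"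
    unfolding z[symmetric] by (rule galois_comp_galois_arr[OF M(2) r r', symmetric])
  also have "\<dots> = galois_arr p' (f' \<cdot> n) ?o'"
    using galois_comp_zero(1)[OF M(2) null] galois_arr(2)[OF M(2) r'] n' n(3) M'(3-5) by simp
  finally have eq: "incl p' \<cdot> galois_map p f p' = incl p' \<cdot> galois_map p f' p'" unfolding g g' .
  show ?thesis
    by (rule incl(6)[OF M(2) _ _ _ _ _ _ eq]) (use galois_map[OF fb] galois_map[OF fb'] K in simp_all)
qed

lemma galois_map_ide:
  assumes p: "normal_extension \<Gamma> p"
  shows "galois_map p (Ide C (Dom C p)) p = Ide C (K p)"
proof -
  let ?i = "Ide C (Dom C p)" and ?o = "zero_arr C (K p) (Dom C p)"
  note pa = normal_extension_arr[OF p] and i = incl(1-4)[OF p] and K = K_obj[OF p]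
  have fb: "(p, (?i, Ide C (Cod C p)), p) \<in> Arr (NExt \<Gamma>)" using p pa by (simp add: Arr_NExt)
  obtain n where n: "related p n ?o" "incl p = galois_arr p n ?o"
    using automorphism_of_0_lift_zero[OF p i(4)] .
  have n': "?i \<cdot> n = n" "?i \<cdot> ?o = ?o" using n(1) pa K by (simp_all add: related_def)
  have inn: "incl p \<cdot> Ide C (K p) = galois_arr p n ?o" using n(2) i by simp
  have eq: "incl p \<cdot> galois_map p ?i p = incl p \<cdot> Ide C (K p)"
    using galois_map_elements[OF fb _ _ n(1) inn] K galois_map[OF fb] n' inn by simp
  show ?thesis
    by (rule incl(6)[OF p _ _ _ _ _ _ eq]) (use galois_map[OF fb] K in simp_all)
qed

lemma galois_map_comp:
  assumes fb: "(p, (f, b), p') \<in> Arr (NExt \<Gamma>)" and fb': "(p', (f', b'), p'') \<in> Arr (NExt \<Gamma>)"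
    and fb'': "(p, (f' \<cdot> f, b''), p'') \<in> Arr (NExt \<Gamma>)"
  shows "galois_map p (f' \<cdot> f) p'' = galois_map p' f' p'' \<cdot> galois_map p f p'"
proof -
  note M = morphism[OF fb] and M' = morphism[OF fb'] and g = galois_map[OF fb] and g' = galois_map[OF fb']
    and g'' = galois_map[OF fb'']
  let ?o = "zero_arr C (K p) (Dom C p)"
  note i = incl(1-4)[OF M(1)] and K = K_obj[OF M(1)]
  obtain n where n: "related p n ?o" "incl p = galois_arr p n ?o"
    using automorphism_of_0_lift_zero[OF M(1) i(4)] .
  have n': "n \<in> Arr C" "Cod C n = Dom C p" using n(1) by (simp_all add: related_def)
  have inn: "incl p \<cdot> Ide C (K p) = galois_arr p n ?o" using n(2) i by simp
  have e: "incl p' \<cdot> galois_map p f p' = galois_arr p' (f \<cdot> n) (f \<cdot> ?o)"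
    using galois_map_elements[OF fb _ _ n(1) inn] K g by simp
  have "incl p'' \<cdot> (galois_map p' f' p'' \<cdot> galois_map p f p') = galois_arr p'' (f' \<cdot> (f \<cdot> n)) (f' \<cdot> (f \<cdot> ?o))"
    by (rule galois_map_elements[OF fb' _ _ related_map[OF fb n(1)] e]) (use g in simp_all)
  moreover have "incl p'' \<cdot> galois_map p (f' \<cdot> f) p'' = galois_arr p'' ((f' \<cdot> f) \<cdot> n) ((f' \<cdot> f) \<cdot> ?o)"
    using galois_map_elements[OF fb'' _ _ n(1) inn] K g'' by simp
  moreover have "(f' \<cdot> f) \<cdot> n = f' \<cdot> (f \<cdot> n)" "(f' \<cdot> f) \<cdot> ?o = f' \<cdot> (f \<cdot> ?o)"
    using n' M(3-5,10) M'(3-5) K by simp_all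
  ultimately have eq: "incl p'' \<cdot> galois_map p (f' \<cdot> f) p'' = incl p'' \<cdot> (galois_map p' f' p'' \<cdot> galois_map p f p')"
    by simp
  show ?thesis
    by (rule incl(6)[OF M'(2) _ _ _ _ _ _ eq]) (use g g' g'' K in simp_all)
qed

lemma functor_Gal: "is_functor (NExt \<Gamma>) (Gp X) (Gal \<Gamma>)"
  unfolding is_functor_def
proof (intro conjI ballI impI)
  show "category (NExt \<Gamma>)" by (rule category_NExt)
  show "category (Gp X)" by (rule X.category_Gp[OF product_X])
next
  fix p assume "p \<in> Obj (NExt \<Gamma>)"
  then have p: "normal_extension \<Gamma> p" unfolding Obj_NExt .
  show "on_obj (Gal \<Gamma>) p \<in> Obj (Gp X)"
    using is_int_group_galois_group[OF p] by (simp add: Gal_simps Gp_def)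
  show "on_arr (Gal \<Gamma>) (Ide (NExt \<Gamma>) p) = Ide (Gp X) (on_obj (Gal \<Gamma>) p)"
    using galois_map_ide[OF p] galois_group_simps(1)[OF p] K_obj[OF p]
    by (simp add: NExt_simps Gal_simps Gp_def)
next
  fix t assume t: "t \<in> Arr (NExt \<Gamma>)"
  obtain p f b p' where tt: "t = (p, (f, b), p')" by (metis prod.exhaust)
  note fb = t[unfolded tt] and M = morphism[OF t[unfolded tt]]
  show "on_arr (Gal \<Gamma>) t \<in> hom (Gp X) (on_obj (Gal \<Gamma>) (Dom (NExt \<Gamma>) t)) (on_obj (Gal \<Gamma>) (Cod (NExt \<Gamma>) t))"
    using is_int_group_galois_group[OF M(1)] is_int_group_galois_group[OF M(2)] int_group_hom_galois_map[OF fb]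
    by (simp add: tt NExt_simps Gal_simps Gp_def)
  fix t' assume t': "t' \<in> Arr (NExt \<Gamma>)" "Dom (NExt \<Gamma>) t' = Cod (NExt \<Gamma>) t"
  obtain q f' b' p'' where tt': "t' = (q, (f', b'), p'')" by (metis prod.exhaust)
  have q: "q = p'" using t'(2) by (simp add: tt tt' NExt_simps)
  have fb': "(p', (f', b'), p'') \<in> Arr (NExt \<Gamma>)" using t'(1) tt' q by simp
  interpret N: small_category "NExt \<Gamma>" by unfold_locales (rule category_NExt)
  have "t' \<cdot>\<^bsub>NExt \<Gamma>\<^esub> t \<in> Arr (NExt \<Gamma>)" using t t' by simp
  then have fb'': "(p, (f' \<cdot> f, b' \<cdot> b), p'') \<in> Arr (NExt \<Gamma>)" by (simp add: tt tt' NExt_simps)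
  show "on_arr (Gal \<Gamma>) (t' \<cdot>\<^bsub>NExt \<Gamma>\<^esub> t) = on_arr (Gal \<Gamma>) t' \<cdot>\<^bsub>Gp X\<^esub> on_arr (Gal \<Gamma>) t"
    using galois_map_comp[OF fb fb' fb''] galois_map[OF fb] galois_map[OF fb'] K_obj[OF M(1)]
      K_obj[OF M(2)] K_obj[OF morphism(2)[OF fb']]
    by (simp add: tt tt' q NExt_simps Gal_simps Gp_def)
qed

lemma functor_CodF: "is_functor (NExt \<Gamma>) C (CodF \<Gamma>)"
  unfolding is_functor_def
proof (intro conjI ballI impI)
  show "category (NExt \<Gamma>)" by (rule category_NExt)
  show "category C" by (rule category)
next
  fix p assume "p \<in> Obj (NExt \<Gamma>)"
  then have p: "p \<in> Arr C" unfolding Obj_NExt by (rule normal_extension_arr)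
  show "on_obj (CodF \<Gamma>) p \<in> Obj C" using p by (simp add: CodF_def)
  show "on_arr (CodF \<Gamma>) (Ide (NExt \<Gamma>) p) = Ide C (on_obj (CodF \<Gamma>) p)"
    by (simp add: CodF_def NExt_simps)
next
  fix t assume t: "t \<in> Arr (NExt \<Gamma>)"
  obtain p f b p' where tt: "t = (p, (f, b), p')" by (metis prod.exhaust)
  note M = morphism[OF t[unfolded tt]]
  show "on_arr (CodF \<Gamma>) t \<in> hom C (on_obj (CodF \<Gamma>) (Dom (NExt \<Gamma>) t)) (on_obj (CodF \<Gamma>) (Cod (NExt \<Gamma>) t))"
    using M by (simp add: tt CodF_def NExt_simps)
  fix t' assume "t' \<in> Arr (NExt \<Gamma>)"
  obtain q f' b' p'' where tt': "t' = (q, (f', b'), p'')" by (metis prod.exhaust)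
  show "on_arr (CodF \<Gamma>) (t' \<cdot>\<^bsub>NExt \<Gamma>\<^esub> t) = on_arr (CodF \<Gamma>) t' \<cdot> on_arr (CodF \<Gamma>) t"
    by (simp add: tt tt' CodF_def NExt_simps)
qed

end

section \<open>Right Kan extensions from weakly initial lifts\<close>

text \<open>
  The object \<open>u c\<close>, with the identity of \<open>c\<close>, is weakly initial in the comma category of \<open>c\<close> over \<open>K\<close>,
  by composing the lift of \<open>c \<rightarrow> K a\<close> to \<open>u c \<rightarrow> u (K a)\<close> with the one of the identity of \<open>K a\<close>. As \<open>G\<close>
  identifies any two arrows of \<open>A\<close> lifting the same arrow, its limit over the comma category is \<open>G (u c)\<close>.
\<close>

lemma right_kan_extension_from_lifts:
  assumes K: "is_functor A C K" and G: "is_functor A D G"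
    and same: "\<And>s t. \<lbrakk>s \<in> Arr A; t \<in> Arr A; Dom A s = Dom A t; Cod A s = Cod A t; on_arr K s = on_arr K t\<rbrakk>
      \<Longrightarrow> on_arr G s = on_arr G t"
    and u: "\<And>c. c \<in> Obj C \<Longrightarrow> u c \<in> Obj A \<and> on_obj K (u c) = c"
    and R_obj: "\<And>c. c \<in> Obj C \<Longrightarrow> on_obj R c = on_obj G (u c)"
    and R_arr: "\<And>f. f \<in> Arr C \<Longrightarrow> \<exists>s \<in> hom A (u (Dom C f)) (u (Cod C f)). on_arr K s = f \<and> on_arr R f = on_arr G s"
    and kap: "\<And>a. a \<in> Obj A \<Longrightarrow> \<exists>s \<in> hom A (u (on_obj K a)) a. on_arr K s = Ide C (on_obj K a) \<and> \<kappa> a = on_arr G s"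
  shows "right_kan_extension A C D K G R \<kappa>"
proof -
  interpret A: small_category A using K by unfold_locales (simp add: is_functor_def)
  interpret C: small_category C using K by unfold_locales (simp add: is_functor_def)
  interpret D: small_category D using G by unfold_locales (simp add: is_functor_def)
  have K_simps: "\<And>a. a \<in> Obj A \<Longrightarrow> on_obj K a \<in> Obj C"
    "\<And>t. t \<in> Arr A \<Longrightarrow> on_arr K t \<in> Arr C" "\<And>t. t \<in> Arr A \<Longrightarrow> Dom C (on_arr K t) = on_obj K (Dom A t)"
    "\<And>t. t \<in> Arr A \<Longrightarrow> Cod C (on_arr K t) = on_obj K (Cod A t)"
    "\<And>a. a \<in> Obj A \<Longrightarrow> on_arr K (Ide A a) = Ide C (on_obj K a)"
    "\<And>s t. \<lbrakk>t \<in> Arr A; s \<in> Arr A; Dom A s = Cod A t\<rbrakk> \<Longrightarrow> on_arr K (s \<cdot>\<^bsub>A\<^esub> t) = on_arr K s \<cdot>\<^bsub>C\<^esub> on_arr K t"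
    using K unfolding is_functor_def by simp_all
  have G_simps: "\<And>a. a \<in> Obj A \<Longrightarrow> on_obj G a \<in> Obj D"
    "\<And>t. t \<in> Arr A \<Longrightarrow> on_arr G t \<in> Arr D" "\<And>t. t \<in> Arr A \<Longrightarrow> Dom D (on_arr G t) = on_obj G (Dom A t)"
    "\<And>t. t \<in> Arr A \<Longrightarrow> Cod D (on_arr G t) = on_obj G (Cod A t)"
    "\<And>a. a \<in> Obj A \<Longrightarrow> on_arr G (Ide A a) = Ide D (on_obj G a)"
    "\<And>s t. \<lbrakk>t \<in> Arr A; s \<in> Arr A; Dom A s = Cod A t\<rbrakk> \<Longrightarrow> on_arr G (s \<cdot>\<^bsub>A\<^esub> t) = on_arr G s \<cdot>\<^bsub>D\<^esub> on_arr G t"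
    using G unfolding is_functor_def by simp_all
  have R: "is_functor C D R"
    unfolding is_functor_def
  proof (intro conjI ballI impI)
    show "category C" "category D" by (rule C.category D.category)+
  next
    fix c assume c: "c \<in> Obj C"
    show "on_obj R c \<in> Obj D" using R_obj[OF c] u[OF c] G_simps(1) by simp
    obtain s where s: "s \<in> hom A (u c) (u c)" "on_arr K s = Ide C c" "on_arr R (Ide C c) = on_arr G s"
      using R_arr[of "Ide C c"] c by auto
    have "on_arr G s = on_arr G (Ide A (u c))"
      by (rule same) (use s u[OF c] K_simps(5) in simp_all)
    then show "on_arr R (Ide C c) = Ide D (on_obj R c)"
      using s R_obj[OF c] u[OF c] G_simps(5) by simp
  next
    fix f assume f: "f \<in> Arr C"
    obtain s where s: "s \<in> hom A (u (Dom C f)) (u (Cod C f))" "on_arr K s = f" "on_arr R f = on_arr G s"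
      using R_arr[OF f] by blast
    show "on_arr R f \<in> hom D (on_obj R (Dom C f)) (on_obj R (Cod C f))"
      using s R_obj f G_simps(2-4)[of s] by simp
    fix g assume g: "g \<in> Arr C" "Dom C g = Cod C f"
    obtain t where t: "t \<in> hom A (u (Dom C g)) (u (Cod C g))" "on_arr K t = g" "on_arr R g = on_arr G t"
      using R_arr[OF g(1)] by blast
    have gf: "g \<cdot>\<^bsub>C\<^esub> f \<in> Arr C" "Dom C (g \<cdot>\<^bsub>C\<^esub> f) = Dom C f" "Cod C (g \<cdot>\<^bsub>C\<^esub> f) = Cod C g" using f g by simp_all
    obtain r where r: "r \<in> hom A (u (Dom C f)) (u (Cod C g))" "on_arr K r = g \<cdot>\<^bsub>C\<^esub> f" "on_arr R (g \<cdot>\<^bsub>C\<^esub> f) = on_arr G r"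
      using R_arr[OF gf(1)] unfolding gf by blast
    have "on_arr G r = on_arr G (t \<cdot>\<^bsub>A\<^esub> s)"
      by (rule same) (use r s t g K_simps(6)[of s t] in simp_all)
    also have "\<dots> = on_arr G t \<cdot>\<^bsub>D\<^esub> on_arr G s" by (rule G_simps(6)) (use s t g in simp_all)
    finally show "on_arr R (g \<cdot>\<^bsub>C\<^esub> f) = on_arr R g \<cdot>\<^bsub>D\<^esub> on_arr R f" unfolding r(3) s(3) t(3) .
  qed
  have RK: "is_functor A D (comp_func R K)"
    using R K A.category D.category unfolding is_functor_def comp_func_def by simp
  have nat: "nat_trans A D (comp_func R K) G \<kappa>"
    unfolding nat_trans_def
  proof (intro conjI ballI)
    fix a assume a: "a \<in> Obj A"
    obtain s where s: "s \<in> hom A (u (on_obj K a)) a" "\<kappa> a = on_arr G s" using kap[OF a] by blast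
    then show "\<kappa> a \<in> hom D (on_obj (comp_func R K) a) (on_obj G a)"
      using G_simps(2-4)[of s] R_obj[of "on_obj K a"] K_simps(1)[OF a] by (simp add: comp_func_def)
  next
    fix t assume t: "t \<in> Arr A"
    let ?a = "Dom A t" and ?b = "Cod A t"
    have ob: "?a \<in> Obj A" "?b \<in> Obj A" using t by simp_all
    obtain s where s: "s \<in> hom A (u (on_obj K ?a)) ?a" "on_arr K s = Ide C (on_obj K ?a)" "\<kappa> ?a = on_arr G s"
      using kap[OF ob(1)] by blast
    obtain s' where s': "s' \<in> hom A (u (on_obj K ?b)) ?b" "on_arr K s' = Ide C (on_obj K ?b)" "\<kappa> ?b = on_arr G s'"
      using kap[OF ob(2)] by blast
    obtain r where r: "r \<in> hom A (u (on_obj K ?a)) (u (on_obj K ?b))" "on_arr K r = on_arr K t"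
      "on_arr R (on_arr K t) = on_arr G r"
      using R_arr[of "on_arr K t"] K_simps(2-4)[OF t] by auto
    have "on_arr K (s' \<cdot>\<^bsub>A\<^esub> r) = on_arr K (t \<cdot>\<^bsub>A\<^esub> s)"
      using K_simps(6)[of r s'] K_simps(6)[of s t] K_simps(2-4)[OF t] r(1,2) s(1,2) s'(1,2) t by simp
    then have "on_arr G (s' \<cdot>\<^bsub>A\<^esub> r) = on_arr G (t \<cdot>\<^bsub>A\<^esub> s)"
      by (intro same) (use r(1) s(1) s'(1) t in simp_all)
    moreover have "on_arr G (s' \<cdot>\<^bsub>A\<^esub> r) = on_arr G s' \<cdot>\<^bsub>D\<^esub> on_arr G r"
      "on_arr G (t \<cdot>\<^bsub>A\<^esub> s) = on_arr G t \<cdot>\<^bsub>D\<^esub> on_arr G s"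
      by (rule G_simps(6); use r(1) s(1) s'(1) t in simp)+
    ultimately show "\<kappa> ?b \<cdot>\<^bsub>D\<^esub> on_arr (comp_func R K) t = on_arr G t \<cdot>\<^bsub>D\<^esub> \<kappa> ?a"
      using r(3) s(3) s'(3) by (simp add: comp_func_def)
  qed (fact RK G)+
  \<comment> \<open>\<open>\<alpha>\<close> is forced at \<open>c\<close> by the condition at \<open>u c\<close>, where \<open>\<kappa>\<close> is an identity\<close>
  have "\<exists>\<alpha>. nat_trans C D F R \<alpha> \<and> (\<forall>a \<in> Obj A. \<kappa> a \<cdot>\<^bsub>D\<^esub> \<alpha> (on_obj K a) = \<gamma> a) \<and>
      (\<forall>\<alpha>'. nat_trans C D F R \<alpha>' \<and> (\<forall>a \<in> Obj A. \<kappa> a \<cdot>\<^bsub>D\<^esub> \<alpha>' (on_obj K a) = \<gamma> a) \<longrightarrow>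
        (\<forall>c \<in> Obj C. \<alpha>' c = \<alpha> c))"
    if F: "is_functor C D F" and \<gamma>: "nat_trans A D (comp_func F K) G \<gamma>" for F \<gamma>
  proof (intro exI[of _ "\<lambda>c. \<gamma> (u c)"] conjI allI impI ballI)
    have \<gamma>_arr: "\<gamma> a \<in> Arr D" "Dom D (\<gamma> a) = on_obj F (on_obj K a)" "Cod D (\<gamma> a) = on_obj G a" if "a \<in> Obj A" for a
      using \<gamma> that unfolding nat_trans_def comp_func_def by simp_all
    have \<gamma>_nat: "\<gamma> (Cod A t) \<cdot>\<^bsub>D\<^esub> on_arr F (on_arr K t) = on_arr G t \<cdot>\<^bsub>D\<^esub> \<gamma> (Dom A t)" if "t \<in> Arr A" for t
      using \<gamma> that unfolding nat_trans_def comp_func_def by simp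
    show "nat_trans C D F R (\<lambda>c. \<gamma> (u c))"
      unfolding nat_trans_def
    proof (intro conjI ballI)
      show "\<gamma> (u c) \<in> hom D (on_obj F c) (on_obj R c)" if c: "c \<in> Obj C" for c
        using \<gamma>_arr[of "u c"] u[OF c] R_obj[OF c] by simp
      fix f assume f: "f \<in> Arr C"
      obtain s where s: "s \<in> hom A (u (Dom C f)) (u (Cod C f))" "on_arr K s = f" "on_arr R f = on_arr G s"
        using R_arr[OF f] by blast
      then show "\<gamma> (u (Cod C f)) \<cdot>\<^bsub>D\<^esub> on_arr F f = on_arr R f \<cdot>\<^bsub>D\<^esub> \<gamma> (u (Dom C f))"
        using \<gamma>_nat[of s] by simp
    qed (fact F R)+
    show "\<kappa> a \<cdot>\<^bsub>D\<^esub> \<gamma> (u (on_obj K a)) = \<gamma> a" if a: "a \<in> Obj A" for a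
    proof -
      obtain s where s: "s \<in> hom A (u (on_obj K a)) a" "on_arr K s = Ide C (on_obj K a)" "\<kappa> a = on_arr G s"
        using kap[OF a] by blast
      have "on_arr G s \<cdot>\<^bsub>D\<^esub> \<gamma> (u (on_obj K a)) = \<gamma> a \<cdot>\<^bsub>D\<^esub> on_arr F (Ide C (on_obj K a))"
        using \<gamma>_nat[of s] s by simp
      also have "on_arr F (Ide C (on_obj K a)) = Ide D (on_obj F (on_obj K a))"
        using F K_simps(1)[OF a] unfolding is_functor_def by simp
      finally show ?thesis using \<gamma>_arr[OF a] s(3) by simp
    qed
    fix \<alpha>' c
    assume \<alpha>': "nat_trans C D F R \<alpha>' \<and> (\<forall>a \<in> Obj A. \<kappa> a \<cdot>\<^bsub>D\<^esub> \<alpha>' (on_obj K a) = \<gamma> a)" and c: "c \<in> Obj C"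
    note uc = u[OF c]
    obtain s where s: "s \<in> hom A (u c) (u c)" "on_arr K s = Ide C c" "\<kappa> (u c) = on_arr G s"
      using kap[of "u c"] uc by auto
    have "on_arr G s = on_arr G (Ide A (u c))"
      by (rule same) (use s uc K_simps(5) in simp_all)
    then have "\<kappa> (u c) = Ide D (on_obj G (u c))" using s(3) uc G_simps(5) by simp
    moreover have "\<kappa> (u c) \<cdot>\<^bsub>D\<^esub> \<alpha>' c = \<gamma> (u c)" using \<alpha>' uc by metis
    moreover have "\<alpha>' c \<in> Arr D" "Cod D (\<alpha>' c) = on_obj G (u c)"
      using \<alpha>' c R_obj[OF c] unfolding nat_trans_def by simp_all
    ultimately show "\<alpha>' c = \<gamma> (u c)" by simp
  qed
  then show ?thesis
    unfolding right_kan_extension_def using K G R nat by blast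
qed

section \<open>The fundamental group functor\<close>

context admissible_galois_structure
begin

text \<open>
  The pullback of \<open>w\<close> along \<open>f\<close> is a normal extension of the domain of \<open>f\<close>, so \<open>v\<close> factors through it.
\<close>

lemma weakly_universal_lift:
  assumes v: "weakly_universal \<Gamma> (Dom C f) v" and w: "normal_extension \<Gamma> w" "Cod C w = Cod C f"
    and f: "f \<in> Arr C"
  obtains g where "(v, (g, f), w) \<in> Arr (NExt \<Gamma>)"
proof -
  have vn: "normal_extension \<Gamma> v" "Cod C v = Dom C f"
    and ex: "\<And>p. \<lbrakk>normal_extension \<Gamma> p; Cod C p = Dom C f\<rbrakk> \<Longrightarrow> \<exists>e \<in> hom C (Dom C v) (Dom C p). p \<cdot> e = v"
    using v unfolding weakly_universal_def Gamma by blast+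
  note wa = normal_extension_arr[OF w(1)] and va = normal_extension_arr[OF vn(1)]
  obtain h q where pb: "is_pullback C w f h q"
    using pullback_exists[OF finitely_complete wa f w(2)] .
  note sq = pullback_square[OF pb]
  obtain e where e: "e \<in> hom C (Dom C v) (Dom C q)" "q \<cdot> e = v"
    using ex[OF normal_extension_pullback[OF w(1) pb]] sq by blast
  have "w \<cdot> (h \<cdot> e) = f \<cdot> (q \<cdot> e)" by (rule comp_swap_left[OF sq(9)]) (use sq e(1) in simp_all)
  then have "(v, (h \<cdot> e, f), w) \<in> Arr (NExt \<Gamma>)"
    unfolding Arr_NExt e(2) using sq(1-8) e(1) vn w va f by simp
  then show thesis by (rule that)
qed

lemma pi1_kan_extension:
  assumes u: "\<And>B. B \<in> Obj C \<Longrightarrow> weakly_universal \<Gamma> B (u B)"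
  shows "right_kan_extension (NExt \<Gamma>) C (Gp X) (CodF \<Gamma>) (Gal \<Gamma>) (pi1 \<Gamma> u) (kappa \<Gamma> u)"
proof (rule right_kan_extension_from_lifts[OF functor_CodF functor_Gal])
  have un: "normal_extension \<Gamma> (u B)" "Cod C (u B) = B" if "B \<in> Obj C" for B
    using u[OF that] unfolding weakly_universal_def by simp_all
  show "on_arr (Gal \<Gamma>) s = on_arr (Gal \<Gamma>) t"
    if st: "s \<in> Arr (NExt \<Gamma>)" "t \<in> Arr (NExt \<Gamma>)" "Dom (NExt \<Gamma>) s = Dom (NExt \<Gamma>) t"
      "Cod (NExt \<Gamma>) s = Cod (NExt \<Gamma>) t" "on_arr (CodF \<Gamma>) s = on_arr (CodF \<Gamma>) t" for s t
  proof -
    obtain p f b p' where s: "s = (p, (f, b), p')" by (metis prod.exhaust)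
    obtain q g a q' where t: "t = (q, (g, a), q')" by (metis prod.exhaust)
    have eq: "q = p" "q' = p'" "a = b" using st(3-5) by (simp_all add: s t NExt_simps CodF_def)
    have "galois_map p f p' = galois_map p g p'"
      by (rule galois_map_eq) (use st(1,2) in \<open>simp_all add: s t eq\<close>)
    then show ?thesis by (simp add: s t eq Gal_simps)
  qed
  show "u c \<in> Obj (NExt \<Gamma>) \<and> on_obj (CodF \<Gamma>) (u c) = c" if "c \<in> Obj C" for c
    using un[OF that] by (simp add: Obj_NExt CodF_def)
  show "on_obj (pi1 \<Gamma> u) c = on_obj (Gal \<Gamma>) (u c)" for c
    by (simp add: pi1_def)
  show "\<exists>s \<in> hom (NExt \<Gamma>) (u (Dom C f)) (u (Cod C f)). on_arr (CodF \<Gamma>) s = f \<and> on_arr (pi1 \<Gamma> u) f = on_arr (Gal \<Gamma>) s"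
    if f: "f \<in> Arr C" for f
  proof -
    let ?v = "u (Dom C f)" and ?w = "u (Cod C f)"
    define g where "g = (SOME g. (?v, (g, f), ?w) \<in> Arr (NExt \<Gamma>))"
    obtain g' where "(?v, (g', f), ?w) \<in> Arr (NExt \<Gamma>)"
      using weakly_universal_lift[OF u un f] f by auto
    then have "(?v, (g, f), ?w) \<in> Arr (NExt \<Gamma>)" unfolding g_def by (rule someI)
    moreover have "on_arr (pi1 \<Gamma> u) f = on_arr (Gal \<Gamma>) (?v, (g, f), ?w)"
      by (simp add: pi1_def Let_def g_def)
    ultimately show ?thesis by (intro bexI[of _ "(?v, (g, f), ?w)"]) (simp_all add: NExt_simps CodF_def)
  qed
  show "\<exists>s \<in> hom (NExt \<Gamma>) (u (on_obj (CodF \<Gamma>) p)) p.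
      on_arr (CodF \<Gamma>) s = Ide C (on_obj (CodF \<Gamma>) p) \<and> kappa \<Gamma> u p = on_arr (Gal \<Gamma>) s"
    if "p \<in> Obj (NExt \<Gamma>)" for p
  proof -
    have p: "normal_extension \<Gamma> p" using that by (simp add: Obj_NExt)
    let ?B = "Cod C p"
    have pa: "p \<in> Arr C" and B: "?B \<in> Obj C" using normal_extension_arr[OF p] by simp_all
    note uB = un[OF B] and ua = normal_extension_arr[OF un(1)[OF B]]
    define h where "h = (SOME h. h \<in> hom C (Dom C (u ?B)) (Dom C p) \<and> p \<cdot> h = u ?B)"
    have "\<exists>h. h \<in> hom C (Dom C (u ?B)) (Dom C p) \<and> p \<cdot> h = u ?B"
      using u[OF B] p unfolding weakly_universal_def Gamma by blast
    then have h: "h \<in> hom C (Dom C (u ?B)) (Dom C p) \<and> p \<cdot> h = u ?B" unfolding h_def by (rule someI_ex)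
    then have "(u ?B, (h, Ide C ?B), p) \<in> Arr (NExt \<Gamma>)"
      using p uB ua B by (simp add: Arr_NExt)
    moreover have "kappa \<Gamma> u p = on_arr (Gal \<Gamma>) (u ?B, (h, Ide C ?B), p)"
      by (simp add: kappa_def Let_def h_def)
    ultimately show ?thesis
      by (intro bexI[of _ "(u ?B, (h, Ide C ?B), p)"]) (simp_all add: NExt_simps CodF_def)
  qed
qed

end

text \<open>
  The factorization of \<open>f : a \<rightarrow> x\<close> through \<open>\<eta> a\<close> is \<open>\<epsilon> x \<cdot> I f\<close>. It is unique since \<open>k = \<epsilon> x \<cdot> I (k \<cdot> \<eta> a)\<close> for
  every \<open>k : I a \<rightarrow> x\<close>.
\<close>

lemma reflective_subcategory_of_adjunction:
  assumes adj: "adjunction C X I H \<eta> \<epsilon>" and incl: "full_subcategory_inclusion C X H"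
    and "finitely_complete C" and "pointed C"
  shows "reflective_subcategory C X (on_obj I) (on_arr I) \<eta>"
proof -
  have I: "is_functor C X I" and H: "is_functor X C H" and eta: "nat_trans C C id_func (comp_func H I) \<eta>"
    and eps: "nat_trans X X (comp_func I H) id_func \<epsilon>"
    and tri1: "\<And>a. a \<in> Obj C \<Longrightarrow> \<epsilon> (on_obj I a) \<cdot>\<^bsub>X\<^esub> on_arr I (\<eta> a) = Ide X (on_obj I a)"
    and tri2: "\<And>x. x \<in> Obj X \<Longrightarrow> on_arr H (\<epsilon> x) \<cdot>\<^bsub>C\<^esub> \<eta> (on_obj H x) = Ide C (on_obj H x)"
    using adj unfolding adjunction_def by blast+
  interpret C: small_category C using I by unfold_locales (simp add: is_functor_def)
  interpret X: small_category X using I by unfold_locales (simp add: is_functor_def)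
  note inc = incl[unfolded full_subcategory_inclusion_def]
  have Arr_X: "f \<in> Arr X \<longleftrightarrow> f \<in> Arr C \<and> Dom C f \<in> Obj X \<and> Cod C f \<in> Obj X" for f using inc by blast
  have Ob: "x \<in> Obj C" if "x \<in> Obj X" for x using inc that by blast
  have DC: "Dom X f = Dom C f" "Cod X f = Cod C f" "on_arr H f = f" if "f \<in> Arr X" for f using inc that by blast+
  have Hx: "on_obj H x = x" "Ide X x = Ide C x" if "x \<in> Obj X" for x using inc that by blast+
  have Comp: "g \<cdot>\<^bsub>X\<^esub> f = g \<cdot>\<^bsub>C\<^esub> f" if "f \<in> Arr X" "g \<in> Arr X" "Dom C g = Cod C f" for f g using inc that by blast
  have Io: "on_obj I a \<in> Obj X" if "a \<in> Obj C" for a using I that unfolding is_functor_def by blast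
  have Ia: "on_arr I f \<in> Arr X" "Dom C (on_arr I f) = on_obj I (Dom C f)" "Cod C (on_arr I f) = on_obj I (Cod C f)"
    if "f \<in> Arr C" for f
  proof -
    have h: "on_arr I f \<in> hom X (on_obj I (Dom C f)) (on_obj I (Cod C f))"
      using I that unfolding is_functor_def by blast
    then show "on_arr I f \<in> Arr X" by simp
    from DC[OF this] h show "Dom C (on_arr I f) = on_obj I (Dom C f)" "Cod C (on_arr I f) = on_obj I (Cod C f)"
      by simp_all
  qed
  have IaC: "on_arr I f \<in> Arr C" if "f \<in> Arr C" for f using Ia[OF that] Arr_X by blast
  have Icomp: "on_arr I (g \<cdot>\<^bsub>C\<^esub> f) = on_arr I g \<cdot>\<^bsub>C\<^esub> on_arr I f"
    if "f \<in> Arr C" "g \<in> Arr C" "Dom C g = Cod C f" for f g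
  proof -
    have "on_arr I (g \<cdot>\<^bsub>C\<^esub> f) = on_arr I g \<cdot>\<^bsub>X\<^esub> on_arr I f" using I that unfolding is_functor_def by blast
    then show ?thesis using Comp[of "on_arr I f" "on_arr I g"] Ia[OF that(1)] Ia[OF that(2)] that(3) by simp
  qed
  have eta_arr: "\<eta> a \<in> hom C a (on_obj I a)" if "a \<in> Obj C" for a
  proof -
    have "\<eta> a \<in> hom C a (on_obj H (on_obj I a))"
      using eta that unfolding nat_trans_def id_func_def comp_func_def by simp
    then show ?thesis unfolding Hx[OF Io[OF that]] .
  qed
  have eta_nat: "on_arr I f \<cdot>\<^bsub>C\<^esub> \<eta> (Dom C f) = \<eta> (Cod C f) \<cdot>\<^bsub>C\<^esub> f" if "f \<in> Arr C" for f
  proof -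
    have "\<eta> (Cod C f) \<cdot>\<^bsub>C\<^esub> f = on_arr H (on_arr I f) \<cdot>\<^bsub>C\<^esub> \<eta> (Dom C f)"
      using eta that unfolding nat_trans_def id_func_def comp_func_def by simp
    then show ?thesis unfolding DC(3)[OF Ia(1)[OF that]] by simp
  qed
  have eps_arr: "\<epsilon> x \<in> Arr X" "\<epsilon> x \<in> Arr C" "Dom C (\<epsilon> x) = on_obj I x" "Cod C (\<epsilon> x) = x" if x: "x \<in> Obj X" for x
  proof -
    have h: "\<epsilon> x \<in> hom X (on_obj I (on_obj H x)) x"
      using eps x unfolding nat_trans_def id_func_def comp_func_def by simp
    then show e: "\<epsilon> x \<in> Arr X" by simp
    then show "\<epsilon> x \<in> Arr C" using Arr_X by blast
    show "Dom C (\<epsilon> x) = on_obj I x" "Cod C (\<epsilon> x) = x" using DC[OF e] h Hx[OF x] by simp_all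
  qed
  have eps_nat: "\<epsilon> (Cod C f) \<cdot>\<^bsub>C\<^esub> on_arr I f = f \<cdot>\<^bsub>C\<^esub> \<epsilon> (Dom C f)" if f: "f \<in> Arr X" for f
  proof -
    have fC: "f \<in> Arr C" "Dom C f \<in> Obj X" "Cod C f \<in> Obj X" using f Arr_X by blast+
    have "\<epsilon> (Cod X f) \<cdot>\<^bsub>X\<^esub> on_arr I (on_arr H f) = f \<cdot>\<^bsub>X\<^esub> \<epsilon> (Dom X f)"
      using eps f unfolding nat_trans_def id_func_def comp_func_def by simp
    then have "\<epsilon> (Cod C f) \<cdot>\<^bsub>X\<^esub> on_arr I f = f \<cdot>\<^bsub>X\<^esub> \<epsilon> (Dom C f)" unfolding DC[OF f] .
    moreover have "\<epsilon> (Cod C f) \<cdot>\<^bsub>X\<^esub> on_arr I f = \<epsilon> (Cod C f) \<cdot>\<^bsub>C\<^esub> on_arr I f"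
      by (rule Comp) (use eps_arr[OF fC(3)] Ia[OF fC(1)] in simp_all)
    moreover have "f \<cdot>\<^bsub>X\<^esub> \<epsilon> (Dom C f) = f \<cdot>\<^bsub>C\<^esub> \<epsilon> (Dom C f)"
      by (rule Comp) (use eps_arr[OF fC(2)] f in simp_all)
    ultimately show ?thesis by simp
  qed
  have tri1': "\<epsilon> (on_obj I a) \<cdot>\<^bsub>C\<^esub> on_arr I (\<eta> a) = Ide C (on_obj I a)" if a: "a \<in> Obj C" for a
  proof -
    have "\<epsilon> (on_obj I a) \<cdot>\<^bsub>X\<^esub> on_arr I (\<eta> a) = \<epsilon> (on_obj I a) \<cdot>\<^bsub>C\<^esub> on_arr I (\<eta> a)"
      by (rule Comp) (use eps_arr[OF Io[OF a]] Ia[of "\<eta> a"] eta_arr[OF a] in simp_all)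
    then show ?thesis using tri1[OF a] Hx(2)[OF Io[OF a]] by simp
  qed
  have tri2': "\<epsilon> x \<cdot>\<^bsub>C\<^esub> \<eta> x = Ide C x" if x: "x \<in> Obj X" for x
    using tri2[OF x] unfolding Hx(1)[OF x] DC(3)[OF eps_arr(1)[OF x]] .
  show ?thesis
  proof unfold_locales
    show "pointed C" "finitely_complete C" "category X" by (fact assms X.category)+
    show "Obj X \<subseteq> Obj C" using Ob by blast
    show "f \<in> Arr X \<longleftrightarrow> f \<in> Arr C \<and> Dom C f \<in> Obj X \<and> Cod C f \<in> Obj X" for f by (rule Arr_X)
    show "Dom X f = Dom C f" "Cod X f = Cod C f" if "f \<in> Arr X" for f using DC[OF that] by simp_all
    show "Ide X x = Ide C x" if "x \<in> Obj X" for x by (rule Hx[OF that])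
    show "g \<cdot>\<^bsub>X\<^esub> f = g \<cdot>\<^bsub>C\<^esub> f" if "f \<in> Arr X" "g \<in> Arr X" "Dom C g = Cod C f" for f g by (rule Comp[OF that])
    show "on_obj I a \<in> Obj X" if "a \<in> Obj C" for a by (rule Io[OF that])
    show "on_arr I f \<in> hom C (on_obj I (Dom C f)) (on_obj I (Cod C f))" if "f \<in> Arr C" for f
      using Ia[OF that] IaC[OF that] by simp
    show "on_arr I (Ide C a) = Ide C (on_obj I a)" if a: "a \<in> Obj C" for a
      using I a Hx(2)[OF Io[OF a]] unfolding is_functor_def by simp
    show "on_arr I (g \<cdot>\<^bsub>C\<^esub> f) = on_arr I g \<cdot>\<^bsub>C\<^esub> on_arr I f"
      if "f \<in> Arr C" "g \<in> Arr C" "Dom C g = Cod C f" for f g by (rule Icomp[OF that])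
    show "\<eta> a \<in> hom C a (on_obj I a)" if "a \<in> Obj C" for a by (rule eta_arr[OF that])
    show "on_arr I f \<cdot>\<^bsub>C\<^esub> \<eta> (Dom C f) = \<eta> (Cod C f) \<cdot>\<^bsub>C\<^esub> f" if "f \<in> Arr C" for f by (rule eta_nat[OF that])
    show "\<exists>h. h \<in> hom C (on_obj I (Dom C f)) (Cod C f) \<and> h \<cdot>\<^bsub>C\<^esub> \<eta> (Dom C f) = f"
      if f: "f \<in> Arr C" "Cod C f \<in> Obj X" for f
    proof (intro exI conjI)
      let ?h = "\<epsilon> (Cod C f) \<cdot>\<^bsub>C\<^esub> on_arr I f"
      note e = eps_arr[OF f(2)] and a = Ia[OF f(1)] IaC[OF f(1)] and n = eta_arr[of "Dom C f"] eta_arr[of "Cod C f"]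
      show "?h \<in> hom C (on_obj I (Dom C f)) (Cod C f)" using e a by simp
      have "?h \<cdot>\<^bsub>C\<^esub> \<eta> (Dom C f) = \<epsilon> (Cod C f) \<cdot>\<^bsub>C\<^esub> (on_arr I f \<cdot>\<^bsub>C\<^esub> \<eta> (Dom C f))"
        by (rule C.assoc) (use e a n f in simp_all)
      also have "\<dots> = \<epsilon> (Cod C f) \<cdot>\<^bsub>C\<^esub> (\<eta> (Cod C f) \<cdot>\<^bsub>C\<^esub> f)" unfolding eta_nat[OF f(1)] ..
      also have "\<dots> = Ide C (Cod C f) \<cdot>\<^bsub>C\<^esub> f"
        by (rule C.comp_cong_left[OF tri2'[OF f(2)]]) (use e n f in simp_all)
      finally show "?h \<cdot>\<^bsub>C\<^esub> \<eta> (Dom C f) = f" using f by simp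
    qed
    show "h' = h"
      if a: "a \<in> Obj C" and h: "h \<in> Arr C" "h' \<in> Arr C" "Dom C h = on_obj I a" "Dom C h' = on_obj I a"
        "Cod C h \<in> Obj X" "Cod C h' = Cod C h" and eq: "h' \<cdot>\<^bsub>C\<^esub> \<eta> a = h \<cdot>\<^bsub>C\<^esub> \<eta> a" for a h h'
    proof -
      have "k = \<epsilon> (Cod C k) \<cdot>\<^bsub>C\<^esub> on_arr I (k \<cdot>\<^bsub>C\<^esub> \<eta> a)"
        if k: "k \<in> Arr C" "Dom C k = on_obj I a" "Cod C k \<in> Obj X" for k
      proof -
        note n = eta_arr[OF a] and ea = eps_arr[OF Io[OF a]] and ek = eps_arr[OF k(3)] and Ik = Ia[OF k(1)] IaC[OF k(1)]
        have In: "on_arr I (\<eta> a) \<in> Arr C" "Dom C (on_arr I (\<eta> a)) = on_obj I a"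
          "Cod C (on_arr I (\<eta> a)) = on_obj I (on_obj I a)"
          using Ia[of "\<eta> a"] IaC[of "\<eta> a"] n by simp_all
        have kX: "k \<in> Arr X" using k Io[OF a] Arr_X by simp
        have "\<epsilon> (Cod C k) \<cdot>\<^bsub>C\<^esub> on_arr I (k \<cdot>\<^bsub>C\<^esub> \<eta> a) = \<epsilon> (Cod C k) \<cdot>\<^bsub>C\<^esub> (on_arr I k \<cdot>\<^bsub>C\<^esub> on_arr I (\<eta> a))"
          using Icomp[of "\<eta> a" k] n k by simp
        also have "\<dots> = k \<cdot>\<^bsub>C\<^esub> (\<epsilon> (Dom C k) \<cdot>\<^bsub>C\<^esub> on_arr I (\<eta> a))"
          by (rule C.comp_swap_left[OF eps_nat[OF kX]]) (use Ik ek ea In k in simp_all)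
        also have "\<dots> = k" unfolding k(2) tri1'[OF a] using k by simp
        finally show ?thesis by simp
      qed
      from this[of h] this[of h'] show ?thesis using h eq by simp
    qed
  qed
qed

theorem theorem5p1:
  fixes \<Gamma> :: "('o, 'm, 'o, 'm) galois_structure" and u :: "'o \<Rightarrow> 'm"
  assumes "is_galois_structure \<Gamma>"
    and "admissible \<Gamma>"
    and "finitely_complete (baseC \<Gamma>)"
    and "pointed (baseC \<Gamma>)"
    and "full_subcategory_inclusion (baseC \<Gamma>) (baseX \<Gamma>) (functH \<Gamma>)"
    and "pullback_stable (baseC \<Gamma>) {p. monadic_extension \<Gamma> p}"
    and "\<And>B. B \<in> Obj (baseC \<Gamma>) \<Longrightarrow> weakly_universal \<Gamma> B (u B)"
  shows "right_kan_extension (NExt \<Gamma>) (baseC \<Gamma>) (Gp (baseX \<Gamma>))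
           (CodF \<Gamma>) (Gal \<Gamma>) (pi1 \<Gamma> u) (kappa \<Gamma> u)"
proof -
  note gs = assms(1)[unfolded is_galois_structure_def Let_def]
  from gs have adj: "adjunction (baseC \<Gamma>) (baseX \<Gamma>) (functI \<Gamma>) (functH \<Gamma>) (unitG \<Gamma>) (counitG \<Gamma>)"
    by (elim conjE)
  from gs have E: "classE \<Gamma> \<subseteq> Arr (baseC \<Gamma>)" by (elim conjE)
  from gs have F: "classF \<Gamma> \<subseteq> Arr (baseX \<Gamma>)" by (elim conjE)
  from gs have E_stable: "pullback_stable (baseC \<Gamma>) (classE \<Gamma>)" by (elim conjE)
  from gs have F_stable: "pullback_stable (baseX \<Gamma>) (classF \<Gamma>)" by (elim conjE)
  from gs have HF: "on_arr (functH \<Gamma>) ` classF \<Gamma> \<subseteq> classE \<Gamma>" by (elim conjE)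
  from gs have IE: "on_arr (functI \<Gamma>) ` classE \<Gamma> \<subseteq> classF \<Gamma>" by (elim conjE)
  have H: "on_arr (functH \<Gamma>) f = f" if "f \<in> Arr (baseX \<Gamma>)" for f
    using assms(5) that unfolding full_subcategory_inclusion_def by blast
  interpret R: reflective_subcategory "baseC \<Gamma>" "baseX \<Gamma>" "on_obj (functI \<Gamma>)" "on_arr (functI \<Gamma>)" "unitG \<Gamma>"
    by (rule reflective_subcategory_of_adjunction[OF adj assms(5,3,4)])
  interpret admissible_galois_structure "baseC \<Gamma>" "baseX \<Gamma>" "on_obj (functI \<Gamma>)" "on_arr (functI \<Gamma>)" "unitG \<Gamma>" \<Gamma>
  proof unfold_locales
    show "f \<in> classE \<Gamma>" if f: "f \<in> classF \<Gamma>" for f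
    proof -
      have "on_arr (functH \<Gamma>) f \<in> classE \<Gamma>" using HF f by (rule subsetD[OF _ imageI])
      then show ?thesis unfolding H[OF subsetD[OF F f]] .
    qed
    show "on_arr (functI \<Gamma>) f \<in> classF \<Gamma>" if "f \<in> classE \<Gamma>" for f
      using IE that by (rule subsetD[OF _ imageI])
  qed (assumption | rule refl assms(2,6) E_stable F_stable H subsetD[OF E] subsetD[OF F])+
  show ?thesis by (rule pi1_kan_extension[OF assms(7)])
qed

end
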